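(* Let $(X,d)$ be a proper metric space equipped with a Radon measure $\mu$ whose support is $X$, and let $p\in[1,\infty)$. Let $E$ be a complex Banach space and let $B\subseteq \mathfrak{B}(L^p(X;E))$ be a Banach (i.e. norm-closed) subalgebra such that $C_b(X)BC_b(X)=B$ and $B$ is closed under block cutdowns. Then for $b\in B$ the following are equivalent: (i) $[b,f]=0$ for all $f\in \mathrm{VL}_\infty(X)$; (ii) $b$ is quasi-local; (iii) $[b,g]\in\mathcal{K}(X,B)$ for every $g\in C_h(X)$. If moreover $X$ has straight finite decomposition complexity, then these are also equivalent to: (iv) $b\in \mathrm{Roe}(X,B)$.
   Context: Setting. A metric space is proper if every bounded subset is pre-compact. A Radon measure on $X$ is a regular Borel measure that is finite on compact sets; its support is $X$ if every $x\in X$ has a neighbourhood of positive measure (full support). $L^p(X;E)=L^p(X,\mu;E)$ is the Bochner space of (classes of) Bochner measurable functions $\xi:X\to E$ with $\|\xi\|_p=(\int_X\|\xi(x)\|_E^p\,d\mu(x))^{1/p}<\infty$. $\mathfrak{B}(\cdot)$ denotes bounded linear operators. $C_b(X)$, $C_0(X)$ are the bounded continuous functions and the continuous functions vanishing at infinity (complex valued). $C_b(X)$ acts on $L^p(X;E)$ by pointwise multiplication, and $f\in C_b(X)$ is identified with the corresponding multiplication operator; $[a,f]=af-fa$. The closed unit ball of a Banach space $Y$ is denoted $Y_1$. Block cutdowns. For an equicontinuous family $(e_j)_{j\in J}$ of positive contractions in $C_b(X)$ with pairwise disjoint supports, put $\theta_{(e_j)_{j\in J}}(a)=\sum_{j\in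 J}e_jae_j$ for $a\in\mathfrak{B}(L^p(X;E))$, the sum converging in the strong operator topology. $B$ is closed under block cutdowns if $\theta_{(e_j)_{j\in J}}(B)\subseteq B$ for every such family. Quasi-locality. For $R\ge 0$, $a\in\mathfrak{B}(L^p(X;E))$ has propagation at most $R$ if $faf'=0$ for all $f,f'\in C_b(X)$ with $d(\mathrm{supp}(f),\mathrm{supp}(f'))>R$. For $\varepsilon>0$, $a$ has $\varepsilon$-propagation at most $R$ if $\|faf'\|<\varepsilon$ for all $f,f'\in C_b(X)_1$ with $d(\mathrm{supp}(f),\mathrm{supp}(f'))>R$. $a$ is quasi-local if for every $\varepsilon>0$ it has $\varepsilon$-propagation at most $R$ for some finite $R$. Algebras. $\mathrm{Roe}(X,B)$ (the $L^p$-Roe-like algebra) is the norm closure of the set of all operators in $B$ with finite propagation. $\mathcal{K}(X,B)$ is the norm closure of $C_0(X)BC_0(X)$ in $\mathfrak{B}(L^p(X;E))$. Higson functions. $C_h(X)$ is the set of $g\in C_b(X)$ such that for all $R>0$ and $\varepsilon>0$ there is a compact $A\subseteq X$ with $|g(x)-g(y)|<\varepsilon$ whenever $x,y\in X\setminus A$ and $d(x,y)<R$. Very Lipschitz sequences. $\mathrm{VL}(X)$ is the set of bounded sequences $(f_n)_{n\in\mathbb{N}}$ in $C_b(X)$ such that for every $L>0$ there is $n_0$ with $f_n$ $L$-Lipschitz for all $n\ge n_0$. $\mathrm{VL}_\infty(X)=\mathrm{VL}(X)/\{(f_n)\in \mathrm{VL}(X):\lim_n\|f_n\|=0\}$. For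 a Banach algebra $A$, $A_\infty=\ell^\infty(\mathbb{N},A)/\{(a_n):\lim_n\|a_n\|=0\}$. Both $\mathrm{VL}_\infty(X)$ and $B$ (via constant sequences) are viewed inside $\mathfrak{B}(L^p(X;E))_\infty$; thus $[b,f]=0$ for $f$ the class of $(f_n)$ means $\lim_n\|[b,f_n]\|=0$. Straight finite decomposition complexity. A metric family is a set of subsets of $X$ (with induced metrics). A family $(Y_j)_{j\in J}$ of subsets is $R$-disjoint if $d(Y_j,Y_{j'})>R$ for all $j\ne j'$. A subset $Z\subseteq X$ $R$-decomposes over a metric family $\mathcal{Y}$ if $Z=X_0\cup X_1$ where each $X_i$ ($i=0,1$) is the union of an $R$-disjoint family $(X_{ij})_j$ with all $X_{ij}\in\mathcal{Y}$. Write $\mathcal{X}\xrightarrow{R}\mathcal{Y}$ if every member of $\mathcal{X}$ $R$-decomposes over $\mathcal{Y}$. $X$ has straight finite decomposition complexity if for every sequence $0\le R_1<R_2<\cdots$ there exist $m\in\mathbb{N}$ and metric families $\{X\}=\mathcal{X}_0,\mathcal{X}_1,\ldots,\mathcal{X}_m$ of subsets of $X$ such that $\mathcal{X}_{i-1}\xrightarrow{R_i}\mathcal{X}_i$ for $i=1,\ldots,m$ and $\mathcal{X}_m$ is uniformly bounded (the diameters of its members have a finite supremum). *)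

theory Defs
  imports "HOL-Analysis.Analysis"
begin

section \<open>Complex Banach spaces\<close>

text \<open>The distribution only has real Banach spaces as a type class.\<close>

class complex_banach = banach +
  fixes scaleC :: "complex \<Rightarrow> 'a \<Rightarrow> 'a" (infixr \<open>*\<^sub>C\<close> 75)
  assumes scaleC_add_right: "a *\<^sub>C (x + y) = a *\<^sub>C x + a *\<^sub>C y"
    and scaleC_add_left: "(a + b) *\<^sub>C x = a *\<^sub>C x + b *\<^sub>C x"
    and scaleC_scaleC: "a *\<^sub>C b *\<^sub>C x = (a * b) *\<^sub>C x"
    and scaleC_one: "1 *\<^sub>C x = x"
    and scaleR_scaleC: "r *\<^sub>R x = complex_of_real r *\<^sub>C x"
    and norm_scaleC: "norm (a *\<^sub>C x) = cmod a * norm x"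


section \<open>The space and the measure\<close>

definition proper_space :: "'x::metric_space set \<Rightarrow> bool" where
  "proper_space X \<longleftrightarrow> (\<forall>S\<subseteq>X. bounded S \<longrightarrow> (\<exists>K\<subseteq>X. compact K \<and> S \<subseteq> K))"

definition radon_measure :: "'x::topological_space measure \<Rightarrow> bool" where
  "radon_measure M \<longleftrightarrow>
     sets M = sets borel \<and>
     (\<forall>K. compact K \<longrightarrow> emeasure M K < \<infinity>) \<and>
     (\<forall>A\<in>sets borel. emeasure M A = (INF U\<in>{U. open U \<and> A \<subseteq> U}. emeasure M U)) \<and>
     (\<forall>A\<in>sets borel. emeasure M A = (SUP K\<in>{K. compact K \<and> K \<subseteq> A}. emeasure M K))"

definition full_support :: "'x::topological_space measure \<Rightarrow> bool" where
  "full_support M \<longleftrightarrow> (\<forall>x U. open U \<and> x \<in> U \<longrightarrow> 0 < emeasure M U)"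


section \<open>Bochner spaces\<close>

text \<open>
  Elements of \<open>L\<^sup>p(X;E)\<close> are handled through their representatives: \<open>Lp M p\<close> is the set of all
  representatives, with the seminorm \<open>Lp_norm M p\<close>, and two representatives give the same element
  iff they agree almost everywhere.  The type \<open>'e\<close> need not be second countable, so
  measurability is Bochner (strong) measurability, and the norm is a nonnegative integral, which
  does not see the null set on which a representative may fail to be Borel.
\<close>

definition bochner_measurable :: "'x measure \<Rightarrow> ('x \<Rightarrow> 'e::real_normed_vector) \<Rightarrow> bool" where
  "bochner_measurable M \<xi> \<longleftrightarrow>
     (\<exists>s. (\<forall>n::nat. simple_function M (s n)) \<and> (AE x in M. (\<lambda>n. s n x) \<longlonglongrightarrow> \<xi> x))"

definition Lp :: "'x measure \<Rightarrow> real \<Rightarrow> ('x \<Rightarrow> 'e::real_normed_vector) set" where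
  "Lp M p = {\<xi>. bochner_measurable M \<xi> \<and> (\<integral>\<^sup>+x. ennreal (norm (\<xi> x) powr p) \<partial>M) < \<infinity>}"

definition Lp_norm :: "'x measure \<Rightarrow> real \<Rightarrow> ('x \<Rightarrow> 'e::real_normed_vector) \<Rightarrow> real" where
  "Lp_norm M p \<xi> = enn2real (\<integral>\<^sup>+x. ennreal (norm (\<xi> x) powr p) \<partial>M) powr (1 / p)"


section \<open>Bounded operators\<close>

type_synonym ('x, 'e) fun_op = "('x \<Rightarrow> 'e) \<Rightarrow> 'x \<Rightarrow> 'e"

text \<open>
  A bounded operator on \<open>L\<^sup>p(X;E)\<close> is likewise a map on representatives that is compatible with
  almost everywhere equality.  Two such maps \<open>a\<close>, \<open>b\<close> describe the same operator iff
  \<open>op_norm M p (op_diff a b) = 0\<close>.  A norm-closed set of operators in the sense of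
  \<open>op_closure\<close> is automatically saturated for this identification, so norm-closed sets of maps
  correspond exactly to norm-closed sets of operators.
\<close>

definition bounded_op :: "'x measure \<Rightarrow> real \<Rightarrow> ('x, 'e::complex_banach) fun_op \<Rightarrow> bool" where
  "bounded_op M p a \<longleftrightarrow>
     (\<forall>\<xi>\<in>Lp M p. a \<xi> \<in> Lp M p) \<and>
     (\<forall>\<xi>\<in>Lp M p. \<forall>\<eta>\<in>Lp M p. (AE x in M. \<xi> x = \<eta> x) \<longrightarrow> (AE x in M. a \<xi> x = a \<eta> x)) \<and>
     (\<forall>\<xi>\<in>Lp M p. \<forall>\<eta>\<in>Lp M p. AE x in M. a (\<lambda>y. \<xi> y + \<eta> y) x = a \<xi> x + a \<eta> x) \<and>
     (\<forall>c. \<forall>\<xi>\<in>Lp M p. AE x in M. a (\<lambda>y. c *\<^sub>C \<xi> y) x = c *\<^sub>C a \<xi> x) \<and>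
     (\<exists>K. \<forall>\<xi>\<in>Lp M p. Lp_norm M p (a \<xi>) \<le> K * Lp_norm M p \<xi>)"

definition op_norm :: "'x measure \<Rightarrow> real \<Rightarrow> ('x, 'e::complex_banach) fun_op \<Rightarrow> real" where
  "op_norm M p a = (SUP \<xi>\<in>{\<xi>\<in>Lp M p. Lp_norm M p \<xi> \<le> 1}. Lp_norm M p (a \<xi>))"

definition op_zero :: "('x, 'e::complex_banach) fun_op" where
  "op_zero = (\<lambda>\<xi> x. 0)"

definition op_add :: "('x, 'e::complex_banach) fun_op \<Rightarrow> ('x, 'e) fun_op \<Rightarrow> ('x, 'e) fun_op" where
  "op_add a b = (\<lambda>\<xi> x. a \<xi> x + b \<xi> x)"

definition op_diff :: "('x, 'e::complex_banach) fun_op \<Rightarrow> ('x, 'e) fun_op \<Rightarrow> ('x, 'e) fun_op" where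
  "op_diff a b = (\<lambda>\<xi> x. a \<xi> x - b \<xi> x)"

definition op_scale :: "complex \<Rightarrow> ('x, 'e::complex_banach) fun_op \<Rightarrow> ('x, 'e) fun_op" where
  "op_scale c a = (\<lambda>\<xi> x. c *\<^sub>C a \<xi> x)"

definition op_closure ::
  "'x measure \<Rightarrow> real \<Rightarrow> ('x, 'e::complex_banach) fun_op set \<Rightarrow> ('x, 'e) fun_op set" where
  "op_closure M p S =
     {a. bounded_op M p a \<and> (\<forall>\<epsilon>>0. \<exists>s\<in>S. op_norm M p (op_diff a s) < \<epsilon>)}"

definition banach_subalgebra ::
  "'x measure \<Rightarrow> real \<Rightarrow> ('x, 'e::complex_banach) fun_op set \<Rightarrow> bool" where
  "banach_subalgebra M p B \<longleftrightarrow>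
     B \<subseteq> Collect (bounded_op M p) \<and>
     op_zero \<in> B \<and>
     (\<forall>a\<in>B. \<forall>b\<in>B. op_add a b \<in> B) \<and>
     (\<forall>c. \<forall>a\<in>B. op_scale c a \<in> B) \<and>
     (\<forall>a\<in>B. \<forall>b\<in>B. a \<circ> b \<in> B) \<and>
     op_closure M p B = B"


section \<open>Multiplication operators\<close>

definition mult_op :: "('x::topological_space \<Rightarrow>\<^sub>C complex) \<Rightarrow> ('x, 'e::complex_banach) fun_op" where
  "mult_op f = (\<lambda>\<xi> x. f x *\<^sub>C \<xi> x)"

definition commutator ::
  "('x::topological_space, 'e::complex_banach) fun_op \<Rightarrow> ('x \<Rightarrow>\<^sub>C complex) \<Rightarrow> ('x, 'e) fun_op" where
  "commutator a f = op_diff (a \<circ> mult_op f) (mult_op f \<circ> a)"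

definition sandwich ::
  "('x::topological_space \<Rightarrow>\<^sub>C complex) set \<Rightarrow> ('x, 'e::complex_banach) fun_op set \<Rightarrow> ('x, 'e) fun_op set"
where
  "sandwich F B = {mult_op f \<circ> b \<circ> mult_op g | f b g. f \<in> F \<and> b \<in> B \<and> g \<in> F}"

definition supp :: "('x::topological_space \<Rightarrow>\<^sub>C complex) \<Rightarrow> 'x set" where
  "supp f = closure {x. f x \<noteq> 0}"

definition C0 :: "('x::topological_space \<Rightarrow>\<^sub>C complex) set" where
  "C0 = {f :: _ \<Rightarrow>\<^sub>C complex. \<forall>\<epsilon>>0. \<exists>K. compact K \<and> (\<forall>x. x \<notin> K \<longrightarrow> cmod (f x) < \<epsilon>)}"


section \<open>Block cutdowns\<close>

text \<open>
  Members of a family with pairwise disjoint supports are distinct unless they vanish, and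
  vanishing members do not contribute to \<open>\<Sum>\<^sub>j e\<^sub>j a e\<^sub>j\<close>; hence a family is given by
  the set \<open>F\<close> of its members.
\<close>

definition cutdown_family :: "('x::metric_space \<Rightarrow>\<^sub>C complex) set \<Rightarrow> bool" where
  "cutdown_family F \<longleftrightarrow>
     (\<forall>e\<in>F. (\<forall>x. apply_bcontfun e x \<in> \<real>\<^sub>\<ge>\<^sub>0) \<and> norm e \<le> 1) \<and>
     (\<forall>x. \<forall>\<epsilon>>0. \<exists>\<delta>>0. \<forall>e\<in>F. \<forall>y. dist x y < \<delta> \<longrightarrow> cmod (apply_bcontfun e x - apply_bcontfun e y) < \<epsilon>) \<and>
     pairwise (\<lambda>e e'. supp e \<inter> supp e' = {}) F"

text \<open>
  \<open>is_block_cutdown M p F a c\<close> says \<open>c = \<theta>\<^sub>F(a)\<close>: the finite partial sums of \<open>e a e\<close>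
  converge to \<open>c\<close> in the strong operator topology.
\<close>

definition is_block_cutdown ::
  "'x::metric_space measure \<Rightarrow> real \<Rightarrow> ('x \<Rightarrow>\<^sub>C complex) set \<Rightarrow>
     ('x, 'e::complex_banach) fun_op \<Rightarrow> ('x, 'e) fun_op \<Rightarrow> bool" where
  "is_block_cutdown M p F a c \<longleftrightarrow>
     bounded_op M p c \<and>
     (\<forall>\<xi>\<in>Lp M p.
        ((\<lambda>G. Lp_norm M p (\<lambda>x. (\<Sum>e\<in>G. (mult_op e \<circ> a \<circ> mult_op e) \<xi> x) - c \<xi> x)) \<longlongrightarrow> 0)
          (finite_subsets_at_top F))"

definition closed_under_block_cutdowns ::
  "'x::metric_space measure \<Rightarrow> real \<Rightarrow> ('x, 'e::complex_banach) fun_op set \<Rightarrow> bool" where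
  "closed_under_block_cutdowns M p B \<longleftrightarrow>
     (\<forall>F. cutdown_family F \<longrightarrow> (\<forall>a\<in>B. \<forall>c. is_block_cutdown M p F a c \<longrightarrow> c \<in> B))"


section \<open>Propagation and quasi-locality\<close>

text \<open>
  \<open>far_apart R S T\<close> is \<open>d(S,T) > R\<close> with the convention \<open>d(S,T) = \<infinity>\<close> if one of the sets is
  empty, whereas \<open>setdist\<close> is \<open>0\<close> in that case.
\<close>

definition far_apart :: "real \<Rightarrow> 'x::metric_space set \<Rightarrow> 'x set \<Rightarrow> bool" where
  "far_apart R S T \<longleftrightarrow> S = {} \<or> T = {} \<or> R < setdist S T"

definition propagation_le ::
  "'x::metric_space measure \<Rightarrow> real \<Rightarrow> ('x, 'e::complex_banach) fun_op \<Rightarrow> real \<Rightarrow> bool" where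
  "propagation_le M p a R \<longleftrightarrow>
     (\<forall>f f'. far_apart R (supp f) (supp f') \<longrightarrow>
        (\<forall>\<xi>\<in>Lp M p. AE x in M. (mult_op f \<circ> a \<circ> mult_op f') \<xi> x = 0))"

definition eps_propagation_le ::
  "'x::metric_space measure \<Rightarrow> real \<Rightarrow> real \<Rightarrow> ('x, 'e::complex_banach) fun_op \<Rightarrow> real \<Rightarrow> bool" where
  "eps_propagation_le M p \<epsilon> a R \<longleftrightarrow>
     (\<forall>f f'. norm f \<le> 1 \<and> norm f' \<le> 1 \<and> far_apart R (supp f) (supp f') \<longrightarrow>
        op_norm M p (mult_op f \<circ> a \<circ> mult_op f') < \<epsilon>)"

definition quasi_local ::
  "'x::metric_space measure \<Rightarrow> real \<Rightarrow> ('x, 'e::complex_banach) fun_op \<Rightarrow> bool" where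
  "quasi_local M p a \<longleftrightarrow> (\<forall>\<epsilon>>0. \<exists>R\<ge>0. eps_propagation_le M p \<epsilon> a R)"

definition Roe ::
  "'x::metric_space measure \<Rightarrow> real \<Rightarrow> ('x, 'e::complex_banach) fun_op set \<Rightarrow> ('x, 'e) fun_op set" where
  "Roe M p B = op_closure M p {a\<in>B. \<exists>R\<ge>0. propagation_le M p a R}"

definition K_ideal ::
  "'x::metric_space measure \<Rightarrow> real \<Rightarrow> ('x, 'e::complex_banach) fun_op set \<Rightarrow> ('x, 'e) fun_op set" where
  "K_ideal M p B = op_closure M p (sandwich C0 B)"


section \<open>Higson functions and very Lipschitz sequences\<close>

definition higson :: "('x::metric_space \<Rightarrow>\<^sub>C complex) set" where
  "higson = {g :: _ \<Rightarrow>\<^sub>C complex. \<forall>R>0. \<forall>\<epsilon>>0. \<exists>A. compact A \<and>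
     (\<forall>x y. x \<notin> A \<and> y \<notin> A \<and> dist x y < R \<longrightarrow> cmod (g x - g y) < \<epsilon>)}"

definition VL :: "(nat \<Rightarrow> 'x::metric_space \<Rightarrow>\<^sub>C complex) set" where
  "VL = {f :: nat \<Rightarrow> _ \<Rightarrow>\<^sub>C complex. bounded (range f) \<and>
     (\<forall>L>0. \<exists>n0. \<forall>n\<ge>n0. L-lipschitz_on UNIV (apply_bcontfun (f n)))}"

text \<open>
  \<open>[b,f] = 0\<close> in \<open>\<BB>(L\<^sup>p(X;E))\<^sub>\<infinity>\<close>, where \<open>f\<close> is the class of the sequence \<open>(f n)\<close>
  and \<open>b\<close> is the class of a constant sequence.
\<close>

definition commutes_at_infinity ::
  "'x::metric_space measure \<Rightarrow> real \<Rightarrow> ('x, 'e::complex_banach) fun_op \<Rightarrow>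
     (nat \<Rightarrow> 'x \<Rightarrow>\<^sub>C complex) \<Rightarrow> bool" where
  "commutes_at_infinity M p b f \<longleftrightarrow> (\<lambda>n. op_norm M p (commutator b (f n))) \<longlonglongrightarrow> 0"


section \<open>Straight finite decomposition complexity\<close>

text \<open>
  An \<open>R\<close>-disjoint family is given by the set of its members; distinct members of an
  \<open>R\<close>-disjoint indexed family are distinct sets unless they are empty.
\<close>

definition decomposes_over :: "real \<Rightarrow> 'x::metric_space set \<Rightarrow> 'x set set \<Rightarrow> bool" where
  "decomposes_over R Z \<Y> \<longleftrightarrow>
     (\<exists>\<A>\<^sub>0 \<A>\<^sub>1. \<A>\<^sub>0 \<subseteq> \<Y> \<and> \<A>\<^sub>1 \<subseteq> \<Y> \<and>
        pairwise (far_apart R) \<A>\<^sub>0 \<and> pairwise (far_apart R) \<A>\<^sub>1 \<and>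
        Z = \<Union>\<A>\<^sub>0 \<union> \<Union>\<A>\<^sub>1)"

definition family_decomposes_over ::
  "real \<Rightarrow> 'x::metric_space set set \<Rightarrow> 'x set set \<Rightarrow> bool" where
  "family_decomposes_over R \<X> \<Y> \<longleftrightarrow> (\<forall>Z\<in>\<X>. decomposes_over R Z \<Y>)"

definition uniformly_bounded :: "'x::metric_space set set \<Rightarrow> bool" where
  "uniformly_bounded \<X> \<longleftrightarrow> (\<exists>D. \<forall>Y\<in>\<X>. \<forall>x\<in>Y. \<forall>y\<in>Y. dist x y \<le> D)"

definition straight_fdc :: "'x::metric_space set \<Rightarrow> bool" where
  "straight_fdc X \<longleftrightarrow>
     (\<forall>R::nat \<Rightarrow> real. 0 \<le> R 1 \<and> (\<forall>i\<ge>1. R i < R (Suc i)) \<longrightarrow>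
        (\<exists>m. \<exists>\<X>::nat \<Rightarrow> 'x set set.
           \<X> 0 = {X} \<and> (\<forall>i\<le>m. \<X> i \<subseteq> Pow X) \<and>
           (\<forall>i\<in>{1..m}. family_decomposes_over (R i) (\<X> (i - 1)) (\<X> i)) \<and>
           uniformly_bounded (\<X> m)))"

end

theory Submission
  imports Defs
begin

text \<open>
  For bounded \<open>b\<close>, commuting asymptotically with very Lipschitz sequences and having Higson
  commutators in \<open>\<K>(X,B)\<close> are both compared with quasi-locality.  If \<open>b\<close> is not quasi-local, it
  has large blocks between sets \<open>S\<^sub>n\<close> and \<open>T\<^sub>n\<close> at distance at least \<open>n\<close>, and the commutator with a
  function that is \<open>1\<close> on \<open>S\<^sub>n\<close> and \<open>0\<close> on \<open>T\<^sub>n\<close> has the same block up to sign.  Conversely, the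
  commutator of a quasi-local \<open>b\<close> with a function of small oscillation at a large scale is small:
  cut \<open>X\<close> into the level sets of the function.  For straight finite decomposition complexity, each
  decomposition step replaces a block-diagonal cutdown of \<open>b\<close> by two cutdowns over finer families;
  the error consists of commutators with flat functions and of off-diagonal parts, and the latter
  are controlled by averaging over all subsets of the index set.  After finitely many steps the
  blocks are uniformly bounded, so that the operator has finite propagation.
\<close>


section \<open>Bochner spaces\<close>

text \<open>Two kinds of cutoff are kept apart. Estimates use indicators of Borel sets: a
  quasi-local \<open>b\<close> may be cut to arbitrary Borel sets, because the pieces do not have to
  stay in \<open>B\<close>. Membership in \<open>B\<close> of the operators that approximate
  \<open>b\<close> in the Roe algebra comes from block cutdowns by equicontinuous families, so those
  are built from continuous functions. Every analytic estimate in the descent concerns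
  \<open>b\<close> itself, never an intermediate cutdown. Hence all scales can be fixed beforehand
  in terms of \<open>b\<close> and the allowed error, which is what the order of quantifiers in
  straight finite decomposition complexity demands. The number of blocks is unbounded, so no error
  may grow with it. Pieces between two disjoint families of sets are added in the p-norm without
  loss, and in the average over the subsets of an n-element set the 2^n terms meet the weight 4/2^n,
  which leaves the constant 4.\<close>

lemma bochner_measurable_cong_AE:
  assumes "bochner_measurable M \<xi>" "AE x in M. \<xi> x = \<eta> x"
  shows "bochner_measurable M \<eta>"
proof -
  obtain s where s: "\<forall>n::nat. simple_function M (s n)" "AE x in M. (\<lambda>n. s n x) \<longlonglongrightarrow> \<xi> x"
    using assms(1) unfolding bochner_measurable_def by blast
  have "AE x in M. (\<lambda>n. s n x) \<longlonglongrightarrow> \<eta> x"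
    using s(2) assms(2) by eventually_elim simp
  then show ?thesis using s(1) unfolding bochner_measurable_def by blast
qed

lemma bochner_measurable_zero: "bochner_measurable M (\<lambda>x. 0)"
  unfolding bochner_measurable_def by (rule exI[of _ "\<lambda>n x. 0"]) simp

lemma bochner_measurable_add:
  assumes "bochner_measurable M \<xi>" "bochner_measurable M \<eta>"
  shows "bochner_measurable M (\<lambda>x. \<xi> x + \<eta> x)"
proof -
  obtain s where s: "\<forall>n::nat. simple_function M (s n)" "AE x in M. (\<lambda>n. s n x) \<longlonglongrightarrow> \<xi> x"
    using assms(1) unfolding bochner_measurable_def by blast
  obtain t where t: "\<forall>n::nat. simple_function M (t n)" "AE x in M. (\<lambda>n. t n x) \<longlonglongrightarrow> \<eta> x"
    using assms(2) unfolding bochner_measurable_def by blast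
  have "simple_function M (\<lambda>x. s n x + t n x)" for n
    using s(1) t(1) by (intro simple_function_compose2[where h="(+)"]) auto
  moreover have "AE x in M. (\<lambda>n. s n x + t n x) \<longlonglongrightarrow> \<xi> x + \<eta> x"
    using s(2) t(2) by eventually_elim (rule tendsto_add)
  ultimately show ?thesis unfolding bochner_measurable_def
    by (intro exI[of _ "\<lambda>n x. s n x + t n x"]) simp
qed

section \<open>Complex scalar multiplication\<close>

lemma scaleC_zero_left [simp]: "0 *\<^sub>C (y::'e::complex_banach) = 0"
  using norm_scaleC[of 0 y] by simp

lemma scaleC_zero_right [simp]: "c *\<^sub>C (0::'e::complex_banach) = 0"
  using norm_scaleC[of c "0::'e"] by simp

lemma scaleC_minus_one: "(-1) *\<^sub>C (y::'e::complex_banach) = - y"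
  using scaleR_scaleC[of "-1" y] by simp

lemma scaleC_minus_right: "c *\<^sub>C (- y) = - (c *\<^sub>C (y::'e::complex_banach))"
  using scaleC_add_right[of c y "-y"] by (simp add: add_eq_0_iff2)

lemma scaleC_minus_left: "(- c) *\<^sub>C y = - (c *\<^sub>C (y::'e::complex_banach))"
  using scaleC_add_left[of c "-c" y] by (simp add: add_eq_0_iff)

lemma scaleC_diff_right: "c *\<^sub>C (x - y) = c *\<^sub>C x - c *\<^sub>C (y::'e::complex_banach)"
  using scaleC_add_right[of c x "- y"] by (simp add: scaleC_minus_right)

lemma scaleC_diff_left: "(c - d) *\<^sub>C y = c *\<^sub>C y - d *\<^sub>C (y::'e::complex_banach)"
  using scaleC_add_left[of c "- d" y] by (simp add: scaleC_minus_left)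

lemma scaleC_sum_right: "c *\<^sub>C (\<Sum>i\<in>I. f i) = (\<Sum>i\<in>I. c *\<^sub>C (f i ::'e::complex_banach))"
  by (induction I rule: infinite_finite_induct) (simp_all add: scaleC_add_right)

lemma tendsto_scaleC:
  fixes y :: "nat \<Rightarrow> 'e::complex_banach"
  assumes "c \<longlonglongrightarrow> c'" "y \<longlonglongrightarrow> y'"
  shows "(\<lambda>n. c n *\<^sub>C y n) \<longlonglongrightarrow> c' *\<^sub>C y'"
proof -
  have "(\<lambda>n. cmod (c n) * norm (y n - y') + cmod (c n - c') * norm y') \<longlonglongrightarrow> cmod c' * 0 + 0 * norm y'"
    using assms by (intro tendsto_intros) (auto simp: tendsto_norm_zero LIM_zero)
  then have *: "(\<lambda>n. cmod (c n) * norm (y n - y') + cmod (c n - c') * norm y') \<longlonglongrightarrow> 0" by simp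
  have "norm (c n *\<^sub>C y n - c' *\<^sub>C y') \<le> cmod (c n) * norm (y n - y') + cmod (c n - c') * norm y'" for n
  proof -
    have "c n *\<^sub>C y n - c' *\<^sub>C y' = c n *\<^sub>C (y n - y') + (c n - c') *\<^sub>C y'"
      by (simp add: scaleC_diff_left scaleC_diff_right)
    then show ?thesis by (metis norm_scaleC norm_triangle_ineq)
  qed
  then have "(\<lambda>n. c n *\<^sub>C y n - c' *\<^sub>C y') \<longlonglongrightarrow> 0"
    by (intro Lim_null_comparison[OF _ *] always_eventually allI)
  then show ?thesis using LIM_zero_iff by blast
qed

section \<open>Multiplication by functions and restriction to sets\<close>

definition cmul :: "('x \<Rightarrow> complex) \<Rightarrow> ('x \<Rightarrow> 'e::complex_banach) \<Rightarrow> 'x \<Rightarrow> 'e" where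
  "cmul h \<xi> = (\<lambda>x. h x *\<^sub>C \<xi> x)"

definition res :: "'x set \<Rightarrow> ('x \<Rightarrow> 'e::zero) \<Rightarrow> 'x \<Rightarrow> 'e" where
  "res V \<xi> = (\<lambda>x. if x \<in> V then \<xi> x else 0)"

lemma mult_op_cmul: "mult_op f = cmul (apply_bcontfun f)"
  by (simp add: mult_op_def cmul_def fun_eq_iff)

lemma res_cmul: "res V \<xi> = cmul (indicator V) \<xi>"
  by (auto simp: res_def cmul_def fun_eq_iff scaleC_one indicator_def)

lemma bochner_measurable_cmul:
  fixes \<xi> :: "'x \<Rightarrow> 'e::complex_banach"
  assumes "bochner_measurable M \<xi>" "h \<in> borel_measurable M"
  shows "bochner_measurable M (cmul h \<xi>)"
proof -
  obtain s where s: "\<forall>n::nat. simple_function M (s n)" "AE x in M. (\<lambda>n. s n x) \<longlonglongrightarrow> \<xi> x"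
    using assms(1) unfolding bochner_measurable_def by blast
  obtain t where t: "\<And>n::nat. simple_function M (t n)" "\<And>x. x \<in> space M \<Longrightarrow> (\<lambda>n. t n x) \<longlonglongrightarrow> h x"
    using borel_measurable_implies_sequence_metric[OF assms(2), of 0] by blast
  have "simple_function M (\<lambda>x. t n x *\<^sub>C s n x)" for n
    using s(1) t(1) by (intro simple_function_compose2[where h="scaleC"]) auto
  moreover have "AE x in M. (\<lambda>n. t n x *\<^sub>C s n x) \<longlonglongrightarrow> h x *\<^sub>C \<xi> x"
    using s(2) AE_space by eventually_elim (intro tendsto_scaleC t)
  ultimately show ?thesis unfolding bochner_measurable_def cmul_def
    by (intro exI[of _ "\<lambda>n x. t n x *\<^sub>C s n x"]) simp
qed

lemma bochner_measurable_res:
  fixes \<xi> :: "'x \<Rightarrow> 'e::complex_banach"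
  assumes "bochner_measurable M \<xi>" "V \<in> sets M"
  shows "bochner_measurable M (res V \<xi>)"
  unfolding res_cmul using assms by (intro bochner_measurable_cmul) auto

lemma bochner_measurable_sum:
  assumes "\<And>i. i \<in> I \<Longrightarrow> bochner_measurable M (\<xi> i)"
  shows "bochner_measurable M (\<lambda>x. \<Sum>i\<in>I. \<xi> i x)"
  using assms
  by (induction I rule: infinite_finite_induct)
     (auto intro: bochner_measurable_zero bochner_measurable_add)

text \<open>The norm of a representative may fail to be Borel on a null set. Integration rules that
  require measurability are applied to \<open>u\<close> instead.\<close>

lemma bochner_measurable_norm_rep:
  assumes "bochner_measurable M \<xi>"
  obtains u :: "'x \<Rightarrow> real" where "u \<in> borel_measurable M" "\<And>x. 0 \<le> u x" "AE x in M. norm (\<xi> x) = u x"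
proof -
  obtain s where s: "\<forall>n::nat. simple_function M (s n)" "AE x in M. (\<lambda>n. s n x) \<longlonglongrightarrow> \<xi> x"
    using assms(1) unfolding bochner_measurable_def by blast
  have "simple_function M (\<lambda>x. norm (s n x))" for n
    using s(1) by (intro simple_function_compose1[where g=norm]) auto
  then have "(\<lambda>x. lim (\<lambda>n. norm (s n x))) \<in> borel_measurable M"
    by (intro borel_measurable_lim_metric borel_measurable_simple_function)
  \<comment> \<open>Where the sequence diverges, \<open>lim\<close> is an unspecified real; the
    absolute value makes the function nonnegative everywhere.\<close>
  moreover have "AE x in M. norm (\<xi> x) = \<bar>lim (\<lambda>n. norm (s n x))\<bar>"
    using s(2) by eventually_elim (metis tendsto_norm limI abs_norm_cancel)
  ultimately show ?thesis by (intro that[of "\<lambda>x. \<bar>lim (\<lambda>n. norm (s n x))\<bar>"]) auto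
qed

text \<open>The range of \<open>\<xi>\<close> need not be separable, so pointwise limits have to be handled by
  hand; here the approximating simple functions are simply patched together.\<close>

lemma bochner_measurable_exhaust:
  fixes \<xi> :: "'x \<Rightarrow> 'e::complex_banach"
  assumes V: "\<And>n::nat. V n \<in> sets M" "incseq V" "(\<Union>n. V n) = space M"
    and bm: "\<And>n. bochner_measurable M (res (V n) \<xi>)"
  shows "bochner_measurable M \<xi>"
proof -
  have "\<forall>n. \<exists>s. (\<forall>k::nat. simple_function M (s k)) \<and> (AE x in M. (\<lambda>k. s k x) \<longlonglongrightarrow> res (V n) \<xi> x)"
    using bm unfolding bochner_measurable_def by blast
  then obtain s where "\<forall>n. (\<forall>k::nat. simple_function M (s n k)) \<and> (AE x in M. (\<lambda>k. s n k x) \<longlonglongrightarrow> res (V n) \<xi> x)"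
    by (rule choice[THEN exE])
  then have s: "\<And>n k. simple_function M (s n k)"
      "\<And>n. AE x in M. (\<lambda>k. s n k x) \<longlonglongrightarrow> res (V n) \<xi> x"
    by blast+
  define D where "D = disjointed V"
  have D: "D n \<in> sets M" "D n \<subseteq> V n" for n
    using V(1) sets.range_disjointed_sets[of V M] disjointed_subset[of V n]
    by (auto simp: D_def image_subset_iff)
  have UD: "(\<Union>n. D n) = space M" using V(3) by (simp add: D_def UN_disjointed_eq)
  have disj: "D m \<inter> D n = {}" if "m \<noteq> n" for m n
    using disjoint_family_disjointed[of V] that by (auto simp: D_def disjoint_family_on_def)
  \<comment> \<open>Stopping the sum at \<open>k\<close> keeps \<open>t k\<close> simple; at a point
    of \<open>D n\<close> it agrees with \<open>s n k\<close> as soon as \<open>k\<close> reaches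
    \<open>n\<close>.\<close>
  define t where "t k x = (\<Sum>n\<le>k. indicator (D n) x *\<^sub>C s n k x)" for k x
  have simp_t: "simple_function M (t k)" for k
    unfolding t_def
  proof (rule simple_function_sum)
    fix n show "simple_function M (\<lambda>x. indicator (D n) x *\<^sub>C s n k x)"
      by (rule simple_function_compose2[where h="scaleC", OF simple_function_indicator[OF D(1)] s(1)])
  qed
  have "AE x in M. \<forall>n. (\<lambda>k. s n k x) \<longlonglongrightarrow> res (V n) \<xi> x"
    using s(2) by (simp add: AE_all_countable)
  then have "AE x in M. (\<lambda>k. t k x) \<longlonglongrightarrow> \<xi> x"
    using AE_space
  proof eventually_elim
    case (elim x)
    then obtain n where n: "x \<in> D n" using UD by blast
    have ind: "indicator (D m) x = (if m = n then 1 else (0::complex))" for m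
      using disj[of m n] n by (auto simp: indicator_def)
    have "t k x = s n k x" if "k \<ge> n" for k
    proof -
      have "t k x = (\<Sum>m\<le>k. if m = n then s m k x else 0)"
        unfolding t_def by (intro sum.cong) (auto simp: ind scaleC_one)
      then show ?thesis using that by simp
    qed
    then have "eventually (\<lambda>k. s n k x = t k x) sequentially"
      by (intro eventually_sequentiallyI[of n]) simp
    moreover have "(\<lambda>k. s n k x) \<longlonglongrightarrow> \<xi> x"
      using elim(1)[rule_format, of n] n D(2)[of n] by (simp add: res_def subset_iff)
    ultimately show ?case by (rule Lim_transform_eventually[rotated])
  qed
  then show ?thesis using simp_t unfolding bochner_measurable_def by blast
qed

section \<open>The p-th power integral, Minkowski's inequality and block sums\<close>

text \<open>\<open>Lp_norm\<close> passes through \<open>enn2real\<close>, which sends infinity to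
  0. Finiteness therefore has to be settled at the level of this extended value before norms can be
  compared.\<close>

definition Ip :: "'x measure \<Rightarrow> real \<Rightarrow> ('x \<Rightarrow> 'e::real_normed_vector) \<Rightarrow> ennreal" where
  "Ip M p \<xi> = (\<integral>\<^sup>+x. ennreal (norm (\<xi> x) powr p) \<partial>M)"

lemma Lp_iff: "\<xi> \<in> Lp M p \<longleftrightarrow> bochner_measurable M \<xi> \<and> Ip M p \<xi> < \<infinity>"
  by (simp add: Lp_def Ip_def)

lemma Lp_norm_Ip: "Lp_norm M p \<xi> = enn2real (Ip M p \<xi>) powr (1 / p)"
  by (simp add: Lp_norm_def Ip_def)

lemma Lp_norm_nonneg [simp]: "0 \<le> Lp_norm M p \<xi>"
  by (simp add: Lp_norm_def)

lemma Ip_cong_AE: "AE x in M. norm (\<xi> x) = norm (\<eta> x) \<Longrightarrow> Ip M p \<xi> = Ip M p \<eta>"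
  unfolding Ip_def by (rule nn_integral_cong_AE) auto

lemma Lp_norm_cong_AE: "AE x in M. norm (\<xi> x) = norm (\<eta> x) \<Longrightarrow> Lp_norm M p \<xi> = Lp_norm M p \<eta>"
  unfolding Lp_norm_Ip by (simp add: Ip_cong_AE[of \<xi> \<eta>])

lemma Lp_cong_AE:
  assumes "\<xi> \<in> Lp M p" "AE x in M. \<xi> x = \<eta> x"
  shows "\<eta> \<in> Lp M p"
proof -
  have "AE x in M. norm (\<xi> x) = norm (\<eta> x)" using assms(2) by eventually_elim simp
  then show ?thesis
    using assms bochner_measurable_cong_AE[of M \<xi> \<eta>] Ip_cong_AE[of \<xi> \<eta> M p] by (simp add: Lp_iff)
qed

lemma Ip_eq_Lp_norm:
  assumes "\<xi> \<in> Lp M p" "1 \<le> p"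
  shows "Ip M p \<xi> = ennreal (Lp_norm M p \<xi> powr p)"
proof -
  have "Ip M p \<xi> = ennreal (enn2real (Ip M p \<xi>))"
    using assms by (simp add: Lp_iff less_top)
  also have "enn2real (Ip M p \<xi>) = Lp_norm M p \<xi> powr p"
    using assms(2) by (simp add: Lp_norm_Ip powr_powr)
  finally show ?thesis .
qed

lemma Lp_norm_le_iff:
  assumes "\<xi> \<in> Lp M p" "1 \<le> p" "0 \<le> K"
  shows "Lp_norm M p \<xi> \<le> K \<longleftrightarrow> Ip M p \<xi> \<le> ennreal (K powr p)"
proof -
  have "Ip M p \<xi> \<le> ennreal (K powr p) \<longleftrightarrow> Lp_norm M p \<xi> powr p \<le> K powr p"
    by (simp add: Ip_eq_Lp_norm[OF assms(1,2)])
  also have "\<dots> \<longleftrightarrow> Lp_norm M p \<xi> \<le> K"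
    using assms by (meson Lp_norm_nonneg linorder_not_le powr_less_mono2 powr_mono2
        less_le_trans zero_less_one order.strict_implies_order)
  finally show ?thesis by simp
qed

lemma Lp_norm_mono:
  assumes p: "1 \<le> p" and bm: "bochner_measurable M \<eta>" and \<xi>: "\<xi> \<in> Lp M p" and C: "0 \<le> C"
    and le: "AE x in M. norm (\<eta> x) \<le> C * norm (\<xi> x)"
  shows "\<eta> \<in> Lp M p" "Lp_norm M p \<eta> \<le> C * Lp_norm M p \<xi>"
proof -
  obtain u where u: "u \<in> borel_measurable M" "\<And>x. 0 \<le> u x" "AE x in M. norm (\<xi> x) = u x"
    using bochner_measurable_norm_rep \<xi> by (metis Lp_iff)
  have I\<xi>: "Ip M p \<xi> = (\<integral>\<^sup>+x. ennreal (u x powr p) \<partial>M)"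
    unfolding Ip_def by (rule nn_integral_cong_AE) (use u(3) in \<open>eventually_elim, simp\<close>)
  have "Ip M p \<eta> \<le> (\<integral>\<^sup>+x. ennreal (C powr p) * ennreal (u x powr p) \<partial>M)"
    unfolding Ip_def
  proof (rule nn_integral_mono_AE, use le u(3) in eventually_elim)
    case (elim x)
    then have "norm (\<eta> x) powr p \<le> (C * u x) powr p" using p by (intro powr_mono2) auto
    also have "\<dots> = C powr p * u x powr p" using C u(2) by (simp add: powr_mult)
    finally show ?case by (simp add: ennreal_mult[symmetric] ennreal_leI)
  qed
  also have "\<dots> = ennreal (C powr p) * Ip M p \<xi>"
    unfolding I\<xi> using u(1) by (intro nn_integral_cmult) auto
  finally have le': "Ip M p \<eta> \<le> ennreal (C powr p) * Ip M p \<xi>" .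
  then show *: "\<eta> \<in> Lp M p"
    using bm \<xi> by (auto simp: Lp_iff ennreal_mult_less_top order_le_less_trans)
  have "Ip M p \<eta> \<le> ennreal ((C * Lp_norm M p \<xi>) powr p)"
    using le' C by (simp add: Ip_eq_Lp_norm[OF \<xi> p] ennreal_mult[symmetric] powr_mult)
  then show "Lp_norm M p \<eta> \<le> C * Lp_norm M p \<xi>"
    using Lp_norm_le_iff[OF * p, of "C * Lp_norm M p \<xi>"] C by simp
qed

text \<open>Convexity of the p-th power at the points \<open>a / A\<close> and \<open>b / B\<close>
  with weights \<open>A / (A + B)\<close> and \<open>B / (A + B)\<close>. Integrated with
  \<open>A\<close>, \<open>B\<close> as bounds for two norms, the right side becomes at most
  \<open>(A + B) powr p\<close>: this is Minkowski's inequality.\<close>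

lemma powr_convex_comb:
  fixes a b A B p :: real
  assumes "1 \<le> p" "0 \<le> a" "0 \<le> b" "0 < A" "0 < B"
  shows "(a + b) powr p \<le> (A + B) powr p * (A / (A + B) * (a / A) powr p + B / (A + B) * (b / B) powr p)"
proof -
  define t where "t = B / (A + B)"
  have t: "0 < t" "t < 1" "1 - t = A / (A + B)" using assms by (auto simp: t_def field_simps)
  have conv: "((1 - t) * x + t * y) powr p \<le> (1 - t) * x powr p + t * y powr p"
    if "0 \<le> x" "0 \<le> y" for x y
  proof -
    have le: "(r * z) powr p \<le> r * z powr p" if "0 < r" "r < 1" "0 \<le> z" for r z
    proof -
      have "r powr p \<le> r powr 1" using that assms(1) by (intro powr_mono') auto
      then show ?thesis using that by (simp add: powr_mult mult_right_mono)
    qed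
    have "x = 0 \<or> y = 0 \<or> 0 < x \<and> 0 < y" using that by linarith
    then consider "x = 0" | "y = 0" | "0 < x" "0 < y" by blast
    then show ?thesis
    proof cases
      case 1 then show ?thesis using le[of t y] t that by simp
    next
      case 2 then show ?thesis using le[of "1 - t" x] t that by simp
    next
      case 3
      then show ?thesis
        using convex_onD[OF powr_convex[OF assms(1)], of t x y] t(1,2) by simp
    qed
  qed
  have "a + b = (A + B) * ((1 - t) * (a / A) + t * (b / B))"
    using assms unfolding t(3) unfolding t_def by (simp add: distrib_left)
  then have "(a + b) powr p = (A + B) powr p * ((1 - t) * (a / A) + t * (b / B)) powr p"
    using assms t by (simp add: powr_mult)
  also have "\<dots> \<le> (A + B) powr p * ((1 - t) * (a / A) powr p + t * (b / B) powr p)"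
    using assms by (intro mult_left_mono conv) auto
  finally show ?thesis unfolding t(3) unfolding t_def .
qed

lemma Lp_norm_add:
  assumes p: "1 \<le> p" and \<xi>: "\<xi> \<in> Lp M p" and \<eta>: "\<eta> \<in> Lp M p"
  shows "(\<lambda>x. \<xi> x + \<eta> x) \<in> Lp M p"
    and "Lp_norm M p (\<lambda>x. \<xi> x + \<eta> x) \<le> Lp_norm M p \<xi> + Lp_norm M p \<eta>"
proof -
  obtain u where u: "u \<in> borel_measurable M" "\<And>x. 0 \<le> u x" "AE x in M. norm (\<xi> x) = u x"
    using bochner_measurable_norm_rep \<xi> by (metis Lp_iff)
  obtain v where v: "v \<in> borel_measurable M" "\<And>x. 0 \<le> v x" "AE x in M. norm (\<eta> x) = v x"
    using bochner_measurable_norm_rep \<eta> by (metis Lp_iff)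
  have Iu: "Ip M p \<xi> = (\<integral>\<^sup>+x. ennreal (u x powr p) \<partial>M)"
    unfolding Ip_def by (rule nn_integral_cong_AE) (use u(3) in \<open>eventually_elim, simp\<close>)
  have Iv: "Ip M p \<eta> = (\<integral>\<^sup>+x. ennreal (v x powr p) \<partial>M)"
    unfolding Ip_def by (rule nn_integral_cong_AE) (use v(3) in \<open>eventually_elim, simp\<close>)
  \<comment> \<open>Strictly positive bounds replace the norms because convexity divides by them and
    a norm may vanish; the slack is removed at the end.\<close>
  have key: "Ip M p (\<lambda>x. \<xi> x + \<eta> x) \<le> ennreal ((A + B) powr p)"
    if A: "Lp_norm M p \<xi> \<le> A" "0 < A" and B: "Lp_norm M p \<eta> \<le> B" "0 < B" for A B
  proof -
    define c d where "c = (A + B) powr p * (A / (A + B)) / A powr p"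
      and "d = (A + B) powr p * (B / (A + B)) / B powr p"
    have cd: "0 \<le> c" "0 \<le> d" using A B by (auto simp: c_def d_def)
    have "Ip M p (\<lambda>x. \<xi> x + \<eta> x) \<le> (\<integral>\<^sup>+x. ennreal c * ennreal (u x powr p) + ennreal d * ennreal (v x powr p) \<partial>M)"
      unfolding Ip_def
    proof (rule nn_integral_mono_AE, use u(3) v(3) in eventually_elim)
      case (elim x)
      have "norm (\<xi> x + \<eta> x) powr p \<le> (u x + v x) powr p"
        using p norm_triangle_ineq[of "\<xi> x" "\<eta> x"] elim by (intro powr_mono2) auto
      also have "\<dots> \<le> c * u x powr p + d * v x powr p"
        using powr_convex_comb[OF p u(2)[of x] v(2)[of x] A(2) B(2)] u(2)[of x] v(2)[of x] A B
        by (simp add: c_def d_def powr_divide algebra_simps)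
      finally show ?case
        using cd by (simp add: ennreal_mult[symmetric] ennreal_plus[symmetric] ennreal_leI del: ennreal_plus)
    qed
    also have "\<dots> = ennreal c * Ip M p \<xi> + ennreal d * Ip M p \<eta>"
      unfolding Iu Iv using u v by (simp add: nn_integral_add nn_integral_cmult)
    also have "\<dots> \<le> ennreal c * ennreal (A powr p) + ennreal d * ennreal (B powr p)"
      using Lp_norm_le_iff[OF \<xi> p, of A] Lp_norm_le_iff[OF \<eta> p, of B] A B
      by (intro add_mono mult_left_mono) auto
    also have "\<dots> = ennreal (c * A powr p + d * B powr p)"
      using cd by (simp add: ennreal_mult ennreal_plus)
    also have "c * A powr p + d * B powr p = (A + B) powr p"
      using A B by (simp add: c_def d_def divide_simps) (simp add: algebra_simps)
    finally show ?thesis .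
  qed
  show *: "(\<lambda>x. \<xi> x + \<eta> x) \<in> Lp M p"
    using key[of "Lp_norm M p \<xi> + 1" "Lp_norm M p \<eta> + 1"] \<xi> \<eta>
      bochner_measurable_add[of M \<xi> \<eta>]
    by (auto simp: Lp_iff add_nonneg_pos intro: order_le_less_trans)
  show "Lp_norm M p (\<lambda>x. \<xi> x + \<eta> x) \<le> Lp_norm M p \<xi> + Lp_norm M p \<eta>"
  proof (rule field_le_epsilon)
    fix e :: real assume e: "0 < e"
    have "Ip M p (\<lambda>x. \<xi> x + \<eta> x) \<le> ennreal (((Lp_norm M p \<xi> + e/2) + (Lp_norm M p \<eta> + e/2)) powr p)"
      using e by (intro key) (auto simp: add_nonneg_pos)
    moreover have "0 \<le> (Lp_norm M p \<xi> + e/2) + (Lp_norm M p \<eta> + e/2)"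
      using e by (simp add: add_nonneg_nonneg)
    ultimately have "Lp_norm M p (\<lambda>x. \<xi> x + \<eta> x) \<le> (Lp_norm M p \<xi> + e/2) + (Lp_norm M p \<eta> + e/2)"
      using Lp_norm_le_iff[OF * p] by blast
    then show "Lp_norm M p (\<lambda>x. \<xi> x + \<eta> x) \<le> Lp_norm M p \<xi> + Lp_norm M p \<eta> + e" by simp
  qed
qed

text \<open>As a function of the set, the p-th power integral is a measure, so countable additivity
  and continuity from above become available.\<close>

lemma Ip_res:
  fixes \<xi> :: "'x \<Rightarrow> 'e::real_normed_vector"
  assumes "u \<in> borel_measurable M" "AE x in M. norm (\<xi> x) = u x" "V \<in> sets M" "1 \<le> p"
  shows "Ip M p (res V \<xi>) = emeasure (density M (\<lambda>x. ennreal (u x powr p))) V"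
proof -
  have "Ip M p (res V \<xi>) = (\<integral>\<^sup>+x. ennreal (u x powr p) * indicator V x \<partial>M)"
    unfolding Ip_def
    by (rule nn_integral_cong_AE, use assms(2) in eventually_elim)
       (use assms(4) in \<open>auto simp: res_def indicator_def\<close>)
  then show ?thesis using assms by (simp add: emeasure_density)
qed

text \<open>Over disjoint sets the p-th powers of norms add up, for the pieces of
  \<open>\<eta>\<close> over \<open>V\<close> as well as for those of \<open>\<xi>\<close> over
  \<open>W\<close>. Hence a bound that holds block by block holds globally with the same constant,
  however many blocks there are.\<close>

lemma Lp_norm_block:
  fixes \<xi> \<eta> :: "'x \<Rightarrow> 'e::complex_banach"
  assumes p: "1 \<le> p" and I: "countable I" and C: "0 \<le> C"
    and V: "disjoint_family_on V I" "\<And>i. i \<in> I \<Longrightarrow> V i \<in> sets M"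
    and W: "disjoint_family_on W I" "\<And>i. i \<in> I \<Longrightarrow> W i \<in> sets M"
    and \<eta>: "bochner_measurable M \<eta>" "\<And>x. x \<notin> (\<Union>i\<in>I. V i) \<Longrightarrow> \<eta> x = 0"
    and \<xi>: "\<xi> \<in> Lp M p"
    and le: "\<And>i. i \<in> I \<Longrightarrow> res (V i) \<eta> \<in> Lp M p \<and> Lp_norm M p (res (V i) \<eta>) \<le> C * Lp_norm M p (res (W i) \<xi>)"
  shows "\<eta> \<in> Lp M p" "Lp_norm M p \<eta> \<le> C * Lp_norm M p \<xi>"
proof -
  have \<xi>bm: "bochner_measurable M \<xi>" using \<xi> by (simp add: Lp_iff)
  obtain u where u: "u \<in> borel_measurable M" "\<And>x. 0 \<le> u x" "AE x in M. norm (\<xi> x) = u x"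
    using bochner_measurable_norm_rep[OF \<xi>bm] by blast
  obtain v where v: "v \<in> borel_measurable M" "\<And>x. 0 \<le> v x" "AE x in M. norm (\<eta> x) = v x"
    using bochner_measurable_norm_rep[OF \<eta>(1)] by blast
  let ?D = "density M (\<lambda>x. ennreal (u x powr p))" and ?E = "density M (\<lambda>x. ennreal (v x powr p))"
  have UV: "(\<Union>i\<in>I. V i) \<in> sets M" "(\<Union>i\<in>I. W i) \<in> sets M"
    using I V W by (auto intro: sets.countable_UN')
  have "\<eta> = res (\<Union>i\<in>I. V i) \<eta>" using \<eta>(2) by (auto simp: res_def fun_eq_iff)
  then have "Ip M p \<eta> = emeasure ?E (\<Union>i\<in>I. V i)"
    using Ip_res[OF v(1) v(3) UV(1) p] by simp
  also have "\<dots> = (\<integral>\<^sup>+i. emeasure ?E (V i) \<partial>count_space I)"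
    using I V by (intro emeasure_UN_countable) auto
  also have "\<dots> \<le> (\<integral>\<^sup>+i. ennreal (C powr p) * emeasure ?D (W i) \<partial>count_space I)"
  proof (rule nn_integral_mono)
    fix i assume "i \<in> space (count_space I)"
    then have i: "i \<in> I" by simp
    have \<xi>W: "res (W i) \<xi> \<in> Lp M p"
      by (rule Lp_norm_mono(1)[OF p bochner_measurable_res[OF \<xi>bm W(2)[OF i]] \<xi>, of 1]) (auto simp: res_def)
    have "emeasure ?E (V i) = Ip M p (res (V i) \<eta>)" using Ip_res[OF v(1) v(3) V(2)[OF i] p] by simp
    also have "\<dots> \<le> ennreal ((C * Lp_norm M p (res (W i) \<xi>)) powr p)"
      using le[OF i] C Lp_norm_le_iff[of "res (V i) \<eta>" M p] p by auto
    also have "\<dots> = ennreal (C powr p) * Ip M p (res (W i) \<xi>)"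
      using C by (simp add: Ip_eq_Lp_norm[OF \<xi>W p] ennreal_mult[symmetric] powr_mult)
    also have "Ip M p (res (W i) \<xi>) = emeasure ?D (W i)" by (rule Ip_res[OF u(1) u(3) W(2)[OF i] p])
    finally show "emeasure ?E (V i) \<le> ennreal (C powr p) * emeasure ?D (W i)" .
  qed
  also have "\<dots> = ennreal (C powr p) * (\<integral>\<^sup>+i. emeasure ?D (W i) \<partial>count_space I)"
    by (rule nn_integral_cmult) auto
  also have "(\<integral>\<^sup>+i. emeasure ?D (W i) \<partial>count_space I) = emeasure ?D (\<Union>i\<in>I. W i)"
    using I W by (intro emeasure_UN_countable[symmetric]) auto
  also have "\<dots> = Ip M p (res (\<Union>i\<in>I. W i) \<xi>)" by (rule Ip_res[OF u(1) u(3) UV(2) p, symmetric])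
  also have "\<dots> \<le> Ip M p \<xi>"
    unfolding Ip_def using p by (intro nn_integral_mono ennreal_leI powr_mono2) (auto simp: res_def)
  finally have *: "Ip M p \<eta> \<le> ennreal (C powr p) * Ip M p \<xi>" by (simp add: mult_left_mono)
  then show \<eta>L: "\<eta> \<in> Lp M p"
    using \<eta>(1) \<xi> by (auto simp: Lp_iff ennreal_mult_less_top order_le_less_trans)
  have "Ip M p \<eta> \<le> ennreal ((C * Lp_norm M p \<xi>) powr p)"
    using * C by (simp add: Ip_eq_Lp_norm[OF \<xi> p] ennreal_mult[symmetric] powr_mult)
  then show "Lp_norm M p \<eta> \<le> C * Lp_norm M p \<xi>"
    using Lp_norm_le_iff[OF \<eta>L p, of "C * Lp_norm M p \<xi>"] C by simp
qed


section \<open>Operators on Bochner spaces over a proper space\<close>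

text \<open>\<open>x0\<close> is the centre of the balls that exhaust the space; their compactness
  makes separated families locally finite.\<close>

locale proper_Lp =
  fixes M :: "'x::metric_space measure" and p :: real and x0 :: 'x
  assumes proper: "proper_space (UNIV :: 'x set)"
    and sets_M: "sets M = sets borel"
    and p: "1 \<le> p"
begin

abbreviation N :: "('x \<Rightarrow> 'e::real_normed_vector) \<Rightarrow> real" where "N \<equiv> Lp_norm M p"
abbreviation L :: "('x \<Rightarrow> 'e::real_normed_vector) set" where "L \<equiv> Lp M p"

lemma space_M [simp]: "space M = UNIV"
  using sets_eq_imp_space_eq[OF sets_M] by simp

lemma borel_M: "borel_measurable M = borel_measurable borel"
  by (rule measurable_cong_sets[OF sets_M refl])

lemma compact_cball: "compact (cball (x::'x) r)"
proof -
  obtain K where K: "compact K" "cball x r \<subseteq> K"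
    using proper bounded_cball[of x r] unfolding proper_space_def by (metis subset_UNIV)
  then have "compact (K \<inter> cball x r)" by (intro compact_Int_closed) auto
  then show ?thesis using K(2) by (simp add: Int_absorb1)
qed

lemma Lp_zero [simp]: "(\<lambda>x. 0) \<in> L"
  using p by (simp add: Lp_iff bochner_measurable_zero Ip_def)

lemma N_zero [simp]: "N (\<lambda>x. 0) = 0"
  using p by (simp add: Lp_norm_def)

lemma Lp_cmul:
  fixes \<xi> :: "'x \<Rightarrow> 'e::complex_banach"
  assumes "\<xi> \<in> L" "h \<in> borel_measurable borel" "\<And>x. cmod (h x) \<le> C"
  shows "cmul h \<xi> \<in> L" "N (cmul h \<xi>) \<le> C * N \<xi>"
proof -
  have C: "0 \<le> C" using assms(3)[of undefined] norm_ge_zero order_trans by blast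
  have bm: "bochner_measurable M (cmul h \<xi>)"
    using assms by (intro bochner_measurable_cmul) (auto simp: Lp_iff borel_M)
  have le: "AE x in M. norm (cmul h \<xi> x) \<le> C * norm (\<xi> x)"
    using assms(3) by (intro AE_I2) (auto simp: cmul_def norm_scaleC intro: mult_right_mono)
  show "cmul h \<xi> \<in> L" "N (cmul h \<xi>) \<le> C * N \<xi>"
    using Lp_norm_mono[OF p bm assms(1) C le] by auto
qed

lemma Lp_scale: "(\<xi> :: 'x \<Rightarrow> 'e::complex_banach) \<in> L \<Longrightarrow> (\<lambda>x. c *\<^sub>C \<xi> x) \<in> L"
  using Lp_cmul(1)[of \<xi> "\<lambda>x. c" "cmod c"] by (simp add: cmul_def)

lemma N_scale_le: "(\<xi> :: 'x \<Rightarrow> 'e::complex_banach) \<in> L \<Longrightarrow> N (\<lambda>x. c *\<^sub>C \<xi> x) \<le> cmod c * N \<xi>"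
  using Lp_cmul(2)[of \<xi> "\<lambda>x. c" "cmod c"] by (simp add: cmul_def)

lemma Lp_res:
  fixes \<xi> :: "'x \<Rightarrow> 'e::complex_banach"
  assumes "\<xi> \<in> L" "V \<in> sets borel"
  shows "res V \<xi> \<in> L" "N (res V \<xi>) \<le> N \<xi>"
proof -
  have "cmul (indicator V) \<xi> \<in> L" "N (cmul (indicator V) \<xi>) \<le> 1 * N \<xi>"
    using assms Lp_cmul[of \<xi> "indicator V" 1] by (auto simp: indicator_def)
  then show "res V \<xi> \<in> L" "N (res V \<xi>) \<le> N \<xi>" by (auto simp: res_cmul)
qed

lemmas Lp_add = Lp_norm_add(1)[OF p] and N_add = Lp_norm_add(2)[OF p]

lemma Lp_uminus: "(\<xi> :: 'x \<Rightarrow> 'e::complex_banach) \<in> L \<Longrightarrow> (\<lambda>x. - \<xi> x) \<in> L"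
  using Lp_scale[of \<xi> "-1"] by (simp add: scaleC_minus_one)

lemma N_uminus: "N (\<lambda>x. - \<xi> x) = N \<xi>"
  by (rule Lp_norm_cong_AE) simp

lemma Lp_diff:
  fixes \<xi> \<eta> :: "'x \<Rightarrow> 'e::complex_banach"
  assumes "\<xi> \<in> L" "\<eta> \<in> L"
  shows "(\<lambda>x. \<xi> x - \<eta> x) \<in> L"
  using Lp_add[OF assms(1) Lp_uminus[OF assms(2)]] by simp

lemma N_diff:
  fixes \<xi> \<eta> :: "'x \<Rightarrow> 'e::complex_banach"
  assumes "\<xi> \<in> L" "\<eta> \<in> L"
  shows "N (\<lambda>x. \<xi> x - \<eta> x) \<le> N \<xi> + N \<eta>"
  using N_add[OF assms(1) Lp_uminus[OF assms(2)]] by (simp add: N_uminus)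

lemma Lp_sum:
  fixes \<xi> :: "'i \<Rightarrow> 'x \<Rightarrow> 'e::complex_banach"
  assumes "\<And>i. i \<in> I \<Longrightarrow> \<xi> i \<in> L"
  shows "(\<lambda>x. \<Sum>i\<in>I. \<xi> i x) \<in> L" "N (\<lambda>x. \<Sum>i\<in>I. \<xi> i x) \<le> (\<Sum>i\<in>I. N (\<xi> i))"
proof -
  have "(\<lambda>x. \<Sum>i\<in>I. \<xi> i x) \<in> L \<and> N (\<lambda>x. \<Sum>i\<in>I. \<xi> i x) \<le> (\<Sum>i\<in>I. N (\<xi> i))"
    using assms
  proof (induction I rule: infinite_finite_induct)
    case (insert i I)
    then have "\<xi> i \<in> L" "(\<lambda>x. \<Sum>i\<in>I. \<xi> i x) \<in> L" "N (\<lambda>x. \<Sum>i\<in>I. \<xi> i x) \<le> (\<Sum>i\<in>I. N (\<xi> i))"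
      by auto
    then show ?case using insert.hyps Lp_add[of "\<xi> i"] N_add[of "\<xi> i"] by fastforce
  qed auto
  then show "(\<lambda>x. \<Sum>i\<in>I. \<xi> i x) \<in> L" "N (\<lambda>x. \<Sum>i\<in>I. \<xi> i x) \<le> (\<Sum>i\<in>I. N (\<xi> i))" by auto
qed

lemma N_cong: "AE x in M. \<xi> x = \<eta> x \<Longrightarrow> N \<xi> = N \<eta>"
  by (rule Lp_norm_cong_AE) (erule eventually_mono, simp)

lemma N_le_add:
  assumes "\<xi> \<in> L" "\<eta> \<in> L" "AE x in M. \<zeta> x = \<xi> x + \<eta> x"
  shows "N \<zeta> \<le> N \<xi> + N \<eta>"
  using N_add[OF assms(1,2)] N_cong[OF assms(3)] by simp

lemma N_le_diff:
  fixes \<xi> \<eta> :: "'x \<Rightarrow> 'e::complex_banach"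
  assumes "\<xi> \<in> L" "\<eta> \<in> L" "AE x in M. \<zeta> x = \<xi> x - \<eta> x"
  shows "N \<zeta> \<le> N \<xi> + N \<eta>"
  using N_diff[OF assms(1,2)] N_cong[OF assms(3)] by simp

lemma N_split:
  fixes \<xi> :: "'x \<Rightarrow> 'e::complex_banach"
  assumes "\<xi> \<in> L" "V \<in> sets borel"
  shows "N \<xi> \<le> N (res V \<xi>) + N (res (- V) \<xi>)"
  using assms by (intro N_le_add Lp_res(1)) (auto simp: res_def)

text \<open>The measure with density \<open>u powr p\<close> is finite, and the complements of the
  balls decrease to the empty set.\<close>

lemma N_tail:
  fixes \<xi> :: "'x \<Rightarrow> 'e::complex_banach"
  assumes \<xi>: "\<xi> \<in> L" and e: "0 < \<epsilon>"
  obtains n0 :: nat where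
    "\<And>n V. n0 \<le> n \<Longrightarrow> V \<in> sets borel \<Longrightarrow> V \<inter> cball x0 (real n) = {} \<Longrightarrow> N (res V \<xi>) \<le> \<epsilon>"
proof -
  have bm: "bochner_measurable M \<xi>" using \<xi> by (simp add: Lp_iff)
  obtain u where u: "u \<in> borel_measurable M" "\<And>x. 0 \<le> u x" "AE x in M. norm (\<xi> x) = u x"
    using bochner_measurable_norm_rep[OF bm] by blast
  let ?D = "density M (\<lambda>x. ennreal (u x powr p))"
  have IpD: "Ip M p (res V \<xi>) = emeasure ?D V" if "V \<in> sets borel" for V
    using Ip_res[OF u(1) u(3) _ p, of V] that by (simp add: sets_M)
  have DU: "emeasure ?D UNIV < \<infinity>"
    using \<xi> IpD[of UNIV] by (simp add: Lp_iff res_def)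
  have fin: "emeasure ?D (- cball x0 (real n)) \<noteq> \<infinity>" for n
    using DU emeasure_mono[of "- cball x0 (real n)" UNIV ?D] sets_M
    by (auto simp: top_unique intro!: order_le_less_trans less_top[THEN iffD1])
  have UN: "(\<Inter>n. - cball x0 (real n)) = {}"
    using real_arch_simple by (auto simp: set_eq_iff)
  have "(\<lambda>n. emeasure ?D (- cball x0 (real n))) \<longlonglongrightarrow> emeasure ?D (\<Inter>n. - cball x0 (real n))"
  proof (rule Lim_emeasure_decseq)
    show "range (\<lambda>n. - cball x0 (real n)) \<subseteq> sets ?D" by (auto simp: sets_M)
    show "decseq (\<lambda>n. - cball x0 (real n))" by (auto simp: decseq_def)
  qed (use fin in auto)
  then have "(\<lambda>n. emeasure ?D (- cball x0 (real n))) \<longlonglongrightarrow> 0" by (simp add: UN)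
  then have "eventually (\<lambda>n. emeasure ?D (- cball x0 (real n)) < ennreal (\<epsilon> powr p)) sequentially"
    using e by (intro order_tendstoD) auto
  then obtain n0 where n0: "\<And>n. n0 \<le> n \<Longrightarrow> emeasure ?D (- cball x0 (real n)) < ennreal (\<epsilon> powr p)"
    by (auto simp: eventually_sequentially)
  show ?thesis
  proof (rule that)
    fix n V assume *: "n0 \<le> n" "V \<in> sets borel" "V \<inter> cball x0 (real n) = {}"
    have "Ip M p (res V \<xi>) \<le> emeasure ?D (- cball x0 (real n))"
      unfolding IpD[OF *(2)] using * sets_M by (intro emeasure_mono) auto
    then have "Ip M p (res V \<xi>) \<le> ennreal (\<epsilon> powr p)" using n0[OF *(1)] by simp
    then show "N (res V \<xi>) \<le> \<epsilon>"
      using Lp_norm_le_iff[OF Lp_res(1)[OF \<xi> *(2)] p, of \<epsilon>] e by simp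
  qed
qed

section \<open>Bounded operators on representatives and their norms\<close>

lemma bop_Lp: "bounded_op M p a \<Longrightarrow> \<xi> \<in> L \<Longrightarrow> a \<xi> \<in> L"
  by (simp add: bounded_op_def)

lemma bop_cong:
  "bounded_op M p a \<Longrightarrow> \<xi> \<in> L \<Longrightarrow> AE x in M. \<xi> x = \<eta> x \<Longrightarrow> AE x in M. a \<xi> x = a \<eta> x"
  using Lp_cong_AE[of \<xi> M p \<eta>] by (simp add: bounded_op_def)

lemma bop_add:
  "bounded_op M p a \<Longrightarrow> \<xi> \<in> L \<Longrightarrow> \<eta> \<in> L \<Longrightarrow> AE x in M. a (\<lambda>y. \<xi> y + \<eta> y) x = a \<xi> x + a \<eta> x"
  by (simp add: bounded_op_def)

lemma bop_scale:
  "bounded_op M p a \<Longrightarrow> \<xi> \<in> L \<Longrightarrow> AE x in M. a (\<lambda>y. c *\<^sub>C \<xi> y) x = c *\<^sub>C a \<xi> x"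
  by (simp add: bounded_op_def)

lemma bop_zero:
  assumes "bounded_op M p a" shows "AE x in M. a (\<lambda>y. 0) x = 0"
  using bop_scale[OF assms Lp_zero, of 0] by simp

lemma bop_diff:
  assumes "bounded_op M p a" "\<xi> \<in> L" "\<eta> \<in> L"
  shows "AE x in M. a (\<lambda>y. \<xi> y - \<eta> y) x = a \<xi> x - a \<eta> x"
proof -
  have "AE x in M. a (\<lambda>y. (\<xi> y - \<eta> y) + \<eta> y) x = a (\<lambda>y. \<xi> y - \<eta> y) x + a \<eta> x"
    by (rule bop_add[OF assms(1) Lp_diff[OF assms(2,3)] assms(3)])
  then show ?thesis by (rule eventually_mono) simp
qed

lemma bop_sum:
  assumes a: "bounded_op M p a" and "\<And>i. i \<in> I \<Longrightarrow> \<xi> i \<in> L"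
  shows "AE x in M. a (\<lambda>y. \<Sum>i\<in>I. \<xi> i y) x = (\<Sum>i\<in>I. a (\<xi> i) x)"
  using assms(2)
proof (induction I rule: infinite_finite_induct)
  case (insert i I)
  have "AE x in M. a (\<lambda>y. \<xi> i y + (\<Sum>i\<in>I. \<xi> i y)) x = a (\<xi> i) x + a (\<lambda>y. \<Sum>i\<in>I. \<xi> i y) x"
    using insert.prems by (intro bop_add[OF a] Lp_sum) auto
  moreover have "AE x in M. a (\<lambda>y. \<Sum>i\<in>I. \<xi> i y) x = (\<Sum>i\<in>I. a (\<xi> i) x)"
    using insert by auto
  ultimately show ?case by eventually_elim (use insert.hyps in simp)
qed (use bop_zero[OF a] in auto)

lemma op_norm_bdd:
  fixes a :: "('x, 'e::complex_banach) fun_op"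
  assumes "bounded_op M p a"
  shows "bdd_above ((\<lambda>\<xi>. N (a \<xi>)) ` {\<xi>\<in>L. N \<xi> \<le> 1})"
proof -
  have "\<exists>K. \<forall>\<xi>\<in>L. N (a \<xi>) \<le> K * N \<xi>" using assms unfolding bounded_op_def by blast
  then obtain K where K: "\<And>\<xi>. \<xi> \<in> L \<Longrightarrow> N (a \<xi>) \<le> K * N \<xi>" by blast
  have "N (a \<xi>) \<le> \<bar>K\<bar>" if "\<xi> \<in> L" "N \<xi> \<le> 1" for \<xi>
    using K[OF that(1)] mult_mono[OF abs_ge_self that(2), of K] by simp
  then show ?thesis by (intro bdd_aboveI[of _ "\<bar>K\<bar>"]) auto
qed

lemma bop_norm:
  fixes a :: "('x, 'e::complex_banach) fun_op"
  assumes a: "bounded_op M p a" and \<xi>: "\<xi> \<in> L"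
  shows "N (a \<xi>) \<le> op_norm M p a * N \<xi>"
proof (cases "N \<xi> = 0")
  case True
  \<comment> \<open>A vector of norm 0 cannot be rescaled to norm 1; the constant from boundedness
    shows directly that its image has norm 0.\<close>
  obtain K where "N (a \<xi>) \<le> K * N \<xi>" using a \<xi> by (auto simp: bounded_op_def)
  then show ?thesis using True by simp
next
  case False
  define c where "c = 1 / complex_of_real (N \<xi>)"
  have pos: "0 < N \<xi>" using False Lp_norm_nonneg[of M p \<xi>] by linarith
  have c: "cmod c * N \<xi> = 1" using pos by (simp add: c_def norm_divide)
  have "N (\<lambda>x. c *\<^sub>C \<xi> x) \<le> 1" using N_scale_le[OF \<xi>, of c] c by simp
  then have le: "N (a (\<lambda>x. c *\<^sub>C \<xi> x)) \<le> op_norm M p a"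
    unfolding op_norm_def by (intro cSUP_upper op_norm_bdd[OF a]) (auto intro: Lp_scale \<xi>)
  have "AE x in M. a \<xi> x = complex_of_real (N \<xi>) *\<^sub>C a (\<lambda>x. c *\<^sub>C \<xi> x) x"
    using bop_scale[OF a \<xi>, of c]
    by eventually_elim (use pos in \<open>simp add: c_def scaleC_scaleC scaleC_one\<close>)
  then have "N (a \<xi>) = N (\<lambda>x. complex_of_real (N \<xi>) *\<^sub>C a (\<lambda>x. c *\<^sub>C \<xi> x) x)" by (rule N_cong)
  also have "\<dots> \<le> N \<xi> * N (a (\<lambda>x. c *\<^sub>C \<xi> x))"
    using N_scale_le[OF bop_Lp[OF a Lp_scale[OF \<xi>]], of "complex_of_real (N \<xi>)" c] by simp
  also have "\<dots> \<le> N \<xi> * op_norm M p a" using le by (intro mult_left_mono) auto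
  finally show ?thesis by (simp add: mult.commute)
qed

lemma op_norm_nonneg:
  fixes a :: "('x, 'e::complex_banach) fun_op"
  assumes "bounded_op M p a" shows "0 \<le> op_norm M p a"
  unfolding op_norm_def
  by (rule order_trans[OF Lp_norm_nonneg cSUP_upper[OF _ op_norm_bdd[OF assms], of "\<lambda>x. 0"]]) simp

lemma op_norm_le:
  fixes a :: "('x, 'e::complex_banach) fun_op"
  assumes "0 \<le> C" "\<And>\<xi>. \<xi> \<in> L \<Longrightarrow> N (a \<xi>) \<le> C * N \<xi>"
  shows "op_norm M p a \<le> C"
  unfolding op_norm_def
proof (rule cSUP_least)
  show "{\<xi> \<in> L. N \<xi> \<le> 1} \<noteq> {}" using Lp_zero N_zero by fastforce
  fix \<xi> :: "'x \<Rightarrow> 'e" assume "\<xi> \<in> {\<xi> \<in> L. N \<xi> \<le> 1}"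
  then show "N (a \<xi>) \<le> C" using assms(2)[of \<xi>] mult_left_le[of "N \<xi>" C] assms(1) by simp
qed

text \<open>Both \<open>\<xi>\<close> and its image have small tails, so an estimate for the
  compressions to balls passes to the whole operator. This is the reduction from infinitely many
  blocks to finitely many, and from unbounded sets to bounded ones.\<close>

lemma op_bound_limit:
  fixes D :: "('x, 'e::complex_banach) fun_op"
  assumes D: "bounded_op M p D" and C: "0 \<le> C" and \<xi>: "\<xi> \<in> L"
    and le: "\<And>n::nat. N (res (cball x0 n) (D (res (cball x0 n) \<xi>))) \<le> C * N \<xi>"
  shows "N (D \<xi>) \<le> C * N \<xi>"
proof (rule field_le_epsilon)
  fix e :: real assume e: "0 < e"
  define K where "K = op_norm M p D + 1"
  have K: "0 < K" using op_norm_nonneg[OF D] by (simp add: K_def)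
  have e': "0 < e / (2 * K)" "0 < e / 2" using e K by auto
  obtain n1 where n1: "\<And>n V. n1 \<le> n \<Longrightarrow> V \<in> sets borel \<Longrightarrow> V \<inter> cball x0 (real n) = {} \<Longrightarrow> N (res V \<xi>) \<le> e / (2 * K)"
    using N_tail[OF \<xi> e'(1)] by blast
  obtain n2 where n2: "\<And>n V. n2 \<le> n \<Longrightarrow> V \<in> sets borel \<Longrightarrow> V \<inter> cball x0 (real n) = {} \<Longrightarrow> N (res V (D \<xi>)) \<le> e / 2"
    using N_tail[OF bop_Lp[OF D \<xi>] e'(2)] by blast
  define V where "V = cball x0 (real (max n1 n2))"
  have V: "V \<in> sets borel" "- V \<in> sets borel" by (auto simp: V_def)
  have L1: "res V \<xi> \<in> L" "res (- V) \<xi> \<in> L" using \<xi> V by (auto intro: Lp_res)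
  have "AE x in M. D (\<lambda>y. res V \<xi> y + res (- V) \<xi> y) x = D (res V \<xi>) x + D (res (- V) \<xi>) x"
    by (rule bop_add[OF D L1])
  moreover have "(\<lambda>y. res V \<xi> y + res (- V) \<xi> y) = \<xi>" by (auto simp: res_def fun_eq_iff)
  ultimately have "AE x in M. res V (D \<xi>) x = res V (D (res V \<xi>)) x + res V (D (res (- V) \<xi>)) x"
    by (auto simp: res_def)
  then have "N (res V (D \<xi>)) \<le> N (res V (D (res V \<xi>))) + N (res V (D (res (- V) \<xi>)))"
    by (rule N_le_add[OF Lp_res(1)[OF bop_Lp[OF D L1(1)] V(1)] Lp_res(1)[OF bop_Lp[OF D L1(2)] V(1)]])
  also have "N (res V (D (res (- V) \<xi>))) \<le> N (D (res (- V) \<xi>))"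
    using L1 V by (intro Lp_res(2) bop_Lp[OF D])
  also have "\<dots> \<le> op_norm M p D * N (res (- V) \<xi>)" by (rule bop_norm[OF D L1(2)])
  also have "\<dots> \<le> K * (e / (2 * K))"
    using n1[of "max n1 n2" "- V"] V(2) op_norm_nonneg[OF D]
    by (intro mult_mono) (auto simp: K_def V_def)
  also have "K * (e / (2 * K)) = e / 2" using K by simp
  also have "N (res V (D (res V \<xi>))) \<le> C * N \<xi>" unfolding V_def by (rule le)
  finally have 1: "N (res V (D \<xi>)) \<le> C * N \<xi> + e / 2" by simp
  have "N (res (- V) (D \<xi>)) \<le> e / 2" using n2[of "max n1 n2" "- V"] V(2) by (auto simp: V_def)
  then show "N (D \<xi>) \<le> C * N \<xi> + e"
    using N_split[OF bop_Lp[OF D \<xi>] V(1)] 1 by linarith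
qed


lemma bounded_opI:
  fixes a :: "('x, 'e::complex_banach) fun_op"
  assumes "\<And>\<xi>. \<xi> \<in> L \<Longrightarrow> a \<xi> \<in> L"
    and "\<And>\<xi> \<eta>. \<xi> \<in> L \<Longrightarrow> \<eta> \<in> L \<Longrightarrow> AE x in M. \<xi> x = \<eta> x \<Longrightarrow> AE x in M. a \<xi> x = a \<eta> x"
    and "\<And>\<xi> \<eta>. \<xi> \<in> L \<Longrightarrow> \<eta> \<in> L \<Longrightarrow> AE x in M. a (\<lambda>y. \<xi> y + \<eta> y) x = a \<xi> x + a \<eta> x"
    and "\<And>c \<xi>. \<xi> \<in> L \<Longrightarrow> AE x in M. a (\<lambda>y. c *\<^sub>C \<xi> y) x = c *\<^sub>C a \<xi> x"
    and "\<And>\<xi>. \<xi> \<in> L \<Longrightarrow> N (a \<xi>) \<le> K * N \<xi>"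
  shows "bounded_op M p a"
  unfolding bounded_op_def using assms by blast

lemma bop_cmul:
  assumes "h \<in> borel_measurable borel" "\<And>x. cmod (h x) \<le> C"
  shows "bounded_op M p (cmul h :: ('x, 'e::complex_banach) fun_op)"
proof (rule bounded_opI)
  fix \<xi> \<eta> :: "'x \<Rightarrow> 'e" and c :: complex assume \<xi>: "\<xi> \<in> L"
  show "cmul h \<xi> \<in> L" "N (cmul h \<xi>) \<le> C * N \<xi>" using Lp_cmul[OF \<xi> assms] by auto
  show "AE x in M. cmul h (\<lambda>y. \<xi> y + \<eta> y) x = cmul h \<xi> x + cmul h \<eta> x"
    by (simp add: cmul_def scaleC_add_right)
  show "AE x in M. cmul h (\<lambda>y. c *\<^sub>C \<xi> y) x = c *\<^sub>C cmul h \<xi> x"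
    by (simp add: cmul_def scaleC_scaleC mult.commute)
  assume "AE x in M. \<xi> x = \<eta> x"
  then show "AE x in M. cmul h \<xi> x = cmul h \<eta> x" by eventually_elim (simp add: cmul_def)
qed

lemma bcontfun_borel: "apply_bcontfun (f :: 'x \<Rightarrow>\<^sub>C complex) \<in> borel_measurable borel"
  by (intro borel_measurable_continuous_onI continuous_on_apply_bcontfun)

lemma bop_mult_op: "bounded_op M p (mult_op f :: ('x, 'e::complex_banach) fun_op)"
  unfolding mult_op_cmul by (rule bop_cmul[OF bcontfun_borel norm_bounded])

lemma bop_comp:
  fixes a b :: "('x, 'e::complex_banach) fun_op"
  assumes a: "bounded_op M p a" and b: "bounded_op M p b"
  shows "bounded_op M p (a \<circ> b)"
proof (rule bounded_opI)
  fix \<xi> \<eta> :: "'x \<Rightarrow> 'e" and c :: complex assume \<xi>: "\<xi> \<in> L"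
  note b\<xi> = bop_Lp[OF b \<xi>]
  show "(a \<circ> b) \<xi> \<in> L" using bop_Lp[OF a b\<xi>] by simp
  have "N (a (b \<xi>)) \<le> op_norm M p a * (op_norm M p b * N \<xi>)"
    by (rule order_trans[OF bop_norm[OF a b\<xi>] mult_left_mono[OF bop_norm[OF b \<xi>] op_norm_nonneg[OF a]]])
  then show "N ((a \<circ> b) \<xi>) \<le> (op_norm M p a * op_norm M p b) * N \<xi>" by (simp add: mult.assoc)
  have "AE x in M. a (b (\<lambda>y. c *\<^sub>C \<xi> y)) x = a (\<lambda>y. c *\<^sub>C b \<xi> y) x"
    using \<xi> by (intro bop_cong[OF a] bop_Lp[OF b] bop_scale[OF b] Lp_scale)
  then show "AE x in M. (a \<circ> b) (\<lambda>y. c *\<^sub>C \<xi> y) x = c *\<^sub>C (a \<circ> b) \<xi> x"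
    using bop_scale[OF a b\<xi>, of c] by eventually_elim simp
  assume \<eta>: "\<eta> \<in> L"
  have "AE x in M. a (b (\<lambda>y. \<xi> y + \<eta> y)) x = a (\<lambda>y. b \<xi> y + b \<eta> y) x"
    using \<xi> \<eta> by (intro bop_cong[OF a] bop_Lp[OF b] bop_add[OF b] Lp_add)
  then show "AE x in M. (a \<circ> b) (\<lambda>y. \<xi> y + \<eta> y) x = (a \<circ> b) \<xi> x + (a \<circ> b) \<eta> x"
    using bop_add[OF a b\<xi> bop_Lp[OF b \<eta>]] by eventually_elim simp
  assume "AE x in M. \<xi> x = \<eta> x"
  then show "AE x in M. (a \<circ> b) \<xi> x = (a \<circ> b) \<eta> x"
    using bop_cong[OF a b\<xi> bop_cong[OF b \<xi>]] by simp
qed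

lemma bop_op_diff:
  fixes a b :: "('x, 'e::complex_banach) fun_op"
  assumes a: "bounded_op M p a" and b: "bounded_op M p b"
  shows "bounded_op M p (op_diff a b)"
proof (rule bounded_opI)
  fix \<xi> \<eta> :: "'x \<Rightarrow> 'e" and c :: complex assume \<xi>: "\<xi> \<in> L"
  note L = bop_Lp[OF a \<xi>] bop_Lp[OF b \<xi>]
  show "op_diff a b \<xi> \<in> L" unfolding op_diff_def by (rule Lp_diff[OF L])
  show "N (op_diff a b \<xi>) \<le> (op_norm M p a + op_norm M p b) * N \<xi>"
    using N_diff[OF L] bop_norm[OF a \<xi>] bop_norm[OF b \<xi>]
    by (simp add: op_diff_def algebra_simps)
  show "AE x in M. op_diff a b (\<lambda>y. c *\<^sub>C \<xi> y) x = c *\<^sub>C op_diff a b \<xi> x"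
    using bop_scale[OF a \<xi>, of c] bop_scale[OF b \<xi>, of c]
    by eventually_elim (simp add: op_diff_def scaleC_diff_right)
  assume \<eta>: "\<eta> \<in> L"
  show "AE x in M. op_diff a b (\<lambda>y. \<xi> y + \<eta> y) x = op_diff a b \<xi> x + op_diff a b \<eta> x"
    using bop_add[OF a \<xi> \<eta>] bop_add[OF b \<xi> \<eta>]
    by eventually_elim (simp add: op_diff_def)
  assume eq: "AE x in M. \<xi> x = \<eta> x"
  show "AE x in M. op_diff a b \<xi> x = op_diff a b \<eta> x"
    using bop_cong[OF a \<xi> eq] bop_cong[OF b \<xi> eq] by eventually_elim (simp add: op_diff_def)
qed


section \<open>Quasi-locality and commutators\<close>

text \<open>Quasi-locality tested on Borel sets instead of supports of continuous functions. Sharp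
  cutoffs can partition the space exactly, for instance into level sets. The inequalities are weak,
  so a supremum over vectors causes no trouble.\<close>

definition ql_bound :: "('x, 'e::complex_banach) fun_op \<Rightarrow> real \<Rightarrow> real \<Rightarrow> bool" where
  "ql_bound b \<epsilon> R \<longleftrightarrow> (\<forall>S\<in>sets borel. \<forall>T\<in>sets borel. (\<forall>x\<in>S. \<forall>y\<in>T. R \<le> dist x y) \<longrightarrow>
     (\<forall>\<xi>\<in>L. N (res S (b (res T \<xi>))) \<le> \<epsilon> * N \<xi>))"

lemma ql_boundD:
  "\<lbrakk>ql_bound b \<epsilon> R; S \<in> sets borel; T \<in> sets borel; \<And>x y. x \<in> S \<Longrightarrow> y \<in> T \<Longrightarrow> R \<le> dist x y; \<xi> \<in> L\<rbrakk>
    \<Longrightarrow> N (res S (b (res T \<xi>))) \<le> \<epsilon> * N \<xi>"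
  unfolding ql_bound_def by blast

lemma ql_bound_mono: "ql_bound b \<epsilon> R \<Longrightarrow> R \<le> R' \<Longrightarrow> ql_bound b \<epsilon> R'"
  unfolding ql_bound_def by (meson order_trans)

text \<open>As a union of open balls it is Borel for every \<open>A\<close>, and it is empty for
  empty \<open>A\<close>, where a condition on \<open>infdist\<close> would give the whole
  space.\<close>

definition nbh :: "real \<Rightarrow> 'x set \<Rightarrow> 'x set" where
  "nbh r A = (\<Union>a\<in>A. ball a r)"

lemma nbh_iff: "x \<in> nbh r A \<longleftrightarrow> (\<exists>a\<in>A. dist a x < r)"
  by (auto simp: nbh_def)

lemma nbh_self: "0 < r \<Longrightarrow> x \<in> A \<Longrightarrow> x \<in> nbh r A"
  by (auto simp: nbh_iff intro!: bexI[of _ x])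

lemma nbh_borel [simp]: "nbh r A \<in> sets borel"
  unfolding nbh_def by (intro borel_open open_UN) auto

text \<open>The function \<open>2 - infdist x U / s\<close>, truncated to values between 0 and 1.
  Being 1 on a whole neighbourhood of \<open>U\<close>, and not only on \<open>U\<close>, matters
  when \<open>1 - h\<close> is used as the complementary weight of a decomposition.\<close>

lemma bump_exists:
  fixes U :: "'x set"
  assumes s: "0 < s"
  obtains h :: "'x \<Rightarrow> real" where "\<And>x. 0 \<le> h x" "\<And>x. h x \<le> 1"
    "\<And>x y. \<bar>h x - h y\<bar> \<le> dist x y / s" "\<And>x. x \<in> nbh s U \<Longrightarrow> h x = 1"
    "\<And>x. h x \<noteq> 0 \<Longrightarrow> x \<in> nbh (2 * s) U"
proof (cases "U = {}")
  case True
  then show ?thesis using s by (intro that[of "\<lambda>x. 0"]) (auto simp: nbh_def)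
next
  case False
  define h where "h x = max 0 (min 1 (2 - infdist x U / s))" for x
  show ?thesis
  proof (rule that[of h])
    fix x y
    show "0 \<le> h x" "h x \<le> 1" by (auto simp: h_def)
    have "\<bar>h x - h y\<bar> \<le> \<bar>infdist x U / s - infdist y U / s\<bar>" by (auto simp: h_def)
    also have "\<dots> \<le> dist x y / s"
      using infdist_triangle_abs[of x U y] s by (simp add: diff_divide_distrib[symmetric] divide_right_mono)
    finally show "\<bar>h x - h y\<bar> \<le> dist x y / s" .
    show "h x = 1" if x: "x \<in> nbh s U"
    proof -
      obtain a where a: "a \<in> U" "dist a x < s" using x by (auto simp: nbh_iff)
      then have "infdist x U \<le> s" using infdist_le[of a U x] by (simp add: dist_commute)
      then show ?thesis using s by (simp add: h_def field_simps)
    qed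
    show "x \<in> nbh (2 * s) U" if "h x \<noteq> 0"
    proof -
      have "infdist x U < 2 * s"
      proof (rule ccontr)
        assume "\<not> infdist x U < 2 * s"
        then have "2 \<le> infdist x U / s" using s by (simp add: field_simps)
        then have "h x = 0" by (simp add: h_def)
        with that show False by simp
      qed
      then have "(INF a\<in>U. dist x a) < 2 * s" using False by (simp add: infdist_notempty)
      then obtain a where "a \<in> U" "dist x a < 2 * s"
        using cINF_less_iff[of U "dist x"] False by (auto intro: bdd_belowI2[of _ 0])
      then show ?thesis by (auto simp: nbh_iff dist_commute)
    qed
  qed
qed

lemma lipschitz_bcontfun:
  fixes h :: "'x \<Rightarrow> complex"
  assumes "\<And>x y. cmod (h x - h y) \<le> K * dist x y" "\<And>x. cmod (h x) \<le> C"
  shows "h \<in> bcontfun"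
proof -
  have "continuous_on UNIV h"
  proof (rule lipschitz_on_continuous_on[of "\<bar>K\<bar>"])
    show "\<bar>K\<bar>-lipschitz_on UNIV h"
      using order_trans[OF assms(1) mult_right_mono[OF abs_ge_self zero_le_dist]]
      by (intro lipschitz_onI) (auto simp: dist_norm)
  qed
  then show ?thesis using assms(2) by (auto simp: bcontfun_def bounded_iff)
qed

lemma bump_bcontfun:
  fixes U :: "'x set"
  assumes s: "0 < s"
  obtains h :: "'x \<Rightarrow>\<^sub>C complex" where "\<And>x. cmod (h x) \<le> 1" "norm h \<le> 1"
    "\<And>x y. cmod (h x - h y) \<le> dist x y / s" "\<And>x. x \<in> nbh s U \<Longrightarrow> h x = 1"
    "\<And>x. h x \<noteq> 0 \<Longrightarrow> x \<in> nbh (2 * s) U"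
proof -
  obtain h where h: "\<And>x. 0 \<le> h x" "\<And>x. h x \<le> 1"
    "\<And>x y. \<bar>h x - h y\<bar> \<le> dist x y / s" "\<And>x. x \<in> nbh s U \<Longrightarrow> h x = 1"
    "\<And>x. h x \<noteq> 0 \<Longrightarrow> x \<in> nbh (2 * s) U"
    by (rule bump_exists[OF s, of U]) blast
  have d: "cmod (complex_of_real (h x) - complex_of_real (h y)) \<le> dist x y / s" for x y
    using h(3)[of x y] by (metis norm_of_real of_real_diff)
  have b: "cmod (complex_of_real (h x)) \<le> 1" for x using h(1,2)[of x] by simp
  have "(\<lambda>x. complex_of_real (h x)) \<in> bcontfun"
    using d b by (intro lipschitz_bcontfun[of _ "1 / s" 1]) auto
  then have ap: "apply_bcontfun (Bcontfun (\<lambda>x. complex_of_real (h x))) = (\<lambda>x. complex_of_real (h x))"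
    by (rule Bcontfun_inverse)
  show ?thesis
    using d b h by (intro that[of "Bcontfun (\<lambda>x. complex_of_real (h x))"] norm_bound) (auto simp: ap)
qed

lemma supp_subset: "x \<in> supp f \<Longrightarrow> 0 < r \<Longrightarrow> \<exists>y. f y \<noteq> 0 \<and> dist y x < r"
  unfolding supp_def closure_approachable by blast

lemma not_in_supp: "x \<notin> supp f \<Longrightarrow> apply_bcontfun f x = 0"
  unfolding supp_def using closure_subset[of "{x. apply_bcontfun f x \<noteq> 0}"] by auto

lemma supp_borel [simp]: "supp f \<in> sets borel"
  unfolding supp_def by (intro borel_closed) simp

lemma quasi_local_imp_ql_bound:
  fixes b :: "('x, 'e::complex_banach) fun_op"
  assumes b: "bounded_op M p b" and q: "quasi_local M p b" and e: "0 < \<epsilon>"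
  obtains R where "0 < R" "ql_bound b \<epsilon> R"
proof -
  obtain R where R: "0 \<le> R" "eps_propagation_le M p \<epsilon> b R" using q e unfolding quasi_local_def by blast
  \<comment> \<open>Each bump reaches less than 2 beyond its set, and passing to the closed support
    costs less than 1/2. So 6 = 2 * (2 + 1/2) + 1 leaves the supports at least \<open>R + 1\<close>
    apart, hence strictly more than \<open>R\<close>.\<close>
  have "N (res S (b (res T \<xi>))) \<le> \<epsilon> * N \<xi>"
    if S: "S \<in> sets borel" and T: "T \<in> sets borel" and d: "\<And>x y. x \<in> S \<Longrightarrow> y \<in> T \<Longrightarrow> R + 6 \<le> dist x y"
      and \<xi>: "\<xi> \<in> L" for S T \<xi>
  proof -
    obtain f :: "'x \<Rightarrow>\<^sub>C complex" where f: "\<And>x. cmod (f x) \<le> 1" "norm f \<le> 1"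
        "\<And>x y. cmod (f x - f y) \<le> dist x y / 1" "\<And>x. x \<in> nbh 1 S \<Longrightarrow> apply_bcontfun f x = 1"
        "\<And>x. apply_bcontfun f x \<noteq> 0 \<Longrightarrow> x \<in> nbh (2 * 1) S"
      by (rule bump_bcontfun[OF zero_less_one, of S]) blast
    obtain g :: "'x \<Rightarrow>\<^sub>C complex" where g: "\<And>x. cmod (g x) \<le> 1" "norm g \<le> 1"
        "\<And>x y. cmod (g x - g y) \<le> dist x y / 1" "\<And>x. x \<in> nbh 1 T \<Longrightarrow> apply_bcontfun g x = 1"
        "\<And>x. apply_bcontfun g x \<noteq> 0 \<Longrightarrow> x \<in> nbh (2 * 1) T"
      by (rule bump_bcontfun[OF zero_less_one, of T]) blast
    have "R + 1 \<le> dist x y" if xy: "x \<in> supp f" "y \<in> supp g" for x y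
    proof -
      obtain x' where x': "f x' \<noteq> 0" "dist x' x < 1 / 2" using supp_subset[OF xy(1), of "1/2"] by auto
      obtain y' where y': "g y' \<noteq> 0" "dist y' y < 1 / 2" using supp_subset[OF xy(2), of "1/2"] by auto
      obtain s where s: "s \<in> S" "dist s x' < 2" using f(5)[OF x'(1)] by (auto simp: nbh_iff)
      obtain t where t: "t \<in> T" "dist t y' < 2" using g(5)[OF y'(1)] by (auto simp: nbh_iff)
      show ?thesis
        using d[OF s(1) t(1)] s(2) t(2) x'(2) y'(2) dist_triangle[of s t x] dist_triangle[of s x x']
          dist_triangle[of x t y] dist_triangle[of y t y'] dist_commute[of y y'] dist_commute[of t y']
        by linarith
    qed
    then have "supp f \<noteq> {} \<Longrightarrow> supp g \<noteq> {} \<Longrightarrow> R + 1 \<le> setdist (supp f) (supp g)"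
      by (intro le_setdistI) auto
    then have "far_apart R (supp f) (supp g)" unfolding far_apart_def by linarith
    then have lt: "op_norm M p (mult_op f \<circ> b \<circ> mult_op g) < \<epsilon>"
      using R(2) f(2) g(2) unfolding eps_propagation_le_def by blast
    have bop: "bounded_op M p (mult_op f \<circ> b \<circ> mult_op g)" by (intro bop_comp bop_mult_op b)
    have T\<xi>: "res T \<xi> \<in> L" "N (res T \<xi>) \<le> N \<xi>" using Lp_res[OF \<xi> T] by auto
    have "mult_op g (res T \<xi>) = res T \<xi>"
    proof
      fix x show "mult_op g (res T \<xi>) x = res T \<xi> x"
      proof (cases "x \<in> T")
        case True
        then have "x \<in> nbh 1 T" by (simp add: nbh_self)
        then show ?thesis using g(4) by (simp add: mult_op_def scaleC_one)
      qed (simp add: mult_op_def res_def)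
    qed
    moreover have "res S (mult_op f \<eta>) = res S \<eta>" for \<eta> :: "'x \<Rightarrow> 'e"
    proof
      fix x show "res S (mult_op f \<eta>) x = res S \<eta> x"
      proof (cases "x \<in> S")
        case True
        then have "x \<in> nbh 1 S" by (simp add: nbh_self)
        then show ?thesis using f(4) by (simp add: mult_op_def res_def scaleC_one)
      qed (simp add: res_def)
    qed
    ultimately have "res S (b (res T \<xi>)) = res S ((mult_op f \<circ> b \<circ> mult_op g) (res T \<xi>))" by simp
    then have "N (res S (b (res T \<xi>))) \<le> N ((mult_op f \<circ> b \<circ> mult_op g) (res T \<xi>))"
      using Lp_res(2)[OF bop_Lp[OF bop T\<xi>(1)] S] by simp
    also have "\<dots> \<le> op_norm M p (mult_op f \<circ> b \<circ> mult_op g) * N (res T \<xi>)" by (rule bop_norm[OF bop T\<xi>(1)])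
    also have "\<dots> \<le> \<epsilon> * N \<xi>" using lt T\<xi>(2) e by (intro mult_mono) auto
    finally show ?thesis .
  qed
  then have "ql_bound b \<epsilon> (R + 6)" unfolding ql_bound_def by blast
  then show ?thesis using that[of "R + 6"] R(1) by simp
qed

lemma ql_bound_imp_quasi_local:
  fixes b :: "('x, 'e::complex_banach) fun_op"
  assumes b: "bounded_op M p b" and q: "\<And>\<epsilon>. 0 < \<epsilon> \<Longrightarrow> \<exists>R. ql_bound b \<epsilon> R"
  shows "quasi_local M p b"
  unfolding quasi_local_def
proof (intro allI impI)
  fix \<epsilon> :: real assume e: "0 < \<epsilon>"
  \<comment> \<open>Half of \<open>\<epsilon>\<close>, since the operator norm is a supremum and has
    to be strictly below \<open>\<epsilon>\<close>.\<close>
  then obtain R0 where "ql_bound b (\<epsilon>/2) R0" using q[of "\<epsilon>/2"] by auto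
  then have R: "ql_bound b (\<epsilon>/2) (max 0 R0)" by (rule ql_bound_mono) simp
  have "op_norm M p (mult_op f \<circ> b \<circ> mult_op g) < \<epsilon>"
    if fg: "norm f \<le> 1" "norm g \<le> 1" "far_apart (max 0 R0) (supp f) (supp g)" for f g
  proof -
    have d: "max 0 R0 \<le> dist x y" if "x \<in> supp f" "y \<in> supp g" for x y
      using fg(3) that setdist_le_dist[OF that] unfolding far_apart_def by auto
    have f1: "cmod (f x) \<le> 1" "cmod (g x) \<le> 1" for x using norm_bounded order_trans fg by blast+
    have "op_norm M p (mult_op f \<circ> b \<circ> mult_op g) \<le> \<epsilon> / 2"
    proof (rule op_norm_le)
      fix \<xi> :: "'x \<Rightarrow> 'e" assume \<xi>: "\<xi> \<in> L"
      have g\<xi>: "cmul g \<xi> \<in> L" "N (cmul g \<xi>) \<le> 1 * N \<xi>" using Lp_cmul[OF \<xi> bcontfun_borel, of g 1] f1 by auto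
      have rg: "res (supp g) (cmul g \<xi>) = cmul g \<xi>"
        by (auto simp: res_def cmul_def fun_eq_iff not_in_supp)
      have rf: "cmul f (res (supp f) \<eta>) = cmul f \<eta>" for \<eta> :: "'x \<Rightarrow> 'e"
        by (auto simp: res_def cmul_def fun_eq_iff not_in_supp)
      have L: "res (supp f) (b (res (supp g) (cmul g \<xi>))) \<in> L"
        by (intro Lp_res(1) bop_Lp[OF b] g\<xi>) auto
      have "N ((mult_op f \<circ> b \<circ> mult_op g) \<xi>) = N (cmul f (res (supp f) (b (res (supp g) (cmul g \<xi>)))))"
        by (simp add: mult_op_cmul rf rg)
      also have "\<dots> \<le> 1 * N (res (supp f) (b (res (supp g) (cmul g \<xi>))))"
        by (rule Lp_cmul(2)[OF L bcontfun_borel f1(1)])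
      also have "\<dots> \<le> \<epsilon> / 2 * N (cmul g \<xi>)"
        using ql_boundD[OF R supp_borel supp_borel d g\<xi>(1)] by simp
      also have "\<dots> \<le> \<epsilon> / 2 * N \<xi>" using g\<xi>(2) e by (intro mult_left_mono) auto
      finally show "N ((mult_op f \<circ> b \<circ> mult_op g) \<xi>) \<le> \<epsilon> / 2 * N \<xi>" .
    qed (use e in simp)
    then show ?thesis using e by simp
  qed
  then show "\<exists>R\<ge>0. eps_propagation_le M p \<epsilon> b R"
    unfolding eps_propagation_le_def by (intro exI[of _ "max 0 R0"]) auto
qed

section \<open>Commutators with bounded Borel functions\<close>

definition comm :: "('x, 'e::complex_banach) fun_op \<Rightarrow> ('x \<Rightarrow> complex) \<Rightarrow> ('x, 'e) fun_op" where
  "comm b f = op_diff (b \<circ> cmul f) (cmul f \<circ> b)"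

lemma commutator_comm: "commutator b f = comm b (apply_bcontfun f)"
  by (simp add: commutator_def comm_def mult_op_cmul)

lemma comm_apply: "comm b f \<xi> x = b (cmul f \<xi>) x - f x *\<^sub>C b \<xi> x"
  by (simp add: comm_def op_diff_def cmul_def)

lemma bop_comm:
  fixes b :: "('x, 'e::complex_banach) fun_op"
  assumes "bounded_op M p b" "f \<in> borel_measurable borel" "\<And>x. cmod (f x) \<le> C"
  shows "bounded_op M p (comm b f)"
  unfolding comm_def by (intro bop_op_diff bop_comp assms bop_cmul[OF assms(2,3)])

text \<open>Multiplication by \<open>f\<close> commutes with restriction, so both halves of the
  commutator are a block of \<open>b\<close> between the same two sets, multiplied by
  \<open>f\<close> on one side.\<close>

lemma comm_far:
  fixes b :: "('x, 'e::complex_banach) fun_op"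
  assumes b: "bounded_op M p b" and f: "f \<in> borel_measurable borel" "\<And>x. cmod (f x) \<le> C"
    and q: "ql_bound b \<epsilon> R" "S \<in> sets borel" "T \<in> sets borel" "\<And>x y. x \<in> S \<Longrightarrow> y \<in> T \<Longrightarrow> R \<le> dist x y"
    and \<xi>: "\<xi> \<in> L" and e: "0 \<le> \<epsilon>"
  shows "N (res S (comm b f (res T \<xi>))) \<le> 2 * C * \<epsilon> * N \<xi>"
proof -
  have C: "0 \<le> C" using f(2)[of undefined] norm_ge_zero order_trans by blast
  note f\<xi> = Lp_cmul[OF \<xi> f]
  have L1: "res S (b (res T (cmul f \<xi>))) \<in> L" by (intro Lp_res(1) bop_Lp[OF b] f\<xi> q)
  have L2: "res S (b (res T \<xi>)) \<in> L" by (intro Lp_res(1) bop_Lp[OF b] \<xi> q)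
  have "cmul f (res T \<xi>) = res T (cmul f \<xi>)" by (auto simp: cmul_def res_def fun_eq_iff)
  then have "N (res S (comm b f (res T \<xi>))) \<le> N (res S (b (res T (cmul f \<xi>)))) + N (cmul f (res S (b (res T \<xi>))))"
    by (intro N_le_diff L1 Lp_cmul(1)[OF L2 f]) (auto simp: comm_apply res_def cmul_def)
  also have "N (res S (b (res T (cmul f \<xi>)))) \<le> \<epsilon> * (C * N \<xi>)"
    using ql_boundD[OF q f\<xi>(1)] mult_left_mono[OF f\<xi>(2) e] by simp
  also have "N (cmul f (res S (b (res T \<xi>)))) \<le> C * (\<epsilon> * N \<xi>)"
    using Lp_cmul(2)[OF L2 f] mult_left_mono[OF ql_boundD[OF q \<xi>] C] by simp
  finally show ?thesis by (simp add: algebra_simps)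
qed

text \<open>Subtracting the constant \<open>c\<close> from \<open>f\<close> does not change the
  commutator, so only the deviation of \<open>f\<close> from \<open>c\<close> on the two sets
  counts. The bound keeps \<open>res W \<xi>\<close> on the right, as needed for summing blocks with
  \<open>Lp_norm_block\<close>.\<close>

lemma comm_near:
  fixes b :: "('x, 'e::complex_banach) fun_op"
  assumes b: "bounded_op M p b" and f: "f \<in> borel_measurable borel" "\<And>x. cmod (f x) \<le> C"
    and VW: "V \<in> sets borel" "W \<in> sets borel"
    and c: "\<And>x. x \<in> V \<Longrightarrow> cmod (f x - c) \<le> \<alpha>" "\<And>x. x \<in> W \<Longrightarrow> cmod (f x - c) \<le> \<beta>" "0 \<le> \<alpha>" "0 \<le> \<beta>"
    and \<xi>: "\<xi> \<in> L"
  shows "N (res V (comm b f (res W \<xi>))) \<le> (\<alpha> + \<beta>) * op_norm M p b * N (res W \<xi>)"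
proof -
  define u where "u = res W \<xi>"
  have u: "u \<in> L" unfolding u_def by (intro Lp_res \<xi> VW)
  define g h where "g x = (if x \<in> W then f x - c else 0)" and "h x = (if x \<in> V then f x - c else 0)" for x
  have g: "g \<in> borel_measurable borel" "\<And>x. cmod (g x) \<le> \<beta>" and h: "h \<in> borel_measurable borel" "\<And>x. cmod (h x) \<le> \<alpha>"
  proof -
    note [measurable] = f(1) VW
    show "g \<in> borel_measurable borel" "h \<in> borel_measurable borel" unfolding g_def h_def by measurable
    show "cmod (g x) \<le> \<beta>" "cmod (h x) \<le> \<alpha>" for x using c by (auto simp: g_def h_def)
  qed
  note gu = Lp_cmul[OF u g] and fu = Lp_cmul(1)[OF u f]
  have eq: "cmul g u = (\<lambda>y. cmul f u y - c *\<^sub>C u y)"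
    by (auto simp: cmul_def g_def u_def res_def fun_eq_iff scaleC_diff_left)
  have "AE x in M. b (cmul g u) x = b (cmul f u) x - c *\<^sub>C b u x"
    unfolding eq using bop_diff[OF b fu Lp_scale[OF u, of c]] bop_scale[OF b u, of c] by eventually_elim simp
  then have ae: "AE x in M. res V (comm b f u) x = res V (b (cmul g u)) x - cmul h (b u) x"
    by eventually_elim (simp add: res_def comm_apply cmul_def h_def scaleC_diff_left)
  have "N (res V (comm b f u)) \<le> N (res V (b (cmul g u))) + N (cmul h (b u))"
    by (rule N_le_diff[OF Lp_res(1)[OF bop_Lp[OF b gu(1)] VW(1)] Lp_cmul(1)[OF bop_Lp[OF b u] h] ae])
  also have "N (res V (b (cmul g u))) \<le> N (b (cmul g u))" by (rule Lp_res(2)[OF bop_Lp[OF b gu(1)] VW(1)])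
  also have "\<dots> \<le> op_norm M p b * (\<beta> * N u)"
    using bop_norm[OF b gu(1)] mult_left_mono[OF gu(2) op_norm_nonneg[OF b]] by simp
  also have "N (cmul h (b u)) \<le> \<alpha> * (op_norm M p b * N u)"
    using Lp_cmul(2)[OF bop_Lp[OF b u] h] mult_left_mono[OF bop_norm[OF b u] c(3)] by simp
  finally show ?thesis unfolding u_def by (simp add: algebra_simps)
qed


lemma comm_linear:
  fixes b :: "('x, 'e::complex_banach) fun_op"
  assumes b: "bounded_op M p b" and f: "f \<in> borel_measurable borel" "\<And>x. cmod (f x) \<le> C"
    and g: "g \<in> borel_measurable borel" "\<And>x. cmod (g x) \<le> D" and \<xi>: "\<xi> \<in> L"
  shows "AE x in M. comm b (\<lambda>x. \<alpha> * f x + \<beta> * g x) \<xi> x = \<alpha> *\<^sub>C comm b f \<xi> x + \<beta> *\<^sub>C comm b g \<xi> x"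
proof -
  note fL = Lp_cmul(1)[OF \<xi> f] and gL = Lp_cmul(1)[OF \<xi> g]
  have eq: "cmul (\<lambda>x. \<alpha> * f x + \<beta> * g x) \<xi> = (\<lambda>y. \<alpha> *\<^sub>C cmul f \<xi> y + \<beta> *\<^sub>C cmul g \<xi> y)"
    by (simp add: cmul_def scaleC_add_left scaleC_scaleC)
  have "AE x in M. b (cmul (\<lambda>x. \<alpha> * f x + \<beta> * g x) \<xi>) x = \<alpha> *\<^sub>C b (cmul f \<xi>) x + \<beta> *\<^sub>C b (cmul g \<xi>) x"
    unfolding eq using bop_add[OF b Lp_scale[OF fL, of \<alpha>] Lp_scale[OF gL, of \<beta>]]
      bop_scale[OF b fL, of \<alpha>] bop_scale[OF b gL, of \<beta>] by eventually_elim simp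
  then show ?thesis
    by eventually_elim (simp add: comm_apply scaleC_diff_right scaleC_add_left scaleC_scaleC)
qed

text \<open>Cut \<open>Y\<close> into the level sets \<open>X i\<close> of \<open>f\<close> at height \<open>i / n\<close>.  Blocks of the commutator
  between neighbouring level sets are small since \<open>f\<close> is almost constant there; all other blocks
  are small by quasi-locality, since level sets that are not neighbours are far apart.\<close>

lemma commutator_real:
  fixes b :: "('x, 'e::complex_banach) fun_op"
  assumes b: "bounded_op M p b" and q: "\<And>\<epsilon>. 0 < \<epsilon> \<Longrightarrow> \<exists>R. ql_bound b \<epsilon> R" and e: "0 < \<epsilon>"
  obtains R \<delta> where "0 < R" "0 < \<delta>"
    "\<And>Y f \<xi>. \<lbrakk>Y \<in> sets borel; f \<in> borel_measurable borel; \<And>x. \<bar>f x\<bar> \<le> 1;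
       \<And>x y. x \<in> Y \<Longrightarrow> y \<in> Y \<Longrightarrow> dist x y < R \<Longrightarrow> \<bar>f x - f y\<bar> \<le> \<delta>; \<xi> \<in> L\<rbrakk>
     \<Longrightarrow> N (res Y (comm b (\<lambda>x. complex_of_real (f x)) (res Y \<xi>))) \<le> \<epsilon> * N \<xi>"
proof -
  define K where "K = op_norm M p b"
  have K: "0 \<le> K" unfolding K_def by (rule op_norm_nonneg[OF b])
  \<comment> \<open>Three diagonals of neighbouring level sets, each costing
    \<open>3 / n * K\<close>, may use half of \<open>\<epsilon>\<close>:
    \<open>9 * K / n \<le> \<epsilon> / 2\<close>.\<close>
  obtain n0 :: nat where n0: "18 * K / \<epsilon> < real n0" using reals_Archimedean2 by blast
  define n where "n = Suc n0"
  have n: "0 < real n" "9 * K / n \<le> \<epsilon> / 2"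
    using n0 e K by (auto simp: n_def field_simps)
  define I where "I = {- int n..int n}"
  have cI: "real (card I) = 2 * n + 1" by (simp add: I_def)
  \<comment> \<open>The other half is shared by the \<open>card I\<close> far blocks, each of norm
    at most \<open>2 * e'\<close> by \<open>comm_far\<close> with \<open>C = 1\<close>.\<close>
  define e' where "e' = \<epsilon> / (4 * real (card I))"
  have e': "0 < e'" "card I * (2 * e') = \<epsilon> / 2"
  proof -
    have "0 < real (card I)" using cI by linarith
    then show "0 < e'" "card I * (2 * e') = \<epsilon> / 2" using e by (auto simp: e'_def)
  qed
  obtain R0 where R0: "ql_bound b e' R0" using q[OF e'(1)] by blast
  define R where "R = max 1 R0"
  have R: "ql_bound b e' R" "0 < R" using ql_bound_mono[OF R0, of R] by (auto simp: R_def)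
  \<comment> \<open>At distance below \<open>R\<close> the value \<open>n * f x\<close> moves by at
    most 1/2, so its floor moves by at most 1 and the level sets are neighbours.\<close>
  define \<delta> where "\<delta> = 1 / (2 * real n)"
  have \<delta>: "0 < \<delta>" using n by (simp add: \<delta>_def)
  show ?thesis
  proof (rule that[OF R(2) \<delta>])
    fix Y and f :: "'x \<Rightarrow> real" and \<xi> :: "'x \<Rightarrow> 'e"
    assume Y: "Y \<in> sets borel" and f: "f \<in> borel_measurable borel" "\<And>x. \<bar>f x\<bar> \<le> 1"
      and osc: "\<And>x y. x \<in> Y \<Longrightarrow> y \<in> Y \<Longrightarrow> dist x y < R \<Longrightarrow> \<bar>f x - f y\<bar> \<le> \<delta>" and \<xi>: "\<xi> \<in> L"
    define F where "F x = complex_of_real (f x)" for x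
    have F: "F \<in> borel_measurable borel" "\<And>x. cmod (F x) \<le> 1"
      using f unfolding F_def by auto
    define X where "X i = {x \<in> Y. real_of_int i \<le> n * f x \<and> n * f x < real_of_int i + 1}" for i :: int
    have XY: "X i \<subseteq> Y" for i by (auto simp: X_def)
    have X: "X i \<in> sets borel" for i
    proof -
      have "X i = Y \<inter> {x \<in> space borel. real_of_int i \<le> n * f x \<and> n * f x < real_of_int i + 1}"
        by (auto simp: X_def)
      also have "\<dots> \<in> sets borel" using f(1) Y by measurable
      finally show ?thesis .
    qed
    have X_iff: "x \<in> X i \<longleftrightarrow> x \<in> Y \<and> i = \<lfloor>n * f x\<rfloor>" for x i
      by (auto simp: X_def floor_unique floor_eq_iff)
    have I: "\<lfloor>n * f x\<rfloor> \<in> I" for x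
    proof -
      have "\<bar>n * f x\<bar> \<le> real n" using mult_left_mono[OF f(2)[of x], of "real n"] by (simp add: abs_mult)
      then show ?thesis unfolding I_def by (auto simp: le_floor_iff floor_le_iff)
    qed
    define V where "V i = X (i - 1) \<union> X i \<union> X (i + 1)" for i
    define u where "u = res Y \<xi>"
    have u: "u \<in> L" "N u \<le> N \<xi>" unfolding u_def using Lp_res[OF \<xi> Y] by auto
    note cmb = bop_comm[OF b F]
    have cmL: "res S (comm b F (res T u)) \<in> L" if "S \<in> sets borel" "T \<in> sets borel" for S T
      by (intro Lp_res(1) bop_Lp[OF cmb] u that)
    \<comment> \<open>\<open>\<eta> \<sigma>\<close> is one diagonal of the block decomposition of
      the commutator and \<open>\<zeta>\<close> is everything far from the diagonal. A diagonal is
      summed without loss by \<open>Lp_norm_block\<close>, so refining the level sets really helps.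
      The triangle inequality suffices for \<open>\<zeta>\<close>, because \<open>e'\<close> was
      chosen after \<open>n\<close>.\<close>
    define \<eta> where "\<eta> \<sigma> x = (\<Sum>i\<in>I. res (X i) (comm b F (res (X (i + \<sigma>)) u)) x)" for \<sigma> x
    define \<zeta> where "\<zeta> x = (\<Sum>i\<in>I. res (X i) (comm b F (res (Y - V i) u)) x)" for x
    have disj: "disjoint_family_on (\<lambda>i. X (i + \<sigma>)) I" for \<sigma>
      by (auto simp: disjoint_family_on_def X_iff)
    have collapse: "(\<Sum>i\<in>I. res (X i) (a i) x) = (if x \<in> Y then a \<lfloor>n * f x\<rfloor> x else 0)"
      for a :: "int \<Rightarrow> 'x \<Rightarrow> 'e" and x
    proof -
      have "(\<Sum>i\<in>I. res (X i) (a i) x) = (\<Sum>i\<in>I. if \<lfloor>n * f x\<rfloor> = i then (if x \<in> Y then a i x else 0) else 0)"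
        by (intro sum.cong) (auto simp: res_def X_iff)
      also have "\<dots> = (if x \<in> Y then a \<lfloor>n * f x\<rfloor> x else 0)"
        using I[of x] by (subst sum.delta') (auto simp: I_def)
      finally show ?thesis .
    qed
    have near: "\<eta> \<sigma> \<in> L" "N (\<eta> \<sigma>) \<le> 3 / n * K * N \<xi>" if \<sigma>: "\<sigma> \<in> {-1, 0, 1}" for \<sigma>
    proof -
      have \<eta>L: "\<eta> \<sigma> \<in> L" unfolding \<eta>_def by (intro Lp_sum cmL X)
      have "\<eta> \<sigma> x = 0" if "x \<notin> (\<Union>i\<in>I. X i)" for x
        using that I[of x] by (auto simp: \<eta>_def collapse X_iff)
      moreover have "res (X i) (\<eta> \<sigma>) \<in> L \<and> N (res (X i) (\<eta> \<sigma>)) \<le> 3 / n * K * N (res (X (i + \<sigma>)) u)"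
        if i: "i \<in> I" for i
      proof
        show "res (X i) (\<eta> \<sigma>) \<in> L" by (intro Lp_res \<eta>L X)
        have "res (X i) (\<eta> \<sigma>) = res (X i) (comm b F (res (X (i + \<sigma>)) u))"
          unfolding \<eta>_def collapse by (auto simp: fun_eq_iff res_def[of "X i"] X_iff[of _ i])
        \<comment> \<open>The constant subtracted from \<open>F\<close> is \<open>i / n\<close>: on
          \<open>X i\<close> the function is within \<open>1 / n\<close> of it, on a neighbouring
          level set within \<open>2 / n\<close>.\<close>
        moreover have "N (res (X i) (comm b F (res (X (i + \<sigma>)) u))) \<le> (1 / n + 2 / n) * op_norm M p b * N (res (X (i + \<sigma>)) u)"
        proof (rule comm_near[OF b F X X])
          have eq: "cmod (F x - complex_of_real (i / n)) = \<bar>n * f x - i\<bar> / n" for x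
          proof -
            have "cmod (F x - complex_of_real (i / n)) = \<bar>f x - i / n\<bar>"
              unfolding F_def by (metis norm_of_real of_real_diff)
            also have "f x - i / n = (n * f x - i) / n" using n by (simp add: field_simps)
            finally show ?thesis by simp
          qed
          show "cmod (F x - complex_of_real (i / n)) \<le> 1 / n" if "x \<in> X i" for x
            unfolding eq using that n by (intro divide_right_mono) (auto simp: X_def)
          show "cmod (F x - complex_of_real (i / n)) \<le> 2 / n" if "x \<in> X (i + \<sigma>)" for x
            unfolding eq using that n \<sigma> by (intro divide_right_mono) (auto simp: X_def)
        qed (use n u in auto)
        ultimately show "N (res (X i) (\<eta> \<sigma>)) \<le> 3 / n * K * N (res (X (i + \<sigma>)) u)"
          by (simp add: K_def add_divide_distrib[symmetric])
      qed
      ultimately have "N (\<eta> \<sigma>) \<le> 3 / n * K * N u"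
        using disj[of 0] disj[of \<sigma>] X n K \<eta>L u
        by (intro Lp_norm_block(2)[where I=I and V=X and W="\<lambda>i. X (i + \<sigma>)", OF p])
           (auto simp: sets_M I_def Lp_iff)
      also have "\<dots> \<le> 3 / n * K * N \<xi>" using u(2) K n by (intro mult_left_mono) auto
      finally show "N (\<eta> \<sigma>) \<le> 3 / n * K * N \<xi>" .
      show "\<eta> \<sigma> \<in> L" by (rule \<eta>L)
    qed
    have VB: "Y - V i \<in> sets borel" for i using X Y by (auto simp: V_def)
    have far: "\<zeta> \<in> L" "N \<zeta> \<le> \<epsilon> / 2 * N \<xi>"
    proof -
      show "\<zeta> \<in> L" unfolding \<zeta>_def by (intro Lp_sum cmL X VB)
      have "N \<zeta> \<le> (\<Sum>i\<in>I. N (res (X i) (comm b F (res (Y - V i) u))))"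
        unfolding \<zeta>_def by (intro Lp_sum cmL X VB)
      also have "\<dots> \<le> (\<Sum>i\<in>I. 2 * 1 * e' * N u)"
      proof (intro sum_mono comm_far[OF b F R(1) X VB])
        fix i x y assume x: "x \<in> X i" and y: "y \<in> Y - V i"
        show "R \<le> dist x y"
        proof (rule ccontr)
          assume "\<not> R \<le> dist x y"
          then have "\<bar>f x - f y\<bar> \<le> \<delta>" using osc[of x y] x y XY[of i] by auto
          then have d: "\<bar>n * f x - n * f y\<bar> \<le> 1 / 2"
            using n mult_left_mono[of "\<bar>f x - f y\<bar>" \<delta> n] by (simp add: \<delta>_def abs_mult right_diff_distrib[symmetric])
          moreover have "i \<le> n * f x" "n * f x < i + 1" using x by (auto simp: X_def)
          ultimately have "\<lfloor>n * f y\<rfloor> \<in> {i - 1, i, i + 1}" by (simp; linarith)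
          then have "y \<in> V i" using y by (auto simp: V_def X_iff)
          then show False using y by simp
        qed
      qed (use u e' in auto)
      also have "\<dots> = card I * (2 * e') * N u" by simp
      also have "\<dots> \<le> \<epsilon> / 2 * N \<xi>" unfolding e'(2) using u(2) e by (intro mult_left_mono) auto
      finally show "N \<zeta> \<le> \<epsilon> / 2 * N \<xi>" .
    qed
    have "AE x in M. \<forall>i\<in>I. comm b F u x = comm b F (res (X (i + -1)) u) x + comm b F (res (X (i + 0)) u) x
        + comm b F (res (X (i + 1)) u) x + comm b F (res (Y - V i) u) x"
    proof (intro AE_finite_allI)
      fix i assume "i \<in> I"
      let ?g = "\<lambda>T y. res T u y"
      have L: "res T u \<in> L" if "T \<in> sets borel" for T by (intro Lp_res u that)
      note LL = L[OF X[of "i + -1"]] L[OF X[of "i + 0"]] L[OF X[of "i + 1"]] L[OF VB[of i]]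
      have eq: "u = (\<lambda>y. ((?g (X (i + -1)) y + ?g (X (i + 0)) y) + ?g (X (i + 1)) y) + ?g (Y - V i) y)"
      proof
        fix y
        consider "y \<notin> Y" | "y \<in> X (i + -1)" | "y \<in> X (i + 0)" | "y \<in> X (i + 1)" | "y \<in> Y - V i"
          unfolding V_def by auto
        then show "u y = ((?g (X (i + -1)) y + ?g (X (i + 0)) y) + ?g (X (i + 1)) y) + ?g (Y - V i) y"
          by cases (auto simp: u_def res_def X_iff V_def)
      qed
      note A = bop_add[OF cmb Lp_add[OF Lp_add[OF LL(1,2)] LL(3)] LL(4)]
        bop_add[OF cmb Lp_add[OF LL(1,2)] LL(3)] bop_add[OF cmb LL(1,2)]
      show "AE x in M. comm b F u x = comm b F (res (X (i + -1)) u) x + comm b F (res (X (i + 0)) u) x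
        + comm b F (res (X (i + 1)) u) x + comm b F (res (Y - V i) u) x"
        by (subst eq, use A in eventually_elim) simp
    qed (simp add: I_def)
    then have "AE x in M. res Y (comm b F u) x = ((\<eta> (-1) x + \<eta> 0 x) + \<eta> 1 x) + \<zeta> x"
      by eventually_elim (use I in \<open>auto simp: res_def[of Y] \<eta>_def \<zeta>_def collapse\<close>)
    then have "N (res Y (comm b F u)) \<le> N (\<lambda>x. (\<eta> (-1) x + \<eta> 0 x) + \<eta> 1 x) + N \<zeta>"
      using near(1) far(1) by (intro N_le_add Lp_add) auto
    also have "N (\<lambda>x. (\<eta> (-1) x + \<eta> 0 x) + \<eta> 1 x) \<le> N (\<lambda>x. \<eta> (-1) x + \<eta> 0 x) + N (\<eta> 1)"
      using near(1) by (intro N_add Lp_add) auto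
    also have "N (\<lambda>x. \<eta> (-1) x + \<eta> 0 x) \<le> N (\<eta> (-1)) + N (\<eta> 0)"
      using near(1) by (intro N_add) auto
    finally have "N (res Y (comm b F u)) \<le> 3 * (3 / n * K * N \<xi>) + \<epsilon> / 2 * N \<xi>"
      using near(2)[of "-1"] near(2)[of 0] near(2)[of 1] far(2) by simp
    also have "3 * (3 / n * K * N \<xi>) = 9 * K / n * N \<xi>" by simp
    also have "\<dots> \<le> \<epsilon> / 2 * N \<xi>" using n(2) by (intro mult_right_mono) auto
    finally show "N (res Y (comm b (\<lambda>x. complex_of_real (f x)) (res Y \<xi>))) \<le> \<epsilon> * N \<xi>"
      by (simp add: F_def[abs_def] u_def)
  qed
qed

text \<open>Real and imaginary parts, divided by \<open>C\<close> to have values between -1 and 1,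
  are treated separately; undoing the division turns \<open>\<epsilon> / (2 * C)\<close> into half
  of \<open>\<epsilon>\<close> each.\<close>

lemma commutator_complex:
  fixes b :: "('x, 'e::complex_banach) fun_op"
  assumes b: "bounded_op M p b" and q: "\<And>\<epsilon>. 0 < \<epsilon> \<Longrightarrow> \<exists>R. ql_bound b \<epsilon> R"
    and e: "0 < \<epsilon>" and C: "0 < C"
  obtains R \<delta> where "0 < R" "0 < \<delta>"
    "\<And>Y f \<xi>. \<lbrakk>Y \<in> sets borel; f \<in> borel_measurable borel; \<And>x. cmod (f x) \<le> C;
       \<And>x y. x \<in> Y \<Longrightarrow> y \<in> Y \<Longrightarrow> dist x y < R \<Longrightarrow> cmod (f x - f y) \<le> \<delta>; \<xi> \<in> L\<rbrakk>
     \<Longrightarrow> N (res Y (comm b f (res Y \<xi>))) \<le> \<epsilon> * N \<xi>"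
proof -
  have e2: "0 < \<epsilon> / (2 * C)" using e C by simp
  obtain R \<delta> where R: "0 < R" "0 < \<delta>" and *:
    "\<And>Y f \<xi>. \<lbrakk>Y \<in> sets borel; f \<in> borel_measurable borel; \<And>x. \<bar>f x\<bar> \<le> 1;
       \<And>x y. x \<in> Y \<Longrightarrow> y \<in> Y \<Longrightarrow> dist x y < R \<Longrightarrow> \<bar>f x - f y\<bar> \<le> \<delta>; \<xi> \<in> L\<rbrakk>
     \<Longrightarrow> N (res Y (comm b (\<lambda>x. complex_of_real (f x)) (res Y \<xi>))) \<le> \<epsilon> / (2 * C) * N \<xi>"
    by (rule commutator_real[OF b q e2]) auto
  have "0 < C * \<delta>" using C R by simp
  then show ?thesis
  proof (rule that[OF R(1)])
    fix Y and f :: "'x \<Rightarrow> complex" and \<xi> :: "'x \<Rightarrow> 'e"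
    assume Y: "Y \<in> sets borel" and f: "f \<in> borel_measurable borel" "\<And>x. cmod (f x) \<le> C"
      and osc: "\<And>x y. x \<in> Y \<Longrightarrow> y \<in> Y \<Longrightarrow> dist x y < R \<Longrightarrow> cmod (f x - f y) \<le> C * \<delta>" and \<xi>: "\<xi> \<in> L"
    define g h where "g x = Re (f x) / C" and "h x = Im (f x) / C" for x
    have gh: "g \<in> borel_measurable borel" "h \<in> borel_measurable borel" using f(1) unfolding g_def h_def by auto
    have gh1: "\<bar>g x\<bar> \<le> 1" "\<bar>h x\<bar> \<le> 1" for x
      using f(2)[of x] C abs_Re_le_cmod[of "f x"] abs_Im_le_cmod[of "f x"] by (auto simp: g_def h_def)
    have osc': "\<bar>g x - g y\<bar> \<le> \<delta>" "\<bar>h x - h y\<bar> \<le> \<delta>" if "x \<in> Y" "y \<in> Y" "dist x y < R" for x y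
      using osc[OF that] C abs_Re_le_cmod[of "f x - f y"] abs_Im_le_cmod[of "f x - f y"]
      by (auto simp: g_def h_def diff_divide_distrib[symmetric] field_simps)
    have gs: "N (res Y (comm b (\<lambda>x. complex_of_real (g x)) (res Y \<xi>))) \<le> \<epsilon> / (2 * C) * N \<xi>"
      by (rule *[OF Y gh(1)]) (use gh1 osc' \<xi> in auto)
    have hs: "N (res Y (comm b (\<lambda>x. complex_of_real (h x)) (res Y \<xi>))) \<le> \<epsilon> / (2 * C) * N \<xi>"
      by (rule *[OF Y gh(2)]) (use gh1 osc' \<xi> in auto)
    let ?g = "\<lambda>x. complex_of_real (g x)" and ?h = "\<lambda>x. complex_of_real (h x)"
    have gh': "?g \<in> borel_measurable borel" "?h \<in> borel_measurable borel" using gh by auto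
    have gh1': "cmod (?g x) \<le> 1" "cmod (?h x) \<le> 1" for x using gh1[of x] by auto
    have f_eq: "f = (\<lambda>x. complex_of_real C * ?g x + (\<i> * complex_of_real C) * ?h x)"
      using C by (auto simp: fun_eq_iff g_def h_def complex_eq_iff)
    note u = Lp_res(1)[OF \<xi> Y]
    have L: "res Y (comm b ?g (res Y \<xi>)) \<in> L" "res Y (comm b ?h (res Y \<xi>)) \<in> L"
      by (intro Lp_res(1) Y bop_Lp[OF bop_comm[OF b gh'(1) gh1'(1)]] bop_Lp[OF bop_comm[OF b gh'(2) gh1'(2)]] \<xi>)+
    have "AE x in M. comm b f (res Y \<xi>) x =
       complex_of_real C *\<^sub>C comm b ?g (res Y \<xi>) x + (\<i> * complex_of_real C) *\<^sub>C comm b ?h (res Y \<xi>) x"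
      by (subst f_eq) (rule comm_linear[OF b gh'(1) gh1'(1) gh'(2) gh1'(2) u])
    then have "AE x in M. res Y (comm b f (res Y \<xi>)) x =
       complex_of_real C *\<^sub>C res Y (comm b ?g (res Y \<xi>)) x + (\<i> * complex_of_real C) *\<^sub>C res Y (comm b ?h (res Y \<xi>)) x"
      by eventually_elim (simp add: res_def)
    then have "N (res Y (comm b f (res Y \<xi>))) \<le> N (\<lambda>x. complex_of_real C *\<^sub>C res Y (comm b ?g (res Y \<xi>)) x)
        + N (\<lambda>x. (\<i> * complex_of_real C) *\<^sub>C res Y (comm b ?h (res Y \<xi>)) x)"
      by (intro N_le_add Lp_scale L)
    also have "\<dots> \<le> C * N (res Y (comm b ?g (res Y \<xi>))) + C * N (res Y (comm b ?h (res Y \<xi>)))"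
      using N_scale_le[OF L(1), of "complex_of_real C"] N_scale_le[OF L(2), of "\<i> * complex_of_real C"] C
      by (simp add: norm_mult)
    also have "\<dots> \<le> C * (\<epsilon> / (2 * C) * N \<xi>) + C * (\<epsilon> / (2 * C) * N \<xi>)"
      using gs hs C by (intro add_mono mult_left_mono) auto
    also have "\<dots> = \<epsilon> * N \<xi>" using C by simp
    finally show "N (res Y (comm b f (res Y \<xi>))) \<le> \<epsilon> * N \<xi>" .
  qed
qed


section \<open>Very Lipschitz sequences\<close>

text \<open>From \<open>T\<close> to \<open>S\<close> the commutator is
  \<open>\<beta> - \<alpha>\<close> times the block of \<open>b\<close>. This carries a large block
  of \<open>b\<close> over to a commutator with a function that separates the two sets.\<close>

lemma comm_separated:
  fixes b :: "('x, 'e::complex_banach) fun_op"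
  assumes b: "bounded_op M p b" and \<xi>: "\<xi> \<in> L" and T: "T \<in> sets borel"
    and f: "\<And>x. x \<in> S \<Longrightarrow> f x = \<alpha>" "\<And>x. x \<in> T \<Longrightarrow> f x = \<beta>" "cmod (\<beta> - \<alpha>) = 1"
  shows "N (res S (comm b f (res T \<xi>))) = N (res S (b (res T \<xi>)))"
proof (rule Lp_norm_cong_AE)
  have eq: "cmul f (res T \<xi>) = (\<lambda>y. \<beta> *\<^sub>C res T \<xi> y)"
    using f by (auto simp: cmul_def res_def fun_eq_iff)
  show "AE x in M. norm (res S (comm b f (res T \<xi>)) x) = norm (res S (b (res T \<xi>)) x)"
    using bop_scale[OF b Lp_res(1)[OF \<xi> T], of \<beta>]
  proof eventually_elim
    case (elim x)
    show ?case
    proof (cases "x \<in> S")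
      case True
      then have "comm b f (res T \<xi>) x = (\<beta> - \<alpha>) *\<^sub>C b (res T \<xi>) x"
        using elim f(1) by (simp add: comm_apply eq scaleC_diff_left)
      then show ?thesis using True f(3) by (simp add: res_def norm_scaleC)
    qed (simp add: res_def)
  qed
qed

lemma commutes_imp_quasi_local:
  fixes b :: "('x, 'e::complex_banach) fun_op"
  assumes b: "bounded_op M p b" and com: "\<And>f. f \<in> VL \<Longrightarrow> commutes_at_infinity M p b f"
  shows "quasi_local M p b"
proof (rule ql_bound_imp_quasi_local[OF b], rule ccontr)
  fix \<epsilon> :: real assume e: "0 < \<epsilon>" and "\<nexists>R. ql_bound b \<epsilon> R"
  then have nq: "\<not> ql_bound b \<epsilon> R" for R by blast
  have "\<exists>g :: 'x \<Rightarrow>\<^sub>C complex. norm g \<le> 1 \<and> (\<forall>x y. cmod (apply_bcontfun g x - apply_bcontfun g y) \<le> dist x y / (real (Suc n) / 2)) \<and>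
      \<epsilon> \<le> op_norm M p (commutator b g)" for n
  proof -
    obtain S T \<xi> where ST: "S \<in> sets borel" "T \<in> sets borel" "\<And>x y. x \<in> S \<Longrightarrow> y \<in> T \<Longrightarrow> real (Suc n) \<le> dist x y"
      and \<xi>: "\<xi> \<in> L" and gt: "\<epsilon> * N \<xi> < N (res S (b (res T \<xi>)))"
      using nq[of "Suc n"] unfolding ql_bound_def by (force simp: not_le)
    \<comment> \<open>The bump vanishes at distance \<open>2 * s = Suc n\<close> from
      \<open>S\<close>, hence on \<open>T\<close>. Its Lipschitz constant \<open>1 / s\<close> tends
      to 0 with growing \<open>n\<close>, which makes the sequence very Lipschitz.\<close>
    define s where "s = real (Suc n) / 2"
    have s: "0 < s" by (simp add: s_def)
    obtain g :: "'x \<Rightarrow>\<^sub>C complex" where g: "\<And>x. cmod (g x) \<le> 1" "norm g \<le> 1"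
      "\<And>x y. cmod (apply_bcontfun g x - apply_bcontfun g y) \<le> dist x y / s" "\<And>x. x \<in> nbh s S \<Longrightarrow> g x = 1"
      "\<And>x. g x \<noteq> 0 \<Longrightarrow> x \<in> nbh (2 * s) S"
      by (rule bump_bcontfun[OF s, of S]) blast
    have gS: "g x = 1" if "x \<in> S" for x by (rule g(4)[OF nbh_self[OF s that]])
    have gT: "g y = 0" if "y \<in> T" for y
    proof (rule ccontr)
      assume "g y \<noteq> 0"
      then obtain x where "x \<in> S" "dist x y < 2 * s" using g(5) by (auto simp: nbh_iff)
      then show False using ST(3)[of x y] that by (simp add: s_def)
    qed
    note cb = bop_comm[OF b bcontfun_borel g(1)]
    note T\<xi> = Lp_res[OF \<xi> ST(2)]
    have "\<epsilon> * N \<xi> < N (res S (comm b (apply_bcontfun g) (res T \<xi>)))"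
      using gt comm_separated[OF b \<xi> ST(2), of S g 1 0] gS gT by simp
    also have "\<dots> \<le> N (comm b g (res T \<xi>))" by (rule Lp_res(2)[OF bop_Lp[OF cb T\<xi>(1)] ST(1)])
    also have "\<dots> \<le> op_norm M p (comm b g) * N (res T \<xi>)" by (rule bop_norm[OF cb T\<xi>(1)])
    also have "\<dots> \<le> op_norm M p (comm b g) * N \<xi>" using T\<xi>(2) op_norm_nonneg[OF cb] by (intro mult_left_mono)
    finally have "\<epsilon> < op_norm M p (comm b g)" by (simp add: mult_less_cancel_right)
    then show ?thesis using g(2,3) by (intro exI[of _ g]) (auto simp: commutator_comm s_def)
  qed
  then have "\<exists>g :: nat \<Rightarrow> 'x \<Rightarrow>\<^sub>C complex. \<forall>n. norm (g n) \<le> 1 \<and> (\<forall>x y. cmod (apply_bcontfun (g n) x - apply_bcontfun (g n) y) \<le> dist x y / (real (Suc n) / 2)) \<and>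
      \<epsilon> \<le> op_norm M p (commutator b (g n))" by (intro choice allI)
  then obtain g :: "nat \<Rightarrow> 'x \<Rightarrow>\<^sub>C complex" where g: "\<And>n. norm (g n) \<le> 1"
    "\<And>n x y. cmod (apply_bcontfun (g n) x - apply_bcontfun (g n) y) \<le> dist x y / (real (Suc n) / 2)" "\<And>n. \<epsilon> \<le> op_norm M p (commutator b (g n))"
    by blast
  have "g \<in> VL"
    unfolding VL_def
  proof (intro CollectI conjI allI impI)
    show "bounded (range g)" using g(1) by (auto simp: bounded_iff)
    fix K :: real assume K: "0 < K"
    obtain n0 :: nat where n0: "2 / K < n0" using reals_Archimedean2 by blast
    have "K-lipschitz_on UNIV (apply_bcontfun (g n))" if "n \<ge> n0" for n
    proof (rule lipschitz_onI)
      fix x y :: 'x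
      have "2 / K \<le> real (Suc n)" using n0 that by linarith
      then have "2 / real (Suc n) \<le> K" using K by (simp add: field_simps)
      then have "dist x y * (2 / real (Suc n)) \<le> dist x y * K" by (intro mult_left_mono) auto
      then show "dist (g n x) (g n y) \<le> K * dist x y"
        using g(2)[of n x y] by (simp add: dist_norm[of "g n x"] mult.commute)
    qed (use K in simp)
    then show "\<exists>n0. \<forall>n\<ge>n0. K-lipschitz_on UNIV (apply_bcontfun (g n))" by blast
  qed
  then have "(\<lambda>n. op_norm M p (commutator b (g n))) \<longlonglongrightarrow> 0"
    using com unfolding commutes_at_infinity_def by blast
  then have "eventually (\<lambda>n. op_norm M p (commutator b (g n)) < \<epsilon>) sequentially"
    using e by (rule order_tendstoD)
  then show False using g(3) by (auto simp: eventually_sequentially not_less[symmetric])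
qed

lemma ql_imp_commutes:
  fixes b :: "('x, 'e::complex_banach) fun_op"
  assumes b: "bounded_op M p b" and q: "\<And>\<epsilon>. 0 < \<epsilon> \<Longrightarrow> \<exists>R. ql_bound b \<epsilon> R" and f: "f \<in> VL"
  shows "commutes_at_infinity M p b f"
  unfolding commutes_at_infinity_def
proof (rule LIMSEQ_I)
  fix r :: real assume r: "0 < r"
  obtain C where C: "0 < C" "\<And>n. norm (f n) \<le> C" using f unfolding VL_def bounded_pos by auto
  have fC: "cmod (f n x) \<le> C" for n x using norm_bounded order_trans C(2) by blast
  have r2: "0 < r / 2" using r by simp
  obtain R \<delta> where R: "0 < R" "0 < \<delta>" and *:
    "\<And>Y g \<xi>. \<lbrakk>Y \<in> sets borel; g \<in> borel_measurable borel; \<And>x. cmod (g x) \<le> C;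
       \<And>x y. x \<in> Y \<Longrightarrow> y \<in> Y \<Longrightarrow> dist x y < R \<Longrightarrow> cmod (g x - g y) \<le> \<delta>; \<xi> \<in> L\<rbrakk>
     \<Longrightarrow> N (res Y (comm b g (res Y \<xi>))) \<le> r / 2 * N \<xi>"
    by (rule commutator_complex[OF b q r2 C(1)]) blast+
  \<comment> \<open>A function with Lipschitz constant \<open>\<delta> / R\<close> oscillates by at
    most \<open>\<delta>\<close> at scale \<open>R\<close>.\<close>
  have "0 < \<delta> / R" using R by simp
  then obtain n0 where n0: "\<And>n. n \<ge> n0 \<Longrightarrow> (\<delta> / R)-lipschitz_on UNIV (apply_bcontfun (f n))"
    using f unfolding VL_def by blast
  have "norm (op_norm M p (commutator b (f n)) - 0) < r" if n: "n \<ge> n0" for n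
  proof -
    have lip: "cmod (f n x - f n y) \<le> \<delta>" if "dist x y < R" for x y
    proof -
      have "cmod (f n x - f n y) \<le> \<delta> / R * dist x y"
        using lipschitz_onD[OF n0[OF n], of x y] by (simp add: dist_norm[of "f n x"])
      also have "\<dots> \<le> \<delta> / R * R" using that R by (intro mult_left_mono) auto
      finally show ?thesis using R by simp
    qed
    have UN: "res UNIV \<zeta> = \<zeta>" for \<zeta> :: "'x \<Rightarrow> 'e" by (simp add: res_def)
    have "op_norm M p (comm b (f n)) \<le> r / 2"
    proof (rule op_norm_le)
      fix \<xi> :: "'x \<Rightarrow> 'e" assume \<xi>: "\<xi> \<in> L"
      have "N (res UNIV (comm b (f n) (res UNIV \<xi>))) \<le> r / 2 * N \<xi>"
        by (rule *) (use bcontfun_borel fC lip \<xi> in auto)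
      then show "N (comm b (f n) \<xi>) \<le> r / 2 * N \<xi>" by (simp add: UN)
    qed (use r in simp)
    then show ?thesis
      using op_norm_nonneg[OF bop_comm[OF b bcontfun_borel[of "f n"] fC]] r by (simp add: commutator_comm)
  qed
  then show "\<exists>no. \<forall>n\<ge>no. norm (op_norm M p (commutator b (f n)) - 0) < r" by blast
qed

section \<open>The ideal \<open>K_ideal\<close> and Higson functions\<close>

lemma Lp_res_cmul:
  fixes \<xi> :: "'x \<Rightarrow> 'e::complex_banach"
  assumes "\<xi> \<in> L" "h \<in> borel_measurable borel" "V \<in> sets borel" "\<And>x. x \<in> V \<Longrightarrow> cmod (h x) \<le> c" "0 \<le> c"
  shows "cmul h (res V \<xi>) \<in> L" "N (cmul h (res V \<xi>)) \<le> c * N \<xi>"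
proof -
  define g where "g x = (if x \<in> V then h x else 0)" for x
  note [measurable] = assms(2,3)
  have g: "g \<in> borel_measurable borel" unfolding g_def by measurable
  have "cmul h (res V \<xi>) = cmul g \<xi>" by (auto simp: cmul_def res_def g_def fun_eq_iff)
  moreover have "cmod (g x) \<le> c" for x using assms by (auto simp: g_def)
  ultimately show "cmul h (res V \<xi>) \<in> L" "N (cmul h (res V \<xi>)) \<le> c * N \<xi>"
    using Lp_cmul[OF assms(1) g] by auto
qed

lemma C0_cball:
  fixes f :: "'x \<Rightarrow>\<^sub>C complex"
  assumes "f \<in> C0" "0 < c"
  obtains r where "\<And>x. x \<notin> cball x0 r \<Longrightarrow> cmod (f x) \<le> c"
proof -
  obtain K where K: "compact K" "\<And>x. x \<notin> K \<Longrightarrow> cmod (f x) < c" using assms unfolding C0_def by blast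
  obtain r where "\<forall>y\<in>K. dist x0 y \<le> r"
    using compact_imp_bounded[OF K(1)] bounded_any_center[of K x0] by blast
  then show ?thesis using K(2) by (intro that[of r]) (auto intro: less_imp_le)
qed

text \<open>An element of the ideal is close to some \<open>f c g\<close> with \<open>f\<close> and
  \<open>g\<close> small off a ball. The left factor gives small output off the ball, the right
  factor small response to input from there.\<close>

lemma K_ideal_tail:
  fixes k :: "('x, 'e::complex_banach) fun_op"
  assumes B: "B \<subseteq> Collect (bounded_op M p)" and k: "k \<in> K_ideal M p B" and e: "0 < \<epsilon>"
  obtains r where "\<And>r' \<xi>. r \<le> r' \<Longrightarrow> \<xi> \<in> L \<Longrightarrow> N (res (- cball x0 r') (k \<xi>)) \<le> \<epsilon> * N \<xi>"
    "\<And>r' \<xi>. r \<le> r' \<Longrightarrow> \<xi> \<in> L \<Longrightarrow> N (k (res (- cball x0 r') \<xi>)) \<le> \<epsilon> * N \<xi>"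
proof -
  have kb: "bounded_op M p k" using k by (simp add: K_ideal_def op_closure_def)
  have e2: "0 < \<epsilon> / 2" using e by simp
  then obtain s where s: "s \<in> sandwich C0 B" "op_norm M p (op_diff k s) < \<epsilon> / 2"
    using k unfolding K_ideal_def op_closure_def by blast
  then obtain f g c where fg: "f \<in> C0" "g \<in> C0" and c: "c \<in> B" and s_eq: "s = mult_op f \<circ> c \<circ> mult_op g"
    unfolding sandwich_def by blast
  have cb: "bounded_op M p c" using c B by blast
  have sb: "bounded_op M p s" unfolding s_eq by (intro bop_comp bop_mult_op cb)
  define Kc where "Kc = op_norm M p c"
  have Kc: "0 \<le> Kc" unfolding Kc_def by (rule op_norm_nonneg[OF cb])
  define D where "D = (1 + Kc) * (1 + norm f + norm g)"
  have D: "0 < D" "Kc * norm g \<le> D" "norm f * Kc \<le> D"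
    using Kc by (auto simp: D_def algebra_simps intro!: mult_pos_pos add_pos_nonneg add_nonneg_nonneg)
  define c1 where "c1 = \<epsilon> / (2 * D)"
  have c1: "0 < c1" using e D by (simp add: c1_def)
  obtain r1 where r1: "\<And>x. x \<notin> cball x0 r1 \<Longrightarrow> cmod (f x) \<le> c1" by (rule C0_cball[OF fg(1) c1]) blast
  obtain r2 where r2: "\<And>x. x \<notin> cball x0 r2 \<Longrightarrow> cmod (g x) \<le> c1" by (rule C0_cball[OF fg(2) c1]) blast
  show ?thesis
  proof (rule that[of "max r1 r2"])
    fix r' and \<xi> :: "'x \<Rightarrow> 'e" assume r': "max r1 r2 \<le> r'" and \<xi>: "\<xi> \<in> L"
    define V where "V = - cball x0 r'"
    have V: "V \<in> sets borel" by (simp add: V_def)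
    have small: "cmod (f x) \<le> c1" "cmod (g x) \<le> c1" if "x \<in> V" for x
      using that r1[of x] r2[of x] r' by (auto simp: V_def)
    note kL = bop_Lp[OF bop_op_diff[OF kb sb]]
    have dk: "N (op_diff k s \<zeta>) \<le> \<epsilon> / 2 * N \<zeta>" if "\<zeta> \<in> L" for \<zeta>
      using bop_norm[OF bop_op_diff[OF kb sb] that] s(2) mult_right_mono[of "op_norm M p (op_diff k s)" "\<epsilon> / 2" "N \<zeta>"]
      by simp
    have gL: "cmul g \<xi> \<in> L" "N (cmul g \<xi>) \<le> norm g * N \<xi>" by (rule Lp_cmul[OF \<xi> bcontfun_borel norm_bounded])+
    note cgL = bop_Lp[OF cb gL(1)]
    have "N (res V (k \<xi>)) \<le> N (res V (op_diff k s \<xi>)) + N (res V (s \<xi>))"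
      by (rule N_le_add[OF Lp_res(1)[OF kL[OF \<xi>] V] Lp_res(1)[OF bop_Lp[OF sb \<xi>] V]])
         (simp add: res_def op_diff_def)
    also have "N (res V (op_diff k s \<xi>)) \<le> \<epsilon> / 2 * N \<xi>"
      by (rule order_trans[OF Lp_res(2)[OF kL[OF \<xi>] V] dk[OF \<xi>]])
    also have "res V (s \<xi>) = cmul f (res V (c (cmul g \<xi>)))"
      by (auto simp: s_eq mult_op_cmul res_def cmul_def fun_eq_iff)
    also have "N \<dots> \<le> c1 * N (c (cmul g \<xi>))"
      using small(1) c1 by (intro Lp_res_cmul cgL bcontfun_borel V) auto
    also have "\<dots> \<le> c1 * (Kc * (norm g * N \<xi>))"
      using c1 Kc bop_norm[OF cb gL(1)] mult_left_mono[OF gL(2) Kc] by (intro mult_left_mono) (auto simp: Kc_def)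
    also have "\<dots> = c1 * (Kc * norm g) * N \<xi>" by simp
    also have "\<dots> \<le> c1 * D * N \<xi>" using c1 D by (intro mult_right_mono mult_left_mono) auto
    also have "c1 * D = \<epsilon> / 2" using D by (simp add: c1_def)
    finally show "N (res (- cball x0 r') (k \<xi>)) \<le> \<epsilon> * N \<xi>" by (simp add: V_def)
    have V\<xi>: "res V \<xi> \<in> L" "N (res V \<xi>) \<le> N \<xi>" by (rule Lp_res[OF \<xi> V])+
    have gV: "cmul g (res V \<xi>) \<in> L" "N (cmul g (res V \<xi>)) \<le> c1 * N \<xi>"
      using Lp_res_cmul[OF \<xi> bcontfun_borel V _ less_imp_le[OF c1], of g] small(2) by blast+
    note cgV = bop_Lp[OF cb gV(1)]
    have "N (k (res V \<xi>)) \<le> N (op_diff k s (res V \<xi>)) + N (s (res V \<xi>))"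
      by (rule N_le_add[OF kL[OF V\<xi>(1)] bop_Lp[OF sb V\<xi>(1)]]) (simp add: op_diff_def)
    also have "N (op_diff k s (res V \<xi>)) \<le> \<epsilon> / 2 * N \<xi>"
      by (rule order_trans[OF dk[OF V\<xi>(1)] mult_left_mono[OF V\<xi>(2)]]) (use e in simp)
    also have "N (s (res V \<xi>)) \<le> norm f * N (c (cmul g (res V \<xi>)))"
      using Lp_cmul(2)[OF cgV bcontfun_borel norm_bounded, of f] by (simp add: s_eq mult_op_cmul)
    also have "\<dots> \<le> norm f * (Kc * (c1 * N \<xi>))"
      using Kc bop_norm[OF cb gV(1)] mult_left_mono[OF gV(2) Kc] by (intro mult_left_mono) (auto simp: Kc_def)
    also have "\<dots> = c1 * (norm f * Kc) * N \<xi>" by simp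
    also have "\<dots> \<le> c1 * D * N \<xi>" using c1 D by (intro mult_right_mono mult_left_mono) auto
    also have "c1 * D = \<epsilon> / 2" using D by (simp add: c1_def)
    finally show "N (k (res (- cball x0 r') \<xi>)) \<le> \<epsilon> * N \<xi>" by (simp add: V_def)
  qed
qed

lemma ball_bump:
  obtains h :: "'x \<Rightarrow>\<^sub>C complex" where "\<And>x. cmod (h x) \<le> 1"
    "\<And>x. x \<in> cball x0 r \<Longrightarrow> h x = 1" "\<And>x. x \<notin> cball x0 (r + 2) \<Longrightarrow> h x = 0"
proof -
  obtain h :: "'x \<Rightarrow>\<^sub>C complex" where h: "\<And>x. cmod (h x) \<le> 1" "norm h \<le> 1"
    "\<And>x y. cmod (h x - h y) \<le> dist x y / 1" "\<And>x. x \<in> nbh 1 (cball x0 r) \<Longrightarrow> h x = 1"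
    "\<And>x. h x \<noteq> 0 \<Longrightarrow> x \<in> nbh (2 * 1) (cball x0 r)"
    by (rule bump_bcontfun[OF zero_less_one, of "cball x0 r"]) blast
  have "h x = 1" if "x \<in> cball x0 r" for x
    by (rule h(4)[OF nbh_self[OF zero_less_one that]])
  moreover have "h x = 0" if "x \<notin> cball x0 (r + 2)" for x
  proof (rule ccontr)
    assume "h x \<noteq> 0"
    from h(5)[OF this] obtain a where "dist x0 a \<le> r" "dist a x < 2" by (auto simp: nbh_iff)
    then show False using that dist_triangle[of x0 x a] by simp
  qed
  ultimately show ?thesis using that[of h] h(1) by blast
qed

text \<open>A bump around the ball is 0 off a compact set, so it is a Higson function and its
  commutator has small tails. Between the ball and the far region this commutator has the same
  blocks as \<open>b\<close> up to sign.\<close>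

lemma higson_imp_ball_tail:
  fixes b :: "('x, 'e::complex_banach) fun_op"
  assumes B: "B \<subseteq> Collect (bounded_op M p)" and b: "bounded_op M p b"
    and hig: "\<And>g. g \<in> higson \<Longrightarrow> commutator b g \<in> K_ideal M p B" and e: "0 < \<epsilon>"
  obtains r' where "\<And>\<xi>. \<xi> \<in> L \<Longrightarrow> N (res (- cball x0 r') (b (res (cball x0 r) \<xi>))) \<le> \<epsilon> * N \<xi>"
    "\<And>\<xi>. \<xi> \<in> L \<Longrightarrow> N (res (cball x0 r) (b (res (- cball x0 r') \<xi>))) \<le> \<epsilon> * N \<xi>"
proof -
  obtain h :: "'x \<Rightarrow>\<^sub>C complex" where h: "\<And>x. cmod (h x) \<le> 1"
    and h1: "\<And>x. x \<in> cball x0 r \<Longrightarrow> h x = 1" and h0: "\<And>x. x \<notin> cball x0 (r + 2) \<Longrightarrow> h x = 0"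
    by (rule ball_bump[of r]) blast
  have "h \<in> higson"
    unfolding higson_def
    by (intro CollectI allI impI exI[of _ "cball x0 (r + 2)"]) (auto simp: compact_cball h0)
  then have "comm b h \<in> K_ideal M p B" using hig by (simp add: commutator_comm)
  then obtain r1 where r1: "\<And>r' \<xi>. r1 \<le> r' \<Longrightarrow> \<xi> \<in> L \<Longrightarrow> N (res (- cball x0 r') (comm b h \<xi>)) \<le> \<epsilon> * N \<xi>"
    "\<And>r' \<xi>. r1 \<le> r' \<Longrightarrow> \<xi> \<in> L \<Longrightarrow> N (comm b h (res (- cball x0 r') \<xi>)) \<le> \<epsilon> * N \<xi>"
    by (rule K_ideal_tail[OF B _ e]) blast
  define r' where "r' = max r1 (r + 2)"
  note cb = bop_comm[OF b bcontfun_borel h]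
  show ?thesis
  proof (rule that[of r'])
    fix \<xi> :: "'x \<Rightarrow> 'e" assume \<xi>: "\<xi> \<in> L"
    have V: "cball x0 r \<in> sets borel" "- cball x0 r' \<in> sets borel" by auto
    have "N (res (- cball x0 r') (b (res (cball x0 r) \<xi>))) = N (res (- cball x0 r') (comm b h (res (cball x0 r) \<xi>)))"
      using h0 h1 by (intro comm_separated[OF b \<xi> V(1), of _ _ 0 1, symmetric]) (auto simp: r'_def)
    also have "\<dots> \<le> \<epsilon> * N (res (cball x0 r) \<xi>)" by (intro r1(1) Lp_res \<xi> V) (simp add: r'_def)
    also have "\<dots> \<le> \<epsilon> * N \<xi>" using e by (intro mult_left_mono Lp_res \<xi> V) auto
    finally show "N (res (- cball x0 r') (b (res (cball x0 r) \<xi>))) \<le> \<epsilon> * N \<xi>" .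
    have "N (res (cball x0 r) (b (res (- cball x0 r') \<xi>))) = N (res (cball x0 r) (comm b h (res (- cball x0 r') \<xi>)))"
      using h0 h1 by (intro comm_separated[OF b \<xi> V(2), of _ _ 1 0, symmetric]) (auto simp: r'_def)
    also have "\<dots> \<le> N (comm b h (res (- cball x0 r') \<xi>))"
      by (intro Lp_res(2) bop_Lp[OF cb] Lp_res(1) \<xi> V)
    also have "\<dots> \<le> \<epsilon> * N \<xi>" by (intro r1(2) \<xi>) (simp add: r'_def)
    finally show "N (res (cball x0 r) (b (res (- cball x0 r') \<xi>))) \<le> \<epsilon> * N \<xi>" .
  qed
qed

lemma res_split_bound:
  fixes b :: "('x, 'e::complex_banach) fun_op"
  assumes b: "bounded_op M p b" and \<xi>: "\<xi> \<in> L"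
    and V: "S \<in> sets borel" "T \<in> sets borel" "A \<in> sets borel"
  shows "N (res S (b (res T \<xi>))) \<le> N (res (S - A) (b (res (T - A) \<xi>))) + N (res S (b (res (T \<inter> A) \<xi>)))
     + N (res (S \<inter> A) (b (res T \<xi>)))"
proof -
  have L: "res S' (b (res T' \<xi>)) \<in> L" if "S' \<in> sets borel" "T' \<in> sets borel" for S' T'
    by (intro Lp_res(1) bop_Lp[OF b] \<xi> that)
  have TL: "res (T - A) \<xi> \<in> L" "res (T \<inter> A) \<xi> \<in> L" using V by (auto intro!: Lp_res \<xi>)
  have "res T \<xi> = (\<lambda>y. res (T - A) \<xi> y + res (T \<inter> A) \<xi> y)" by (auto simp: res_def fun_eq_iff)
  then have ae: "AE x in M. b (res T \<xi>) x = b (res (T - A) \<xi>) x + b (res (T \<inter> A) \<xi>) x"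
    using bop_add[OF b TL] by simp
  have "N (res S (b (res T \<xi>))) \<le> N (res (S - A) (b (res T \<xi>))) + N (res (S \<inter> A) (b (res T \<xi>)))"
    using V by (intro N_le_add L) (auto simp: res_def)
  also have "N (res (S - A) (b (res T \<xi>))) \<le> N (res (S - A) (b (res (T - A) \<xi>))) + N (res (S - A) (b (res (T \<inter> A) \<xi>)))"
    using V by (intro N_le_add L) (use ae in \<open>auto simp: res_def elim!: eventually_mono\<close>)
  also have "N (res (S - A) (b (res (T \<inter> A) \<xi>))) \<le> N (res S (b (res (T \<inter> A) \<xi>)))"
  proof -
    have "res (S - A) (b (res (T \<inter> A) \<xi>)) = res (S - A) (res S (b (res (T \<inter> A) \<xi>)))"
      by (auto simp: res_def fun_eq_iff)
    then show ?thesis using V Lp_res(2)[OF L[of S "T \<inter> A"], of "S - A"] by auto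
  qed
  finally show ?thesis by simp
qed

text \<open>Large blocks of \<open>b\<close> can be found outside any prescribed ball: the parts of
  \<open>S\<close> and \<open>T\<close> inside the ball contribute at most
  \<open>\<epsilon> / 8\<close> each, so more than three quarters of the block survive their
  removal.\<close>

lemma higson_blocks:
  fixes b :: "('x, 'e::complex_banach) fun_op"
  assumes B: "B \<subseteq> Collect (bounded_op M p)" and b: "bounded_op M p b"
    and hig: "\<And>g. g \<in> higson \<Longrightarrow> commutator b g \<in> K_ideal M p B" and e: "0 < \<epsilon>"
    and nq: "\<And>R. \<not> ql_bound b \<epsilon> R"
  shows "\<exists>S T r' \<xi>. r \<le> r' \<and> S \<in> sets borel \<and> T \<in> sets borel \<and> S \<subseteq> cball x0 r' - cball x0 r \<and>
    T \<subseteq> cball x0 r' - cball x0 r \<and> (\<forall>x\<in>S. \<forall>y\<in>T. R \<le> dist x y) \<and> \<xi> \<in> L \<and>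
    \<epsilon> / 2 * N \<xi> < N (res S (b (res T \<xi>)))"
proof -
  have e8: "0 < \<epsilon> / 8" using e by simp
  obtain r1 where r1: "\<And>\<xi>. \<xi> \<in> L \<Longrightarrow> N (res (- cball x0 r1) (b (res (cball x0 r) \<xi>))) \<le> \<epsilon> / 8 * N \<xi>"
    "\<And>\<xi>. \<xi> \<in> L \<Longrightarrow> N (res (cball x0 r) (b (res (- cball x0 r1) \<xi>))) \<le> \<epsilon> / 8 * N \<xi>"
    by (rule higson_imp_ball_tail[OF B b hig e8, of r]) blast+
  \<comment> \<open>If one of the two sets meets the ball of radius \<open>r\<close>, this
    separation pushes the other out of the ball of radius \<open>r1\<close>, where the tail
    estimates apply.\<close>
  define R' where "R' = max R (r + r1 + 1)"
  obtain S T \<xi> where ST: "S \<in> sets borel" "T \<in> sets borel" "\<And>x y. x \<in> S \<Longrightarrow> y \<in> T \<Longrightarrow> R' \<le> dist x y"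
    and \<xi>: "\<xi> \<in> L" and gt: "\<epsilon> * N \<xi> < N (res S (b (res T \<xi>)))"
    using nq[of R'] unfolding ql_bound_def by (force simp: not_le)
  define A where "A = cball x0 r"
  have A: "A \<in> sets borel" "- cball x0 r1 \<in> sets borel" by (auto simp: A_def)
  have TA: "N (res S (b (res (T \<inter> A) \<xi>))) \<le> \<epsilon> / 8 * N \<xi>"
  proof (cases "T \<inter> A = {}")
    case True
    then have "res (T \<inter> A) \<xi> = (\<lambda>x. 0)" by (auto simp: res_def)
    then have "AE x in M. res S (b (res (T \<inter> A) \<xi>)) x = 0"
      using bop_zero[OF b] by (auto simp: res_def elim!: eventually_mono)
    then have "N (res S (b (res (T \<inter> A) \<xi>))) = N (\<lambda>x. 0 :: 'e)" by (rule N_cong)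
    then show ?thesis using e by simp
  next
    case False
    then obtain y where y: "y \<in> T" "dist x0 y \<le> r" by (auto simp: A_def)
    have far: "S \<subseteq> - cball x0 r1"
    proof
      fix x assume "x \<in> S"
      then have "r + r1 + 1 \<le> dist x y" using ST(3)[of x y] y by (simp add: R'_def)
      then show "x \<in> - cball x0 r1" using y(2) dist_triangle3[of x y x0] by simp
    qed
    have T\<xi>: "res T \<xi> \<in> L" "N (res T \<xi>) \<le> N \<xi>" by (rule Lp_res[OF \<xi> ST(2)])+
    have L: "res (- cball x0 r1) (b (res A (res T \<xi>))) \<in> L"
      by (intro Lp_res(1) bop_Lp[OF b] T\<xi> A)
    have "res (T \<inter> A) \<xi> = res A (res T \<xi>)" by (auto simp: res_def fun_eq_iff)
    then have "res S (b (res (T \<inter> A) \<xi>)) = res S (res (- cball x0 r1) (b (res A (res T \<xi>))))"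
      using far by (auto simp: res_def fun_eq_iff)
    then have "N (res S (b (res (T \<inter> A) \<xi>))) \<le> N (res (- cball x0 r1) (b (res A (res T \<xi>))))"
      using Lp_res(2)[OF L ST(1)] by simp
    also have "\<dots> \<le> \<epsilon> / 8 * N (res T \<xi>)" unfolding A_def by (rule r1(1)[OF T\<xi>(1)])
    also have "\<dots> \<le> \<epsilon> / 8 * N \<xi>" using T\<xi>(2) e by (intro mult_left_mono) auto
    finally show ?thesis .
  qed
  have SA: "N (res (S \<inter> A) (b (res T \<xi>))) \<le> \<epsilon> / 8 * N \<xi>"
  proof (cases "S \<inter> A = {}")
    case True
    then have "res (S \<inter> A) (b (res T \<xi>)) = (\<lambda>x. 0)" by (auto simp: res_def)
    then show ?thesis using e by simp
  next
    case False
    then obtain x where x: "x \<in> S" "dist x0 x \<le> r" by (auto simp: A_def)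
    have far: "T \<subseteq> - cball x0 r1"
    proof
      fix y assume "y \<in> T"
      then have "r + r1 + 1 \<le> dist x y" using ST(3)[of x y] x by (simp add: R'_def)
      then show "y \<in> - cball x0 r1" using x(2) dist_triangle3[of x y x0] by simp
    qed
    have T\<xi>: "res T \<xi> \<in> L" "N (res T \<xi>) \<le> N \<xi>" by (rule Lp_res[OF \<xi> ST(2)])+
    have L: "res A (b (res (- cball x0 r1) (res T \<xi>))) \<in> L"
      by (intro Lp_res(1) bop_Lp[OF b] T\<xi> A)
    have "res T \<xi> = res (- cball x0 r1) (res T \<xi>)" using far by (auto simp: res_def fun_eq_iff)
    then have "res (S \<inter> A) (b (res T \<xi>)) = res S (res A (b (res (- cball x0 r1) (res T \<xi>))))"
      by (auto simp: res_def fun_eq_iff)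
    then have "N (res (S \<inter> A) (b (res T \<xi>))) \<le> N (res A (b (res (- cball x0 r1) (res T \<xi>))))"
      using Lp_res(2)[OF L ST(1)] by simp
    also have "\<dots> \<le> \<epsilon> / 8 * N (res T \<xi>)" unfolding A_def by (rule r1(2)[OF T\<xi>(1)])
    also have "\<dots> \<le> \<epsilon> / 8 * N \<xi>" using T\<xi>(2) e by (intro mult_left_mono) auto
    finally show ?thesis .
  qed
  define S1 T1 where "S1 = S - A" and "T1 = T - A"
  have ST1: "S1 \<in> sets borel" "T1 \<in> sets borel" using ST A by (auto simp: S1_def T1_def)
  have eN: "0 \<le> \<epsilon> * N \<xi>" using e by simp
  have big: "\<epsilon> / 2 * N \<xi> < N (res S1 (b (res T1 \<xi>)))"
    using gt res_split_bound[OF b \<xi> ST(1,2) A(1)] TA SA eN unfolding S1_def T1_def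
    by (simp add: field_simps)
  define D where "D = cmul (indicator S1) \<circ> b \<circ> cmul (indicator T1)"
  have D: "bounded_op M p D"
    unfolding D_def using ST1 b by (intro bop_comp bop_cmul[of _ 1]) (auto simp: indicator_def)
  have D_eq: "D \<zeta> = res S1 (b (res T1 \<zeta>))" for \<zeta> by (simp add: D_def res_cmul)
  \<comment> \<open>Here the sets become bounded: if every compression of \<open>D\<close> to a ball
    obeyed the bound \<open>\<epsilon> / 2\<close>, then so would \<open>D\<close>.\<close>
  have "\<not> (\<forall>n::nat. N (res (cball x0 n) (D (res (cball x0 n) \<xi>))) \<le> \<epsilon> / 2 * N \<xi>)"
    using op_bound_limit[OF D _ \<xi>, of "\<epsilon> / 2"] big e by (auto simp: D_eq)
  then obtain n :: nat where n: "\<epsilon> / 2 * N \<xi> < N (res (cball x0 n) (D (res (cball x0 n) \<xi>)))" by (auto simp: not_le)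
  have T1n: "res T1 (res (cball x0 n) \<xi>) = res (T1 \<inter> cball x0 n) \<xi>" by (auto simp: res_def fun_eq_iff)
  have "res (cball x0 n) (D (res (cball x0 n) \<xi>)) = res (S1 \<inter> cball x0 n) (b (res (T1 \<inter> cball x0 n) \<xi>))"
    unfolding D_eq T1n by (auto simp: res_def[of "cball x0 n"] res_def[of S1] res_def[of "S1 \<inter> cball x0 n"] fun_eq_iff)
  then have "\<epsilon> / 2 * N \<xi> < N (res (S1 \<inter> cball x0 n) (b (res (T1 \<inter> cball x0 n) \<xi>)))" using n by simp
  moreover have "R \<le> dist x y" if "x \<in> S1 \<inter> cball x0 n" "y \<in> T1 \<inter> cball x0 n" for x y
    using ST(3)[of x y] that by (auto simp: S1_def T1_def R'_def)
  ultimately show ?thesis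
    using \<xi> ST1
    by (intro exI[of _ "S1 \<inter> cball x0 n"] exI[of _ "T1 \<inter> cball x0 n"] exI[of _ "max r n"] exI[of _ \<xi>])
       (auto simp: S1_def T1_def A_def)
qed


text \<open>If \<open>b\<close> is not quasi-local, then it has large blocks between separated sets \<open>S k\<close>, \<open>T k\<close>
  that lie in disjoint annuli going off to infinity.  The supremum \<open>g\<close> of flatter and flatter bumps
  around the \<open>S k\<close> is a Higson function which is \<open>1\<close> on every \<open>S k\<close> and \<open>0\<close> on every \<open>T k\<close>,
  so \<open>[b,g]\<close> has the same large blocks.\<close>

lemma higson_imp_quasi_local:
  fixes b :: "('x, 'e::complex_banach) fun_op"
  assumes B: "B \<subseteq> Collect (bounded_op M p)" and b: "bounded_op M p b"
    and hig: "\<And>g. g \<in> higson \<Longrightarrow> commutator b g \<in> K_ideal M p B"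
  shows "quasi_local M p b"
proof (rule ql_bound_imp_quasi_local[OF b], rule ccontr)
  fix \<epsilon> :: real assume e: "0 < \<epsilon>" and "\<nexists>R. ql_bound b \<epsilon> R"
  then have nq: "\<not> ql_bound b \<epsilon> R" for R by blast
  define P where "P k r S T r' \<xi> \<longleftrightarrow> r \<le> r' \<and> S \<in> sets borel \<and> T \<in> sets borel \<and>
    S \<subseteq> cball x0 r' - cball x0 r \<and> T \<subseteq> cball x0 r' - cball x0 r \<and>
    (\<forall>x\<in>S. \<forall>y\<in>T. real (Suc k) \<le> dist x y) \<and> (\<xi> :: 'x \<Rightarrow> 'e) \<in> L \<and> \<epsilon> / 2 * N \<xi> < N (res S (b (res T \<xi>)))"
    for k :: nat and r S T r' \<xi>
  have "\<forall>z. \<exists>q. P (fst z) (snd z) (fst q) (fst (snd q)) (fst (snd (snd q))) (snd (snd (snd q)))"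
  proof
    fix z :: "nat \<times> real"
    obtain S T r' \<xi> where "P (fst z) (snd z) S T r' \<xi>"
      using higson_blocks[OF B b hig e nq, of "snd z" "real (Suc (fst z))"] unfolding P_def by blast
    then show "\<exists>q. P (fst z) (snd z) (fst q) (fst (snd q)) (fst (snd (snd q))) (snd (snd (snd q)))"
      by (intro exI[of _ "(S, T, r', \<xi>)"]) simp
  qed
  from choice[OF this] obtain Q where Q: "\<And>k r. P k r (fst (Q (k, r))) (fst (snd (Q (k, r))))
      (fst (snd (snd (Q (k, r))))) (snd (snd (snd (Q (k, r)))))" by force
  \<comment> \<open>\<open>r k\<close> bounds all annuli before the \<open>k\<close>-th, and the
    \<open>k\<close>-th one starts only at \<open>r k + real (Suc k)\<close>. The bump around
    \<open>S k\<close> has width \<open>Suc k\<close>, so the gap keeps it away from every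
    \<open>T j\<close> with \<open>j \<noteq> k\<close>, while \<open>T k\<close> itself is at least
    that far from \<open>S k\<close>.\<close>
  define r where "r = rec_nat 0 (\<lambda>k rk. fst (snd (snd (Q (k, rk + real (Suc k))))))"
  define S where "S k = fst (Q (k, r k + real (Suc k)))" for k
  define T where "T k = fst (snd (Q (k, r k + real (Suc k))))" for k
  define \<xi> where "\<xi> k = snd (snd (snd (Q (k, r k + real (Suc k)))))" for k
  have PP: "P k (r k + real (Suc k)) (S k) (T k) (r (Suc k)) (\<xi> k)" for k
    using Q[of k "r k + real (Suc k)"] by (simp add: r_def S_def T_def \<xi>_def)
  have r_Suc: "r k + real (Suc k) \<le> r (Suc k)" for k using PP[of k] by (simp add: P_def)
  have "r k \<le> r (Suc k)" for k using r_Suc[of k] by simp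
  then have r_mono: "r j \<le> r k" if "j \<le> k" for j k by (rule lift_Suc_mono_le[OF _ that])
  have r_ge: "real k \<le> r k" for k
  proof (induction k)
    case 0 show ?case by (simp add: r_def)
  next
    case (Suc k) then show ?case using r_Suc[of k] by simp
  qed
  have meas: "S k \<in> sets borel" "T k \<in> sets borel" for k using PP[of k] by (auto simp: P_def)
  have ann: "r k + real (Suc k) < dist x0 x" "dist x0 x \<le> r (Suc k)" if "x \<in> S k \<union> T k" for k x
    using PP[of k] that by (auto simp: P_def)
  have sep: "real (Suc k) \<le> dist x y" if "x \<in> S k" "y \<in> T k" for k x y
    using PP[of k] that by (auto simp: P_def)
  have \<xi>: "\<xi> k \<in> L" "\<epsilon> / 2 * N (\<xi> k) < N (res (S k) (b (res (T k) (\<xi> k))))" for k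
    using PP[of k] by (auto simp: P_def)

  have "\<forall>k. \<exists>h :: 'x \<Rightarrow> real. (\<forall>x. 0 \<le> h x \<and> h x \<le> 1) \<and> (\<forall>x y. \<bar>h x - h y\<bar> \<le> dist x y / (real (Suc k) / 2)) \<and>
     (\<forall>x\<in>S k. h x = 1) \<and> (\<forall>x. h x \<noteq> 0 \<longrightarrow> x \<in> nbh (real (Suc k)) (S k))"
  proof
    fix k
    have s: "0 < real (Suc k) / 2" by simp
    obtain h :: "'x \<Rightarrow> real" where h: "\<And>x. 0 \<le> h x" "\<And>x. h x \<le> 1"
      "\<And>x y. \<bar>h x - h y\<bar> \<le> dist x y / (real (Suc k) / 2)" "\<And>x. x \<in> nbh (real (Suc k) / 2) (S k) \<Longrightarrow> h x = 1"
      "\<And>x. h x \<noteq> 0 \<Longrightarrow> x \<in> nbh (2 * (real (Suc k) / 2)) (S k)"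
      by (rule bump_exists[OF s, of "S k"]) blast
    show "\<exists>h :: 'x \<Rightarrow> real. (\<forall>x. 0 \<le> h x \<and> h x \<le> 1) \<and> (\<forall>x y. \<bar>h x - h y\<bar> \<le> dist x y / (real (Suc k) / 2)) \<and>
     (\<forall>x\<in>S k. h x = 1) \<and> (\<forall>x. h x \<noteq> 0 \<longrightarrow> x \<in> nbh (real (Suc k)) (S k))"
    proof (intro exI[of _ h] conjI allI ballI impI)
      fix x assume "h x \<noteq> 0"
      moreover have "2 * (real (Suc k) / 2) = real (Suc k)" by simp
      ultimately show "x \<in> nbh (real (Suc k)) (S k)" using h(5)[of x] by metis
    qed (use h(1-3) h(4)[OF nbh_self[OF s]] in auto)
  qed
  from choice[OF this] obtain h where h: "\<And>k x. 0 \<le> h k x" "\<And>k x. h k x \<le> 1"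
    "\<And>k x y. \<bar>h k x - h k y\<bar> \<le> dist x y / (real (Suc k) / 2)" "\<And>k x. x \<in> S k \<Longrightarrow> h k x = 1"
    "\<And>k x. h k x \<noteq> 0 \<Longrightarrow> x \<in> nbh (real (Suc k)) (S k)" by blast
  \<comment> \<open>The bumps may overlap. A supremum inherits every bound on
    \<open>\<bar>h k x - h k y\<bar>\<close> that is uniform in \<open>k\<close>, which a sum would
    not.\<close>
  define g where "g x = (SUP k. h k x)" for x
  have bdd: "bdd_above (range (\<lambda>k. h k x))" for x using h(2) by (auto intro!: bdd_aboveI)
  have h_le_g: "h k x \<le> g x" for k x unfolding g_def by (intro cSUP_upper bdd) auto
  have g01: "0 \<le> g x" "g x \<le> 1" for x
    using h_le_g[of 0 x] h(1)[of 0 x] h(2) by (auto simp: g_def intro!: cSUP_least)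
  have g_diff: "\<bar>g x - g y\<bar> \<le> c" if "\<And>k. \<bar>h k x - h k y\<bar> \<le> c" for x y c
  proof -
    have "g x \<le> g y + c" if "\<And>k. \<bar>h k x - h k y\<bar> \<le> c" for x y
      unfolding g_def[of x]
    proof (rule cSUP_least)
      fix k show "h k x \<le> g y + c" using that[of k] h_le_g[of k y] by linarith
    qed simp
    from this[of x y] this[of y x] show ?thesis using that by (fastforce simp: abs_minus_commute)
  qed
  have g_lip: "\<bar>g x - g y\<bar> \<le> 2 * dist x y" for x y
  proof (rule g_diff)
    fix k
    have "dist x y / (real (Suc k) / 2) \<le> dist x y / (1 / 2)" by (intro divide_left_mono) auto
    then show "\<bar>h k x - h k y\<bar> \<le> 2 * dist x y" using h(3)[of k x y] by simp
  qed
  have gS: "g x = 1" if "x \<in> S k" for x k using h_le_g[of k x] h(4)[OF that] g01(2)[of x] by simp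
  have gT: "g y = 0" if y: "y \<in> T j" for y j
  proof -
    have "h k y = 0" for k
    proof (rule ccontr)
      assume "h k y \<noteq> 0"
      then obtain a where a: "a \<in> S k" "dist a y < real (Suc k)" using h(5)[of k y] by (auto simp: nbh_iff)
      have tri: "dist x0 a \<le> dist x0 y + dist a y" "dist x0 y \<le> dist x0 a + dist a y"
        using dist_triangle[of x0 a y] dist_triangle[of x0 y a] by (auto simp: dist_commute)
      have ay: "r k + real (Suc k) < dist x0 a" "dist x0 a \<le> r (Suc k)"
        "r j + real (Suc j) < dist x0 y" "dist x0 y \<le> r (Suc j)"
        using ann[of a k] ann[of y j] a(1) y by auto
      consider "k = j" | "Suc j \<le> k" | "Suc k \<le> j" by linarith
      then show False
      proof cases
        case 1 then show False using sep[of a j y] a y by simp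
      next
        case 2 then show False using ay tri a(2) r_mono[OF 2] by linarith
      next
        case 3
        then have "real (Suc k) \<le> real (Suc j)" by simp
        then show False using ay tri a(2) r_mono[OF 3] by linarith
      qed
    qed
    then show ?thesis by (simp add: g_def)
  qed
  define G where "G = Bcontfun (\<lambda>x. complex_of_real (g x))"
  have cg: "cmod (complex_of_real (g x) - complex_of_real (g y)) = \<bar>g x - g y\<bar>" for x y
    by (metis norm_of_real of_real_diff)
  have "(\<lambda>x. complex_of_real (g x)) \<in> bcontfun"
    using g01 g_lip by (intro lipschitz_bcontfun[of _ 2 1]) (auto simp: cg)
  then have G: "apply_bcontfun G = (\<lambda>x. complex_of_real (g x))" unfolding G_def by (rule Bcontfun_inverse)
  have "G \<in> higson"
    unfolding higson_def
  proof (intro CollectI allI impI)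
    fix R d :: real assume R: "0 < R" and d: "0 < d"
    obtain K :: nat where K: "2 * R / d < K" using reals_Archimedean2 by blast
    \<comment> \<open>Off this ball all bumps with index below \<open>K\<close> vanish, and the
      others have Lipschitz constant at most \<open>2 / real (Suc K)\<close>.\<close>
    define A where "A = cball x0 (r (Suc K) + real (Suc K))"
    have "cmod (G x - G y) < d" if xy: "x \<notin> A" "y \<notin> A" "dist x y < R" for x y
    proof -
      have h0: "h k z = 0" if "k < K" "z \<notin> A" for k z
      proof (rule ccontr)
        assume "h k z \<noteq> 0"
        then obtain a where a: "a \<in> S k" "dist a z < real (Suc k)" using h(5)[of k z] by (auto simp: nbh_iff)
        have "dist x0 z \<le> r (Suc k) + real (Suc k)"
          using ann(2)[of a k] a dist_triangle[of x0 z a] by auto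
        also have "\<dots> \<le> r (Suc K) + real (Suc K)" using that r_mono[of "Suc k" "Suc K"] by auto
        finally show False using that by (simp add: A_def)
      qed
      have "\<bar>g x - g y\<bar> \<le> R / (real (Suc K) / 2)"
      proof (rule g_diff)
        fix k
        show "\<bar>h k x - h k y\<bar> \<le> R / (real (Suc K) / 2)"
        proof (cases "k < K")
          case True then show ?thesis using h0 xy R by simp
        next
          case False
          have "dist x y / (real (Suc k) / 2) \<le> R / (real (Suc K) / 2)"
            using xy(3) R False by (intro frac_le) auto
          then show ?thesis using h(3)[of k x y] by linarith
        qed
      qed
      also have "\<dots> < d"
      proof -
        have "2 * R / d < real (Suc K)" using K by simp
        then show ?thesis using d by (simp add: field_simps)
      qed
      finally show ?thesis by (simp add: G cg)
    qed
    then show "\<exists>A. compact A \<and> (\<forall>x y. x \<notin> A \<and> y \<notin> A \<and> dist x y < R \<longrightarrow> cmod (G x - G y) < d)"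
      by (intro exI[of _ A]) (auto simp: A_def compact_cball)
  qed
  then have "comm b G \<in> K_ideal M p B" using hig by (simp add: commutator_comm)
  moreover have e4: "0 < \<epsilon> / 4" using e by simp
  ultimately obtain r1 where r1: "\<And>r' \<zeta>. r1 \<le> r' \<Longrightarrow> \<zeta> \<in> L \<Longrightarrow> N (res (- cball x0 r') (comm b G \<zeta>)) \<le> \<epsilon> / 4 * N \<zeta>"
    by (rule K_ideal_tail[OF B]) blast
  have G1: "cmod (G x) \<le> 1" for x using g01[of x] by (simp add: G)
  note cb = bop_comm[OF b bcontfun_borel G1]
  obtain k :: nat where k: "r1 \<le> k" using real_arch_simple by blast
  then have rk: "r1 \<le> r k" using r_ge[of k] by linarith
  note T\<xi> = Lp_res[OF \<xi>(1)[of k] meas(2)[of k]]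
  have "S k \<subseteq> - cball x0 (r k)" using ann(1)[of _ k] by force
  then have eq: "res (S k) \<zeta> = res (S k) (res (- cball x0 (r k)) \<zeta>)" for \<zeta> :: "'x \<Rightarrow> 'e"
    by (auto simp: res_def fun_eq_iff)
  have "N (res (S k) (b (res (T k) (\<xi> k)))) = N (res (S k) (comm b G (res (T k) (\<xi> k))))"
    by (rule comm_separated[OF b \<xi>(1)[of k] meas(2)[of k], where \<alpha>=1 and \<beta>=0, symmetric])
       (use gS[of _ k] gT[of _ k] in \<open>auto simp: G\<close>)
  also have "\<dots> \<le> N (res (- cball x0 (r k)) (comm b G (res (T k) (\<xi> k))))"
    unfolding eq[of "comm b G (res (T k) (\<xi> k))"]
    by (intro Lp_res(2)[OF _ meas(1)] Lp_res(1)[OF bop_Lp[OF cb T\<xi>(1)]]) auto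
  also have "\<dots> \<le> \<epsilon> / 4 * N (res (T k) (\<xi> k))" by (rule r1[OF rk T\<xi>(1)])
  also have "\<dots> \<le> \<epsilon> / 4 * N (\<xi> k)" using T\<xi>(2) e by (intro mult_left_mono) auto
  also have "\<dots> \<le> \<epsilon> / 2 * N (\<xi> k)" using e by (intro mult_right_mono) auto
  finally show False using \<xi>(2)[of k] by simp
qed

section \<open>From quasi-locality to Higson commutators\<close>

lemma banach_subalgebraD:
  assumes "banach_subalgebra M p B"
  shows "B \<subseteq> Collect (bounded_op M p)" "\<And>a b. a \<in> B \<Longrightarrow> b \<in> B \<Longrightarrow> op_add a b \<in> B"
    "\<And>c a. a \<in> B \<Longrightarrow> op_scale c a \<in> B"
  using assms unfolding banach_subalgebra_def by blast+

lemma op_diff_in: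
  assumes "banach_subalgebra M p B" "a \<in> B" "b \<in> B"
  shows "op_diff a b \<in> B"
proof -
  have "op_add a (op_scale (-1) b) \<in> B" using banach_subalgebraD[OF assms(1)] assms(2,3) by blast
  moreover have "op_add a (op_scale (-1) b) = op_diff a b"
    by (simp add: op_add_def op_scale_def op_diff_def scaleC_minus_one)
  ultimately show ?thesis by simp
qed

lemma sandwich_in:
  assumes "sandwich UNIV B = B" "b \<in> B"
  shows "mult_op f \<circ> b \<circ> mult_op g \<in> B"
  using assms unfolding sandwich_def by blast

lemma mult_op_one: "mult_op (const_bcontfun 1) = id"
  by (simp add: mult_op_def fun_eq_iff scaleC_one)

text \<open>A sandwich with the constant function 1 on one side is a one-sided product.\<close>

lemma commutator_in:
  assumes "banach_subalgebra M p B" "sandwich UNIV B = B" "b \<in> B"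
  shows "commutator b g \<in> B"
  unfolding commutator_def
  using sandwich_in[OF assms(2,3), of "const_bcontfun 1" g] sandwich_in[OF assms(2,3), of g "const_bcontfun 1"]
  by (intro op_diff_in[OF assms(1)]) (simp_all add: mult_op_one)

text \<open>Off a ball \<open>T\<close> the function \<open>g\<close> is nearly constant at scale
  \<open>R\<close>, so the corner of the commutator over the complement \<open>Y\<close> is small.
  The corners between \<open>T\<close> and a set \<open>S\<close> still further out are small by
  quasi-locality, on either side.\<close>

lemma higson_commutator_tail:
  fixes b :: "('x, 'e::complex_banach) fun_op"
  assumes b: "bounded_op M p b" and q: "\<And>\<epsilon>. 0 < \<epsilon> \<Longrightarrow> \<exists>R. ql_bound b \<epsilon> R"
    and g: "g \<in> higson" and e: "0 < \<epsilon>"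
  obtains r where "\<And>\<xi>. \<xi> \<in> L \<Longrightarrow> N (res (- cball x0 r) (comm b g \<xi>)) \<le> \<epsilon> * N \<xi>"
    "\<And>\<xi>. \<xi> \<in> L \<Longrightarrow> N (comm b g (res (- cball x0 r) \<xi>)) \<le> \<epsilon> * N \<xi>"
proof -
  define C where "C = norm g + 1"
  have C: "0 < C" by (simp add: C_def add_nonneg_pos)
  have gC: "cmod (g x) \<le> C" for x using norm_bounded[of g x] by (simp add: C_def)
  note cb = bop_comm[OF b bcontfun_borel gC]
  have e2: "0 < \<epsilon> / 2" using e by simp
  obtain R \<delta> where R: "0 < R" "0 < \<delta>" and *:
    "\<And>Y f \<xi>. \<lbrakk>Y \<in> sets borel; f \<in> borel_measurable borel; \<And>x. cmod (f x) \<le> C;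
       \<And>x y. x \<in> Y \<Longrightarrow> y \<in> Y \<Longrightarrow> dist x y < R \<Longrightarrow> cmod (f x - f y) \<le> \<delta>; \<xi> \<in> L\<rbrakk>
     \<Longrightarrow> N (res Y (comm b f (res Y \<xi>))) \<le> \<epsilon> / 2 * N \<xi>"
    by (rule commutator_complex[OF b q e2 C]) blast+
  have "\<exists>A. compact A \<and> (\<forall>x y. x \<notin> A \<and> y \<notin> A \<and> dist x y < R \<longrightarrow> cmod (g x - g y) < \<delta>)"
    using g R unfolding higson_def by simp
  then obtain A where A: "compact A" "\<And>x y. x \<notin> A \<Longrightarrow> y \<notin> A \<Longrightarrow> dist x y < R \<Longrightarrow> cmod (g x - g y) < \<delta>"
    by auto
  obtain r1 where r1: "\<And>y. y \<in> A \<Longrightarrow> dist x0 y \<le> r1"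
    using compact_imp_bounded[OF A(1)] bounded_any_center[of A x0] by blast
  define Y T where "Y = - cball x0 r1" and "T = cball x0 r1"
  have YT: "Y \<in> sets borel" "T \<in> sets borel" by (auto simp: Y_def T_def)
  have notA: "x \<notin> A" if "x \<in> Y" for x using r1[of x] that by (auto simp: Y_def)
  have Y: "N (res Y (comm b g (res Y \<xi>))) \<le> \<epsilon> / 2 * N \<xi>" if "\<xi> \<in> L" for \<xi>
    by (rule *[OF YT(1) bcontfun_borel gC less_imp_le[OF A(2)[OF notA notA]] that])
  define e' where "e' = \<epsilon> / (4 * C)"
  have e': "0 < e'" "2 * C * e' = \<epsilon> / 2" using e C by (auto simp: e'_def)
  obtain R' where R': "ql_bound b e' R'" using q[OF e'(1)] by blast
  define r where "r = r1 + max R' 0"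
  define S where "S = - cball x0 r"
  have S: "S \<in> sets borel" "S \<subseteq> Y" by (auto simp: S_def Y_def r_def)
  have d: "R' \<le> dist x y" if "x \<in> S" "y \<in> T" for x y
    using that dist_triangle[of x0 x y] dist_commute[of x y] by (simp add: S_def T_def r_def)
  have d': "R' \<le> dist x y" if "x \<in> T" "y \<in> S" for x y using d[OF that(2,1)] by (simp add: dist_commute)
  have far: "N (res S (comm b g (res T \<xi>))) \<le> \<epsilon> / 2 * N \<xi>" "N (res T (comm b g (res S \<xi>))) \<le> \<epsilon> / 2 * N \<xi>"
    if "\<xi> \<in> L" for \<xi>
    using comm_far[OF b bcontfun_borel gC R' S(1) YT(2) d that] comm_far[OF b bcontfun_borel gC R' YT(2) S(1) d' that]
      e' by auto
  show ?thesis
  proof (rule that[of r])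
    fix \<xi> :: "'x \<Rightarrow> 'e" assume \<xi>: "\<xi> \<in> L"
    have L: "res V \<xi> \<in> L" "comm b g (res V \<xi>) \<in> L" if "V \<in> sets borel" for V
      using that \<xi> by (auto intro: Lp_res bop_Lp[OF cb])
    have "\<xi> = (\<lambda>y. res Y \<xi> y + res T \<xi> y)" by (auto simp: res_def Y_def T_def fun_eq_iff)
    then have "AE x in M. comm b g \<xi> x = comm b g (res Y \<xi>) x + comm b g (res T \<xi>) x"
      using bop_add[OF cb L(1)[OF YT(1)] L(1)[OF YT(2)]] by simp
    then have "N (res S (comm b g \<xi>)) \<le> N (res S (comm b g (res Y \<xi>))) + N (res S (comm b g (res T \<xi>)))"
      by (intro N_le_add Lp_res(1) L YT S) (auto simp: res_def elim!: eventually_mono)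
    also have "res S (comm b g (res Y \<xi>)) = res S (res Y (comm b g (res Y \<xi>)))"
      using S(2) by (auto simp: res_def fun_eq_iff)
    also have "N \<dots> \<le> N (res Y (comm b g (res Y \<xi>)))" by (intro Lp_res(2)[OF Lp_res(1)] L YT S)
    also have "\<dots> \<le> \<epsilon> / 2 * N \<xi>" by (rule Y[OF \<xi>])
    finally show "N (res (- cball x0 r) (comm b g \<xi>)) \<le> \<epsilon> * N \<xi>" using far(1)[OF \<xi>] by (simp add: S_def)
    have "res Y (res S \<xi>) = res S \<xi>" using S(2) by (auto simp: res_def fun_eq_iff)
    then have "N (res Y (comm b g (res S \<xi>))) \<le> \<epsilon> / 2 * N (res S \<xi>)" using Y[OF L(1)[OF S(1)]] by simp
    also have "\<dots> \<le> \<epsilon> / 2 * N \<xi>" using Lp_res(2)[OF \<xi> S(1)] e by (intro mult_left_mono) auto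
    finally have "N (res Y (comm b g (res S \<xi>))) \<le> \<epsilon> / 2 * N \<xi>" .
    moreover have "N (comm b g (res S \<xi>)) \<le> N (res T (comm b g (res S \<xi>))) + N (res Y (comm b g (res S \<xi>)))"
      using N_split[OF L(2)[OF S(1)] YT(2)] by (simp add: Y_def T_def)
    ultimately show "N (comm b g (res (- cball x0 r) \<xi>)) \<le> \<epsilon> * N \<xi>" using far(2)[OF \<xi>] by (simp add: S_def)
  qed
qed

text \<open>For the commutator \<open>c\<close> and a compactly supported bump \<open>h\<close>, put
  \<open>k = 1 - h\<close>. Then \<open>c - h c h = k c + h c k\<close>, and \<open>k\<close> lives
  where both tails of \<open>c\<close> are small. The bound 2 for \<open>k\<close> and the tails
  \<open>\<epsilon> / 8\<close> give \<open>\<epsilon> / 2\<close>.\<close>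

lemma ql_imp_higson:
  fixes b :: "('x, 'e::complex_banach) fun_op"
  assumes B: "banach_subalgebra M p B" "sandwich UNIV B = B" and b: "b \<in> B"
    and q: "\<And>\<epsilon>. 0 < \<epsilon> \<Longrightarrow> \<exists>R. ql_bound b \<epsilon> R" and g: "g \<in> higson"
  shows "commutator b g \<in> K_ideal M p B"
proof -
  have bb: "bounded_op M p b" using banach_subalgebraD(1)[OF B(1)] b by blast
  note cB = commutator_in[OF B b, of g]
  then have cb: "bounded_op M p (commutator b g)" using banach_subalgebraD(1)[OF B(1)] by blast
  show ?thesis
    unfolding K_ideal_def op_closure_def
  proof (intro CollectI conjI allI impI cb)
    fix \<epsilon> :: real assume e: "0 < \<epsilon>"
    then have e8: "0 < \<epsilon> / 8" by simp
    obtain r where r: "\<And>\<xi>. \<xi> \<in> L \<Longrightarrow> N (res (- cball x0 r) (comm b g \<xi>)) \<le> \<epsilon> / 8 * N \<xi>"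
      "\<And>\<xi>. \<xi> \<in> L \<Longrightarrow> N (comm b g (res (- cball x0 r) \<xi>)) \<le> \<epsilon> / 8 * N \<xi>"
      by (rule higson_commutator_tail[OF bb q g e8]) blast+
    obtain h :: "'x \<Rightarrow>\<^sub>C complex" where h: "\<And>x. cmod (h x) \<le> 1"
      and h1: "\<And>x. x \<in> cball x0 r \<Longrightarrow> h x = 1" and h0: "\<And>x. x \<notin> cball x0 (r + 2) \<Longrightarrow> h x = 0"
      by (rule ball_bump[of r]) blast
    have hC0: "h \<in> C0"
      unfolding C0_def
      by (intro CollectI allI impI exI[of _ "cball x0 (r + 2)"]) (simp add: compact_cball h0 del: mem_cball)
    define s where "s = mult_op h \<circ> commutator b g \<circ> mult_op h"
    have "s \<in> sandwich C0 B" unfolding s_def sandwich_def using hC0 cB by blast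
    define c where "c = comm b g"
    have c: "bounded_op M p c" using cb by (simp add: c_def commutator_comm)
    define V where "V = - cball x0 r"
    have V: "V \<in> sets borel" by (simp add: V_def)
    define k where "k x = 1 - h x" for x
    have k: "k \<in> borel_measurable borel" "\<And>x. cmod (k x) \<le> 2"
    proof -
      note [measurable] = bcontfun_borel[of h]
      show "k \<in> borel_measurable borel" unfolding k_def by measurable
      show "cmod (k x) \<le> 2" for x using norm_triangle_ineq4[of 1 "h x"] h[of x] by (simp add: k_def)
    qed
    have kV: "cmul k \<zeta> = cmul k (res V \<zeta>)" "cmul k \<zeta> = res V (cmul k \<zeta>)" for \<zeta> :: "'x \<Rightarrow> 'e"
      by (auto simp: cmul_def k_def res_def V_def fun_eq_iff h1)
    have "op_norm M p (op_diff (commutator b g) s) \<le> \<epsilon> / 2"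
    proof (rule op_norm_le)
      fix \<xi> :: "'x \<Rightarrow> 'e" assume \<xi>: "\<xi> \<in> L"
      have h\<xi>: "cmul h \<xi> \<in> L" by (rule Lp_cmul(1)[OF \<xi> bcontfun_borel h])
      have k\<xi>: "cmul k \<xi> \<in> L" "N (cmul k \<xi>) \<le> 2 * N \<xi>" by (rule Lp_cmul[OF \<xi> k])+
      have c\<xi>: "c \<xi> \<in> L" by (rule bop_Lp[OF c \<xi>])
      have L1: "cmul k (res V (c \<xi>)) \<in> L" by (intro Lp_cmul(1)[OF _ k] Lp_res(1) c\<xi> V)
      have L2: "cmul h (c (cmul k \<xi>)) \<in> L" by (intro Lp_cmul(1)[OF _ bcontfun_borel h] bop_Lp[OF c] k\<xi>)
      have eq: "\<xi> = (\<lambda>y. cmul h \<xi> y + cmul k \<xi> y)"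
        by (simp add: cmul_def k_def fun_eq_iff scaleC_diff_left scaleC_one)
      have "AE x in M. c \<xi> x = c (cmul h \<xi>) x + c (cmul k \<xi>) x"
        using bop_add[OF c h\<xi> k\<xi>(1)] eq by simp
      then have "AE x in M. op_diff (commutator b g) s \<xi> x = cmul k (res V (c \<xi>)) x + cmul h (c (cmul k \<xi>)) x"
      proof eventually_elim
        case (elim x)
        have "op_diff (commutator b g) s \<xi> x = c \<xi> x - h x *\<^sub>C c (cmul h \<xi>) x"
          by (simp add: op_diff_def s_def mult_op_cmul c_def commutator_comm cmul_def)
        also have "\<dots> = k x *\<^sub>C c \<xi> x + h x *\<^sub>C c (cmul k \<xi>) x"
          using elim by (simp add: k_def scaleC_diff_left scaleC_one scaleC_add_right)
        finally show ?case by (subst kV(1)[symmetric]) (simp add: cmul_def)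
      qed
      then have "N (op_diff (commutator b g) s \<xi>) \<le> N (cmul k (res V (c \<xi>))) + N (cmul h (c (cmul k \<xi>)))"
        by (rule N_le_add[OF L1 L2])
      also have "N (cmul k (res V (c \<xi>))) \<le> 2 * (\<epsilon> / 8 * N \<xi>)"
        using Lp_cmul(2)[OF Lp_res(1)[OF c\<xi> V] k] r(1)[OF \<xi>] by (simp add: c_def V_def)
      also have "N (cmul h (c (cmul k \<xi>))) \<le> 1 * N (c (cmul k \<xi>))"
        by (intro Lp_cmul(2)[OF _ bcontfun_borel h] bop_Lp[OF c] k\<xi>)
      also have "N (c (cmul k \<xi>)) \<le> \<epsilon> / 8 * N (cmul k \<xi>)"
        using r(2)[OF k\<xi>(1)] kV(2)[of \<xi>] by (simp add: c_def V_def)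
      also have "\<dots> \<le> \<epsilon> / 8 * (2 * N \<xi>)" using k\<xi>(2) e by (intro mult_left_mono) auto
      finally show "N (op_diff (commutator b g) s \<xi>) \<le> \<epsilon> / 2 * N \<xi>" by simp
    qed (use e in simp)
    then show "\<exists>s\<in>sandwich C0 B. op_norm M p (op_diff (commutator b g) s) < \<epsilon>"
      using \<open>s \<in> sandwich C0 B\<close> e by (intro bexI[of _ s]) auto
  qed
qed

text \<open>For an approximant \<open>a\<close> of finite propagation, \<open>f a f'\<close>
  vanishes for far supports, so \<open>f b f' = f (b - a) f'\<close> has norm at most that of
  \<open>b - a\<close>.\<close>

lemma Roe_imp_quasi_local:
  fixes b :: "('x, 'e::complex_banach) fun_op"
  assumes B: "B \<subseteq> Collect (bounded_op M p)" and b: "b \<in> Roe M p B"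
  shows "quasi_local M p b"
  unfolding quasi_local_def
proof (intro allI impI)
  fix \<epsilon> :: real assume e: "0 < \<epsilon>"
  have bb: "bounded_op M p b" using b by (simp add: Roe_def op_closure_def)
  obtain a R where a: "a \<in> B" "0 \<le> R" "propagation_le M p a R" and lt: "op_norm M p (op_diff b a) < \<epsilon>"
    using b e unfolding Roe_def op_closure_def by blast
  have ab: "bounded_op M p a" using a(1) B by blast
  note db = bop_op_diff[OF bb ab]
  have "op_norm M p (mult_op f \<circ> b \<circ> mult_op f') < \<epsilon>"
    if ff: "norm f \<le> 1" "norm f' \<le> 1" "far_apart R (supp f) (supp f')" for f f' :: "'x \<Rightarrow>\<^sub>C complex"
  proof -
    have f1: "cmod (f x) \<le> 1" "cmod (f' x) \<le> 1" for x using norm_bounded order_trans ff by blast+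
    have "op_norm M p (mult_op f \<circ> b \<circ> mult_op f') \<le> op_norm M p (op_diff b a)"
    proof (rule op_norm_le[OF op_norm_nonneg[OF db]])
      fix \<xi> :: "'x \<Rightarrow> 'e" assume \<xi>: "\<xi> \<in> L"
      have f\<xi>: "cmul f' \<xi> \<in> L" "N (cmul f' \<xi>) \<le> 1 * N \<xi>" by (rule Lp_cmul[OF \<xi> bcontfun_borel f1(2)])+
      have "AE x in M. (mult_op f \<circ> a \<circ> mult_op f') \<xi> x = 0"
        using a(3) ff(3) \<xi> unfolding propagation_le_def by blast
      then have "AE x in M. (mult_op f \<circ> b \<circ> mult_op f') \<xi> x = cmul f (op_diff b a (cmul f' \<xi>)) x"
        by eventually_elim (simp add: mult_op_cmul cmul_def op_diff_def scaleC_diff_right)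
      then have "N ((mult_op f \<circ> b \<circ> mult_op f') \<xi>) = N (cmul f (op_diff b a (cmul f' \<xi>)))" by (rule N_cong)
      also have "\<dots> \<le> 1 * N (op_diff b a (cmul f' \<xi>))"
        by (intro Lp_cmul(2)[OF _ bcontfun_borel f1(1)] bop_Lp[OF db] f\<xi>)
      also have "\<dots> \<le> op_norm M p (op_diff b a) * N (cmul f' \<xi>)" using bop_norm[OF db f\<xi>(1)] by simp
      also have "\<dots> \<le> op_norm M p (op_diff b a) * N \<xi>"
        using f\<xi>(2) op_norm_nonneg[OF db] by (intro mult_left_mono) auto
      finally show "N ((mult_op f \<circ> b \<circ> mult_op f') \<xi>) \<le> op_norm M p (op_diff b a) * N \<xi>" .
    qed
    then show ?thesis using lt by simp
  qed
  then show "\<exists>R\<ge>0. eps_propagation_le M p \<epsilon> b R"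
    unfolding eps_propagation_le_def using a(2) by blast
qed

end

text \<open>Such a set is a subset of \<open>J - {i, j}\<close> with \<open>i\<close> added. That
  the count is the same for all pairs makes the plain average over subsets reproduce the
  off-diagonal part.\<close>

lemma card_separating_subsets:
  assumes "finite J" "i \<in> J" "j \<in> J" "i \<noteq> j"
  shows "4 * card {S \<in> Pow J. i \<in> S \<and> j \<notin> S} = 2 ^ card J"
proof -
  let ?K = "J - {i, j}"
  have "{S \<in> Pow J. i \<in> S \<and> j \<notin> S} = insert i ` Pow ?K"
  proof
    show "{S \<in> Pow J. i \<in> S \<and> j \<notin> S} \<subseteq> insert i ` Pow ?K"
    proof
      fix S assume "S \<in> {S \<in> Pow J. i \<in> S \<and> j \<notin> S}"
      then have "S = insert i (S - {i})" "S - {i} \<in> Pow ?K" by auto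
      then show "S \<in> insert i ` Pow ?K" by blast
    qed
    show "insert i ` Pow ?K \<subseteq> {S \<in> Pow J. i \<in> S \<and> j \<notin> S}" using assms by auto
  qed
  moreover have "inj_on (insert i) (Pow ?K)" by (auto simp: inj_on_def)
  moreover have "card J = card ?K + 2"
  proof -
    have "J = insert i (insert j ?K)" using assms by blast
    then show ?thesis using assms by (metis card_insert_disjoint finite_Diff insert_iff Diff_iff
          finite_insert add_2_eq_Suc' singletonD insertI1)
  qed
  ultimately show ?thesis using assms(1) by (simp add: card_image card_Pow power_add)
qed

context proper_Lp
begin

section \<open>Block-diagonal operators\<close>

text \<open>Cover the compact ball by finitely many balls of radius \<open>s / 2\<close>. Two sets
  assigned to the same centre would be closer than \<open>s\<close>.\<close>

lemma finite_separated:
  fixes V :: "'i \<Rightarrow> 'x set"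
  assumes s: "0 < s" and sep: "\<And>i j x y. \<lbrakk>i \<in> I; j \<in> I; i \<noteq> j; x \<in> V i; y \<in> V j\<rbrakk> \<Longrightarrow> s \<le> dist x y"
  shows "finite {i \<in> I. V i \<inter> cball x0 r \<noteq> {}}"
proof -
  obtain K where K: "finite K" "cball x0 r \<subseteq> (\<Union>c\<in>K. ball c (s / 2))"
    using compact_cball[of x0 r] s unfolding compact_eq_totally_bounded by (meson half_gt_zero)
  let ?J = "{i \<in> I. V i \<inter> cball x0 r \<noteq> {}}"
  have "\<forall>i\<in>?J. \<exists>c. c \<in> K \<and> (\<exists>x\<in>V i. dist c x < s / 2)"
  proof
    fix i assume "i \<in> ?J"
    then obtain x where x: "x \<in> V i" "x \<in> cball x0 r" by blast
    then obtain c where "c \<in> K" "x \<in> ball c (s / 2)" using K(2) by blast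
    then show "\<exists>c. c \<in> K \<and> (\<exists>x\<in>V i. dist c x < s / 2)" using x(1) by auto
  qed
  from bchoice[OF this] obtain c where c: "\<And>i. i \<in> ?J \<Longrightarrow> c i \<in> K"
    "\<And>i. i \<in> ?J \<Longrightarrow> \<exists>x\<in>V i. dist (c i) x < s / 2" by blast
  have "inj_on c ?J"
  proof (rule inj_onI, rule ccontr)
    fix i j assume ij: "i \<in> ?J" "j \<in> ?J" "c i = c j" "i \<noteq> j"
    obtain x y where "x \<in> V i" "dist (c i) x < s / 2" "y \<in> V j" "dist (c i) y < s / 2"
      using c(2)[OF ij(1)] c(2)[OF ij(2)] ij(3) by auto
    moreover from this have "s \<le> dist x y" using sep[of i j x y] ij by auto
    ultimately show False using dist_triangle3[of x y "c i"] by linarith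
  qed
  then show ?thesis using K(1) c(1) by (meson finite_subset inj_on_finite image_subsetI)
qed

text \<open>Members need only be Borel, so functions cut sharply by a set qualify. One common
  \<open>\<delta>\<close> instead of mere disjointness makes the family locally finite in a proper
  space.\<close>

definition sepfam :: "('x \<Rightarrow> complex) set \<Rightarrow> bool" where
  "sepfam F \<longleftrightarrow> (\<forall>e\<in>F. e \<in> borel_measurable borel \<and> (\<forall>x. cmod (e x) \<le> 1)) \<and>
     (\<exists>\<delta>>0. \<forall>e\<in>F. \<forall>e'\<in>F. e \<noteq> e' \<longrightarrow> (\<forall>x y. e x \<noteq> 0 \<longrightarrow> e' y \<noteq> 0 \<longrightarrow> \<delta> \<le> dist x y))"

text \<open>The sum of all \<open>e a e\<close>, written pointwise: in a separated family at most
  one member is nonzero at a given point, so there is no convergence to discuss and the choice is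
  unique.\<close>

definition blk :: "('x \<Rightarrow> complex) set \<Rightarrow> ('x, 'e::complex_banach) fun_op \<Rightarrow> ('x, 'e) fun_op" where
  "blk F a = (\<lambda>\<xi> x. if \<exists>e\<in>F. e x \<noteq> 0
     then (let e = SOME e. e \<in> F \<and> e x \<noteq> 0 in e x *\<^sub>C a (cmul e \<xi>) x) else 0)"

lemma sepfamD:
  assumes "sepfam F" "e \<in> F"
  shows "e \<in> borel_measurable borel" "cmod (e x) \<le> 1" "{x. e x \<noteq> 0} \<in> sets borel"
proof -
  show *: "e \<in> borel_measurable borel" "cmod (e x) \<le> 1" using assms unfolding sepfam_def by auto
  have "{x \<in> space borel. e x \<noteq> 0} \<in> sets borel" using *(1) by measurable
  then show "{x. e x \<noteq> 0} \<in> sets borel" by simp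
qed

lemma sepfam_unique: "\<lbrakk>sepfam F; e \<in> F; e' \<in> F; e x \<noteq> 0; e' x \<noteq> 0\<rbrakk> \<Longrightarrow> e = e'"
  unfolding sepfam_def by (metis dist_self not_le)

lemma blk_at:
  assumes "sepfam F" "e \<in> F" "e x \<noteq> 0"
  shows "blk F a \<xi> x = e x *\<^sub>C a (cmul e \<xi>) x"
proof -
  have "(SOME e. e \<in> F \<and> e x \<noteq> 0) = e"
    by (rule some_equality) (use assms sepfam_unique[OF assms(1)] in auto)
  then show ?thesis using assms by (auto simp: blk_def)
qed

lemma blk_off: "(\<And>e. e \<in> F \<Longrightarrow> e x = 0) \<Longrightarrow> blk F a \<xi> x = 0"
  by (auto simp: blk_def)

lemma sepfam_finite:
  assumes "sepfam F"
  shows "finite {e \<in> F. \<exists>x\<in>cball x0 r. e x \<noteq> 0}"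
proof -
  obtain \<delta> where "0 < \<delta>" "\<And>e e' x y. \<lbrakk>e \<in> F; e' \<in> F; e \<noteq> e'; x \<in> {x. e x \<noteq> 0}; y \<in> {x. e' x \<noteq> 0}\<rbrakk> \<Longrightarrow> \<delta> \<le> dist x y"
    using assms unfolding sepfam_def by auto
  from finite_separated[where V="\<lambda>e. {x. e x \<noteq> 0}" and I=F and r=r, OF this]
  have "finite {e \<in> F. {x. e x \<noteq> 0} \<inter> cball x0 r \<noteq> {}}" .
  then show ?thesis by (rule rev_finite_subset) auto
qed

text \<open>Each ball meets finitely many members. Countability allows the exceptional null sets of
  the single members to be merged and their norms to be summed.\<close>

lemma sepfam_countable:
  assumes "sepfam F" shows "countable F"
proof -
  have "F \<subseteq> insert (\<lambda>x. 0) (\<Union>n::nat. {e \<in> F. \<exists>x\<in>cball x0 (real n). e x \<noteq> 0})"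
  proof
    fix e assume e: "e \<in> F"
    show "e \<in> insert (\<lambda>x. 0) (\<Union>n::nat. {e \<in> F. \<exists>x\<in>cball x0 (real n). e x \<noteq> 0})"
    proof (cases "e = (\<lambda>x. 0)")
      case False
      then obtain x where "e x \<noteq> 0" by auto
      moreover obtain n :: nat where "dist x0 x \<le> n" using real_arch_simple by blast
      ultimately show ?thesis using e by auto
    qed simp
  qed
  moreover have "countable \<dots>"
    by (intro countable_insert countable_UN[OF countableI_type] countable_finite[OF sepfam_finite[OF assms]])
  ultimately show ?thesis by (rule countable_subset)
qed

lemma blk_local:
  assumes F: "sepfam F" and e: "e \<in> F"
  shows "res {x. e x \<noteq> 0} (blk F a \<xi>) = cmul e (a (cmul e (res {x. e x \<noteq> 0} \<xi>)))"
proof -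
  have eq: "cmul e (res {x. e x \<noteq> 0} \<xi>) = cmul e \<xi>" by (auto simp: cmul_def res_def fun_eq_iff)
  show ?thesis
    unfolding eq
    by (auto simp: fun_eq_iff res_def[of "{x. e x \<noteq> 0}"] blk_at[OF F e] cmul_def[of e "a _"])
qed

text \<open>Each block acts within the carrier of its \<open>e\<close>, and carriers are disjoint,
  so \<open>Lp_norm_block\<close> yields the norm of \<open>a\<close> without a factor.
  Measurability is glued from balls, on which the sum is finite.\<close>

lemma blk_bound:
  fixes a :: "('x, 'e::complex_banach) fun_op"
  assumes F: "sepfam F" and a: "bounded_op M p a" and \<xi>: "\<xi> \<in> L"
  shows "blk F a \<xi> \<in> L" "N (blk F a \<xi>) \<le> op_norm M p a * N \<xi>"
proof -
  have eL: "cmul e \<zeta> \<in> L" "N (cmul e \<zeta>) \<le> 1 * N \<zeta>" if "e \<in> F" "\<zeta> \<in> L" for e and \<zeta> :: "'x \<Rightarrow> 'e"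
    using Lp_cmul[OF that(2) sepfamD(1,2)[OF F that(1)]] by auto
  have aL: "cmul e (a (cmul e \<zeta>)) \<in> L" if "e \<in> F" "\<zeta> \<in> L" for e \<zeta>
    by (intro eL(1) bop_Lp[OF a] that)
  have bm: "bochner_measurable M (blk F a \<xi>)"
  proof (rule bochner_measurable_exhaust)
    fix n :: nat
    let ?V = "cball x0 (real n)" and ?F = "{e \<in> F. \<exists>x\<in>cball x0 (real n). e x \<noteq> 0}"
    show "?V \<in> sets M" by (simp add: sets_M)
    have "res ?V (blk F a \<xi>) = res ?V (\<lambda>x. \<Sum>e\<in>?F. cmul e (a (cmul e \<xi>)) x)"
    proof
      fix x
      show "res ?V (blk F a \<xi>) x = res ?V (\<lambda>x. \<Sum>e\<in>?F. cmul e (a (cmul e \<xi>)) x) x"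
      proof (cases "x \<in> ?V \<and> (\<exists>e\<in>F. e x \<noteq> 0)")
        case True
        then obtain e where e: "x \<in> ?V" "e \<in> F" "e x \<noteq> 0" by blast
        have "(\<Sum>e\<in>?F. cmul e (a (cmul e \<xi>)) x) = (\<Sum>e'\<in>{e}. cmul e' (a (cmul e' \<xi>)) x)"
        proof (rule sum.mono_neutral_right)
          show "\<forall>e'\<in>?F - {e}. cmul e' (a (cmul e' \<xi>)) x = 0"
          proof
            fix e' assume "e' \<in> ?F - {e}"
            then have "e' x = 0" using sepfam_unique[OF F _ e(2) _ e(3), of e'] by auto
            then show "cmul e' (a (cmul e' \<xi>)) x = 0" by (simp add: cmul_def)
          qed
        qed (use e sepfam_finite[OF F] in auto)
        then show ?thesis using e blk_at[OF F e(2,3)] by (simp add: res_def cmul_def)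
      next
        case False
        then consider "x \<notin> ?V" | "x \<in> ?V" "\<And>e. e \<in> F \<Longrightarrow> e x = 0" by blast
        then show ?thesis
        proof cases
          case 2
          have "(\<Sum>e\<in>?F. cmul e (a (cmul e \<xi>)) x) = 0"
            by (rule sum.neutral) (auto simp: cmul_def 2(2))
          then show ?thesis using blk_off[of F x a \<xi>] 2(2) by (simp add: res_def)
        qed (simp add: res_def)
      qed
    qed
    moreover have "(\<lambda>x. \<Sum>e\<in>?F. cmul e (a (cmul e \<xi>)) x) \<in> L" by (intro Lp_sum aL \<xi>) auto
    ultimately have "res ?V (blk F a \<xi>) \<in> L" by (simp add: Lp_res)
    then show "bochner_measurable M (res ?V (blk F a \<xi>))" by (simp add: Lp_iff)
  next
    show "incseq (\<lambda>n. cball x0 (real n))" by (auto simp: incseq_def)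
    show "(\<Union>n. cball x0 (real n)) = space M" using real_arch_simple by auto
  qed
  have dj: "disjoint_family_on (\<lambda>e. {x. e x \<noteq> 0}) F"
    unfolding disjoint_family_on_def using sepfam_unique[OF F] by blast
  have le: "res {x. e x \<noteq> 0} (blk F a \<xi>) \<in> L \<and>
      N (res {x. e x \<noteq> 0} (blk F a \<xi>)) \<le> op_norm M p a * N (res {x. e x \<noteq> 0} \<xi>)" if e: "e \<in> F" for e
  proof -
    note r = Lp_res(1)[OF \<xi> sepfamD(3)[OF F e]]
    have "N (cmul e (a (cmul e (res {x. e x \<noteq> 0} \<xi>)))) \<le> N (a (cmul e (res {x. e x \<noteq> 0} \<xi>)))"
      using eL(2)[OF e bop_Lp[OF a eL(1)[OF e r]]] by simp
    also have "\<dots> \<le> op_norm M p a * N (cmul e (res {x. e x \<noteq> 0} \<xi>))" by (rule bop_norm[OF a eL(1)[OF e r]])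
    also have "\<dots> \<le> op_norm M p a * N (res {x. e x \<noteq> 0} \<xi>)"
      using eL(2)[OF e r] op_norm_nonneg[OF a] by (intro mult_left_mono) auto
    finally show ?thesis using aL[OF e r] by (simp add: blk_local[OF F e])
  qed
  have off: "blk F a \<xi> x = 0" if "x \<notin> (\<Union>e\<in>F. {x. e x \<noteq> 0})" for x
    using that by (intro blk_off) auto
  show "blk F a \<xi> \<in> L" "N (blk F a \<xi>) \<le> op_norm M p a * N \<xi>"
    using Lp_norm_block[OF p sepfam_countable[OF F] op_norm_nonneg[OF a] dj _ dj _ bm off \<xi> le]
      sepfamD(3)[OF F] by (auto simp: sets_M)
qed

lemma bop_blk:
  fixes a :: "('x, 'e::complex_banach) fun_op"
  assumes F: "sepfam F" and a: "bounded_op M p a"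
  shows "bounded_op M p (blk F a)"
proof (rule bounded_opI)
  fix \<xi> \<eta> :: "'x \<Rightarrow> 'e" and c :: complex assume \<xi>: "\<xi> \<in> L"
  show "blk F a \<xi> \<in> L" "N (blk F a \<xi>) \<le> op_norm M p a * N \<xi>" by (rule blk_bound[OF F a \<xi>])+
  have eL: "cmul e \<zeta> \<in> L" if "e \<in> F" "\<zeta> \<in> L" for e and \<zeta> :: "'x \<Rightarrow> 'e"
    using Lp_cmul(1)[OF that(2) sepfamD(1,2)[OF F that(1)]] .
  have AE_F: "AE x in M. \<forall>e\<in>F. Q e x" if "\<And>e. e \<in> F \<Longrightarrow> AE x in M. Q e x" for Q
    using that sepfam_countable[OF F] by (simp add: AE_ball_countable)
  have "AE x in M. \<forall>e\<in>F. a (cmul e (\<lambda>y. c *\<^sub>C \<xi> y)) x = c *\<^sub>C a (cmul e \<xi>) x"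
  proof (rule AE_F)
    fix e assume e: "e \<in> F"
    have "cmul e (\<lambda>y. c *\<^sub>C \<xi> y) = (\<lambda>y. c *\<^sub>C cmul e \<xi> y)"
      by (simp add: cmul_def scaleC_scaleC mult.commute)
    then show "AE x in M. a (cmul e (\<lambda>y. c *\<^sub>C \<xi> y)) x = c *\<^sub>C a (cmul e \<xi>) x"
      using bop_scale[OF a eL[OF e \<xi>], of c] by simp
  qed
  then show "AE x in M. blk F a (\<lambda>y. c *\<^sub>C \<xi> y) x = c *\<^sub>C blk F a \<xi> x"
  proof eventually_elim
    case (elim x)
    show ?case
    proof (cases "\<exists>e\<in>F. e x \<noteq> 0")
      case True
      then obtain e where e: "e \<in> F" "e x \<noteq> 0" by blast
      show ?thesis using elim e by (simp add: blk_at[OF F e] scaleC_scaleC mult.commute)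
    qed (simp add: blk_off)
  qed
  assume \<eta>: "\<eta> \<in> L"
  have "AE x in M. \<forall>e\<in>F. a (cmul e (\<lambda>y. \<xi> y + \<eta> y)) x = a (cmul e \<xi>) x + a (cmul e \<eta>) x"
  proof (rule AE_F)
    fix e assume e: "e \<in> F"
    have "cmul e (\<lambda>y. \<xi> y + \<eta> y) = (\<lambda>y. cmul e \<xi> y + cmul e \<eta> y)"
      by (simp add: cmul_def scaleC_add_right)
    then show "AE x in M. a (cmul e (\<lambda>y. \<xi> y + \<eta> y)) x = a (cmul e \<xi>) x + a (cmul e \<eta>) x"
      using bop_add[OF a eL[OF e \<xi>] eL[OF e \<eta>]] by simp
  qed
  then show "AE x in M. blk F a (\<lambda>y. \<xi> y + \<eta> y) x = blk F a \<xi> x + blk F a \<eta> x"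
  proof eventually_elim
    case (elim x)
    show ?case
    proof (cases "\<exists>e\<in>F. e x \<noteq> 0")
      case True
      then obtain e where e: "e \<in> F" "e x \<noteq> 0" by blast
      show ?thesis using elim e by (simp add: blk_at[OF F e] scaleC_add_right)
    qed (simp add: blk_off)
  qed
  assume eq: "AE x in M. \<xi> x = \<eta> x"
  have "AE x in M. \<forall>e\<in>F. a (cmul e \<xi>) x = a (cmul e \<eta>) x"
  proof (rule AE_F)
    fix e assume e: "e \<in> F"
    have "AE x in M. cmul e \<xi> x = cmul e \<eta> x" using eq by eventually_elim (simp add: cmul_def)
    then show "AE x in M. a (cmul e \<xi>) x = a (cmul e \<eta>) x" by (rule bop_cong[OF a eL[OF e \<xi>]])
  qed
  then show "AE x in M. blk F a \<xi> x = blk F a \<eta> x"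
  proof eventually_elim
    case (elim x)
    show ?case
    proof (cases "\<exists>e\<in>F. e x \<noteq> 0")
      case True
      then obtain e where e: "e \<in> F" "e x \<noteq> 0" by blast
      show ?thesis using elim e by (simp add: blk_at[OF F e])
    qed (simp add: blk_off)
  qed
qed

text \<open>Once \<open>G\<close> contains all members that meet a ball, the partial sum equals the
  limit on that ball; elsewhere it is either the limit or 0. The error is thus dominated by the tail
  of the limit.\<close>

lemma blk_is_block_cutdown:
  fixes a :: "('x, 'e::complex_banach) fun_op"
  assumes F: "sepfam (apply_bcontfun ` F)" and a: "bounded_op M p a"
  shows "is_block_cutdown M p F a (blk (apply_bcontfun ` F) a)"
  unfolding is_block_cutdown_def
proof (intro conjI ballI bop_blk F a)
  define c where "c = blk (apply_bcontfun ` F) a"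
  fix \<xi> :: "'x \<Rightarrow> 'e" assume \<xi>: "\<xi> \<in> L"
  have c\<xi>: "c \<xi> \<in> L" unfolding c_def by (rule blk_bound(1)[OF F a \<xi>])
  let ?u = "\<lambda>G x. (\<Sum>e\<in>G. (mult_op e \<circ> a \<circ> mult_op e) \<xi> x) - c \<xi> x"
  have "((\<lambda>G. N (?u G)) \<longlongrightarrow> 0) (finite_subsets_at_top F)"
  proof (rule tendstoI)
    fix d :: real assume d: "0 < d"
    then have d2: "0 < d / 2" by simp
    obtain n0 :: nat where n0: "\<And>n V. n0 \<le> n \<Longrightarrow> V \<in> sets borel \<Longrightarrow> V \<inter> cball x0 (real n) = {} \<Longrightarrow> N (res V (c \<xi>)) \<le> d / 2"
      by (rule N_tail[OF c\<xi> d2]) blast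
    define X where "X = {e \<in> F. \<exists>x\<in>cball x0 (real n0). apply_bcontfun e x \<noteq> 0}"
    have "inj_on apply_bcontfun X" by (simp add: inj_on_def apply_bcontfun_inject)
    moreover have "finite (apply_bcontfun ` X)"
      by (rule finite_subset[OF _ sepfam_finite[OF F, of "real n0"]]) (auto simp: X_def)
    ultimately have X: "finite X" "X \<subseteq> F" by (auto simp: X_def dest: finite_imageD)
    have "dist (N (?u G)) 0 < d" if G: "finite G" "X \<subseteq> G" "G \<subseteq> F" for G
    proof -
      define V where "V = - cball x0 (real n0)"
      have V: "V \<in> sets borel" by (simp add: V_def)
      have uL: "?u G \<in> L"
        by (intro Lp_diff Lp_sum c\<xi> bop_Lp[OF bop_comp[OF bop_comp[OF bop_mult_op a] bop_mult_op]] \<xi>)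
      have "norm (?u G x) \<le> 1 * norm (res V (c \<xi>) x)" for x
      proof (cases "\<exists>e\<in>F. e x \<noteq> 0")
        case True
        then obtain e where e: "e \<in> F" "apply_bcontfun e x \<noteq> 0" by blast
        have c_eq: "c \<xi> x = (mult_op e \<circ> a \<circ> mult_op e) \<xi> x"
          unfolding c_def using blk_at[OF F imageI[OF e(1)] e(2)] by (simp add: mult_op_cmul cmul_def)
        have uniq: "e' = e" if "e' \<in> F" "apply_bcontfun e' x \<noteq> 0" for e'
          using sepfam_unique[OF F imageI[OF that(1)] imageI[OF e(1)] that(2) e(2)] by (simp add: apply_bcontfun_inject)
        have "(\<Sum>e'\<in>G. (mult_op e' \<circ> a \<circ> mult_op e') \<xi> x) = (\<Sum>e'\<in>G. if e' = e then c \<xi> x else 0)"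
        proof (rule sum.cong[OF refl])
          fix e' assume "e' \<in> G"
          then show "(mult_op e' \<circ> a \<circ> mult_op e') \<xi> x = (if e' = e then c \<xi> x else 0)"
            using uniq[of e'] G(3) e(2) by (cases "apply_bcontfun e' x = 0") (auto simp: c_eq mult_op_def)
        qed
        then have sum: "(\<Sum>e'\<in>G. (mult_op e' \<circ> a \<circ> mult_op e') \<xi> x) = (if e \<in> G then c \<xi> x else 0)"
          using G(1) by simp
        show ?thesis
        proof (cases "x \<in> cball x0 (real n0)")
          case True
          then have "e \<in> G" using e G(2) unfolding X_def by blast
          then show ?thesis unfolding sum by simp
        next
          case False
          then show ?thesis unfolding sum by (simp add: res_def V_def)
        qed
      next
        case False
        then have "c \<xi> x = 0" unfolding c_def by (intro blk_off) auto
        moreover have "(\<Sum>e'\<in>G. (mult_op e' \<circ> a \<circ> mult_op e') \<xi> x) = 0"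
          using False G(3) by (intro sum.neutral) (auto simp: mult_op_def)
        ultimately show ?thesis by simp
      qed
      then have "N (?u G) \<le> 1 * N (res V (c \<xi>))"
        using uL by (intro Lp_norm_mono(2)[OF p _ Lp_res(1)[OF c\<xi> V]]) (auto simp: Lp_iff)
      then show ?thesis using n0[of n0 V] V d by (simp add: V_def dist_real_def)
    qed
    then show "\<forall>\<^sub>F G in finite_subsets_at_top F. dist (N (?u G)) 0 < d"
      unfolding eventually_finite_subsets_at_top using X by blast
  qed
  then show "((\<lambda>G. N (\<lambda>x. (\<Sum>e\<in>G. (mult_op e \<circ> a \<circ> mult_op e) \<xi> x) - blk (apply_bcontfun ` F) a \<xi> x)) \<longlongrightarrow> 0)
     (finite_subsets_at_top F)" unfolding c_def .
qed

text \<open>The off-diagonal part is controlled by an average over all subsets \<open>S\<close> of a finite index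
  set: a pair \<open>i \<noteq> j\<close> is separated by exactly a quarter of them, and for each \<open>S\<close> the part of the
  operator between the union over \<open>S\<close> and the union over its complement is small by quasi-locality.\<close>

lemma offdiagonal_bound:
  fixes b :: "('x, 'e::complex_banach) fun_op" and V :: "'i \<Rightarrow> 'x set"
  assumes b: "bounded_op M p b" and q: "ql_bound b \<epsilon> s" and e: "0 \<le> \<epsilon>" and s: "0 < s"
    and g: "g \<in> borel_measurable borel" "\<And>x. cmod (g x) \<le> 1"
    and V: "\<And>i. i \<in> I \<Longrightarrow> V i \<in> sets borel"
    and sep: "\<And>i j x y. \<lbrakk>i \<in> I; j \<in> I; i \<noteq> j; x \<in> V i; y \<in> V j\<rbrakk> \<Longrightarrow> s \<le> dist x y"
    and cov: "\<And>x. g x \<noteq> 0 \<Longrightarrow> \<exists>i\<in>I. x \<in> V i"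
    and G: "G = (\<lambda>i x. if x \<in> V i then g x else 0) ` I"
    and \<xi>: "\<xi> \<in> L"
  shows "sepfam G" and "N (op_diff (cmul g \<circ> b \<circ> cmul g) (blk G b) \<xi>) \<le> 4 * \<epsilon> * N \<xi>"
proof -
  show G_sep: "sepfam G"
    unfolding sepfam_def
  proof (intro conjI ballI allI exI[of _ s] impI s)
    fix h x assume "h \<in> G"
    then obtain i where i: "i \<in> I" "h = (\<lambda>x. if x \<in> V i then g x else 0)" by (auto simp: G)
    note [measurable] = g(1) V[OF i(1)]
    show "h \<in> borel_measurable borel" unfolding i(2) by measurable
    show "cmod (h x) \<le> 1" using g(2) by (simp add: i(2))
  next
    fix h h' x y assume "h \<in> G" "h' \<in> G" "h \<noteq> h'" "h x \<noteq> 0" "h' y \<noteq> 0"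
    moreover obtain i j where "i \<in> I" "h = (\<lambda>x. if x \<in> V i then g x else 0)"
      "j \<in> I" "h' = (\<lambda>x. if x \<in> V j then g x else 0)"
      using \<open>h \<in> G\<close> \<open>h' \<in> G\<close> by (auto simp: G)
    ultimately show "s \<le> dist x y" using sep[of i j x y] by (auto split: if_splits)
  qed
  define T where "T = cmul g \<circ> b \<circ> cmul g"
  define D where "D = op_diff T (blk G b)"
  have D: "bounded_op M p D"
    unfolding D_def T_def by (intro bop_op_diff bop_comp bop_cmul[OF g] b bop_blk G_sep)
  have "N (D \<xi>) \<le> (4 * \<epsilon>) * N \<xi>"
  proof (rule op_bound_limit[OF D _ \<xi>])
    show "0 \<le> 4 * \<epsilon>" using e by simp
    fix n :: nat
    \<comment> \<open>On a ball only the finitely many indices in \<open>J\<close> matter, so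
      \<open>Pow J\<close> is finite; the resulting bound does not depend on
      \<open>n\<close>.\<close>
    define C where "C = cball x0 (real n)"
    define u where "u = res C \<xi>"
    have C: "C \<in> sets borel" by (simp add: C_def)
    have u: "u \<in> L" "N u \<le> N \<xi>" unfolding u_def using Lp_res[OF \<xi> C] by auto
    note gu = Lp_cmul[OF u(1) g]
    define J where "J = {i \<in> I. V i \<inter> C \<noteq> {}}"
    have J: "finite J" "J \<subseteq> I" unfolding J_def C_def using finite_separated[OF s sep, of I V] by auto
    have Vdisj: "i = j" if "i \<in> I" "j \<in> I" "x \<in> V i" "x \<in> V j" for i j x
      using sep[of i j x x] s that by auto
    define U where "U S = (\<Union>i\<in>S. V i)" for S
    have U: "U S \<in> sets borel" if "S \<subseteq> J" for S
      unfolding U_def using that J V by (intro sets.finite_UN) (auto intro: finite_subset)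
    define y where "y i = b (cmul g (res (V i) u))" for i
    have VL: "cmul g (res (V i) u) \<in> L" if "i \<in> J" for i
      using that J V by (intro Lp_cmul(1)[OF _ g] Lp_res u) auto
    have ae: "AE x in M. \<forall>S\<in>Pow J. b (cmul g (res (U S) u)) x = (\<Sum>j\<in>S. y j x)"
    proof (intro AE_finite_allI)
      fix S assume "S \<in> Pow J"
      then have S: "S \<subseteq> J" by simp
      have "cmul g (res (U S) u) = (\<lambda>x. \<Sum>j\<in>S. cmul g (res (V j) u) x)"
      proof
        fix x
        show "cmul g (res (U S) u) x = (\<Sum>j\<in>S. cmul g (res (V j) u) x)"
        proof (cases "x \<in> U S")
          case True
          then obtain i where i: "i \<in> S" "x \<in> V i" by (auto simp: U_def)
          have "(\<Sum>j\<in>S. cmul g (res (V j) u) x) = (\<Sum>j\<in>{i}. cmul g (res (V j) u) x)"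
          proof (rule sum.mono_neutral_right)
            show "\<forall>j\<in>S - {i}. cmul g (res (V j) u) x = 0"
            proof
              fix j assume "j \<in> S - {i}"
              then have "x \<notin> V j" using Vdisj[of j i x] i S J(2) by auto
              then show "cmul g (res (V j) u) x = 0" by (simp add: cmul_def res_def)
            qed
          qed (use i finite_subset[OF S J(1)] in auto)
          then show ?thesis using True i by (simp add: cmul_def res_def)
        next
          case False
          then show ?thesis by (auto simp: cmul_def res_def U_def intro!: sum.neutral[symmetric])
        qed
      qed
      then show "AE x in M. b (cmul g (res (U S) u)) x = (\<Sum>j\<in>S. y j x)"
        unfolding y_def using S VL by (simp add: bop_sum[OF b] subset_iff)
    qed (use J in simp)
    have UJ: "cmul g (res (U J) u) = cmul g u"
    proof
      fix x show "cmul g (res (U J) u) x = cmul g u x"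
      proof (cases "g x = 0 \<or> x \<notin> C")
        case False
        then have "x \<in> U J" using cov[of x] by (auto simp: U_def J_def)
        then show ?thesis by (simp add: cmul_def res_def)
      qed (auto simp: cmul_def res_def u_def)
    qed
    \<comment> \<open>\<open>w S\<close> is the part leading from the complement of \<open>S\<close>
      to \<open>S\<close>. The weight \<open>k\<close> is the reciprocal of the number of subsets
      separating a given pair; as there are \<open>2 ^ card J\<close> terms, each at most
      \<open>\<epsilon> * N \<xi>\<close>, the total is 4 times that.\<close>
    define w where "w S = res (U S) (cmul g (b (cmul g (res (U (J - S)) u))))" for S
    define k where "k = 4 / (2::real) ^ card J"
    have k: "0 \<le> k" "k * card {S \<in> Pow J. i \<in> S \<and> j \<notin> S} = (if i = j then 0 else 1)"
      if "i \<in> J" "j \<in> J" for i j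
    proof -
      show "0 \<le> k" by (simp add: k_def)
      show "k * card {S \<in> Pow J. i \<in> S \<and> j \<notin> S} = (if i = j then 0 else 1)"
      proof (cases "i = j")
        case False
        have "real (4 * card {S \<in> Pow J. i \<in> S \<and> j \<notin> S}) = 2 ^ card J"
          using card_separating_subsets[OF J(1) that False] by (metis of_nat_numeral of_nat_power)
        then show ?thesis using False by (simp add: k_def field_simps)
      qed (simp add: k_def)
    qed
    from ae have "AE x in M. res C (D u) x = res C (\<lambda>x. complex_of_real k *\<^sub>C (\<Sum>S\<in>Pow J. w S x)) x"
    proof eventually_elim
      case (elim x)
      have bS: "b (cmul g (res (U S) u)) x = (\<Sum>j\<in>S. y j x)" if "S \<subseteq> J" for S using elim that by blast
      show ?case
      proof (cases "x \<in> C \<and> g x \<noteq> 0")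
        case True
        then obtain i where i: "i \<in> I" "x \<in> V i" using cov by blast
        then have iJ: "i \<in> J" using True by (auto simp: J_def)
        have "blk G b u x = g x *\<^sub>C y i x"
        proof -
          let ?h = "\<lambda>x. if x \<in> V i then g x else 0"
          have "blk G b u x = ?h x *\<^sub>C b (cmul ?h u) x"
            using i True by (intro blk_at[OF G_sep]) (auto simp: G)
          moreover have "cmul ?h u = cmul g (res (V i) u)" by (auto simp: cmul_def res_def fun_eq_iff)
          ultimately show ?thesis using i by (simp add: y_def)
        qed
        then have "D u x = g x *\<^sub>C (\<Sum>j\<in>J. y j x) - g x *\<^sub>C y i x"
          using bS[of J] by (simp add: D_def T_def op_diff_def cmul_def[of g "b _"] UJ)
        also have "\<dots> = (\<Sum>j\<in>J. if i = j then 0 else g x *\<^sub>C y j x)"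
        proof -
          have "(\<Sum>j\<in>J - {i}. if i = j then 0 else g x *\<^sub>C y j x) = (\<Sum>j\<in>J - {i}. g x *\<^sub>C y j x)"
            by (intro sum.cong) auto
          then show ?thesis using J(1) iJ by (simp add: scaleC_sum_right scaleC_add_right sum.remove[of J i])
        qed
        also have "\<dots> = (\<Sum>j\<in>J. (k * card {S \<in> Pow J. i \<in> S \<and> j \<notin> S}) *\<^sub>R (g x *\<^sub>C y j x))"
          using k(2)[OF iJ] by (intro sum.cong) auto
        also have "\<dots> = (\<Sum>j\<in>J. k *\<^sub>R (\<Sum>S\<in>Pow J. if i \<in> S \<and> j \<notin> S then g x *\<^sub>C y j x else 0))"
          using J(1) by (intro sum.cong refl) (simp add: sum.If_cases Int_def sum_constant_scaleR)
        also have "\<dots> = k *\<^sub>R (\<Sum>S\<in>Pow J. \<Sum>j\<in>J. if i \<in> S \<and> j \<notin> S then g x *\<^sub>C y j x else 0)"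
          unfolding scaleR_sum_right[symmetric] by (subst sum.swap) simp
        also have "(\<Sum>S\<in>Pow J. \<Sum>j\<in>J. if i \<in> S \<and> j \<notin> S then g x *\<^sub>C y j x else 0) = (\<Sum>S\<in>Pow J. w S x)"
        proof (intro sum.cong refl)
          fix S assume "S \<in> Pow J"
          then have S: "S \<subseteq> J" by simp
          have "j = i" if "j \<in> S" "x \<in> V j" for j
            by (rule Vdisj[OF _ i(1) that(2) i(2)]) (use that(1) S J(2) in blast)
          then have "x \<in> U S \<longleftrightarrow> i \<in> S" using i(2) unfolding U_def by blast
          then have "w S x = (if i \<in> S then g x *\<^sub>C (\<Sum>j\<in>J - S. y j x) else 0)"
            using bS[of "J - S"] by (simp add: w_def res_def[of "U S"] cmul_def[of g "b _"])
          also have "\<dots> = (\<Sum>j\<in>J. if i \<in> S \<and> j \<notin> S then g x *\<^sub>C y j x else 0)"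
            using J(1) by (simp add: scaleC_sum_right sum.If_cases Diff_eq Compl_eq)
          finally show "(\<Sum>j\<in>J. if i \<in> S \<and> j \<notin> S then g x *\<^sub>C y j x else 0) = w S x" by simp
        qed
        finally show ?thesis using True by (simp add: res_def scaleR_scaleC)
      next
        case False
        then consider "x \<notin> C" | "x \<in> C" "g x = 0" by blast
        then show ?thesis
        proof cases
          case 2
          then have "blk G b u x = 0" by (intro blk_off) (auto simp: G)
          then have "D u x = 0" using 2 by (simp add: D_def T_def op_diff_def cmul_def)
          moreover have "w S x = 0" for S using 2 by (simp add: w_def res_def cmul_def)
          ultimately show ?thesis by (simp add: res_def)
        qed (simp add: res_def)
      qed
    qed
    then have "N (res C (D u)) = N (res C (\<lambda>x. complex_of_real k *\<^sub>C (\<Sum>S\<in>Pow J. w S x)))" by (rule N_cong)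
    also have wL: "w S \<in> L \<and> N (w S) \<le> \<epsilon> * N \<xi>" if "S \<in> Pow J" for S
    proof
      have S: "U S \<in> sets borel" "U (J - S) \<in> sets borel" using U that by auto
      have eq: "w S = cmul g (res (U S) (b (res (U (J - S)) (cmul g u))))"
      proof -
        have "cmul g (res A \<eta>) = res A (cmul g \<eta>)" for A and \<eta> :: "'x \<Rightarrow> 'e"
          by (auto simp: cmul_def res_def fun_eq_iff)
        then show ?thesis by (simp add: w_def)
      qed
      have L: "res (U S) (b (res (U (J - S)) (cmul g u))) \<in> L"
        by (intro Lp_res(1) bop_Lp[OF b] gu S)
      show "w S \<in> L" unfolding eq by (rule Lp_cmul(1)[OF L g])
      have "N (w S) \<le> 1 * N (res (U S) (b (res (U (J - S)) (cmul g u))))"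
        unfolding eq by (rule Lp_cmul(2)[OF L g])
      also have "\<dots> \<le> \<epsilon> * N (cmul g u)"
        using ql_boundD[OF q S _ gu(1)] sep that J(2) unfolding U_def by fastforce
      also have "\<dots> \<le> \<epsilon> * N \<xi>" using gu(2) u(2) e by (intro mult_left_mono) auto
      finally show "N (w S) \<le> \<epsilon> * N \<xi>" .
    qed
    have sL: "(\<lambda>x. \<Sum>S\<in>Pow J. w S x) \<in> L" using wL by (intro Lp_sum) auto
    have "N (res C (\<lambda>x. complex_of_real k *\<^sub>C (\<Sum>S\<in>Pow J. w S x))) \<le> N (\<lambda>x. complex_of_real k *\<^sub>C (\<Sum>S\<in>Pow J. w S x))"
      by (intro Lp_res(2)[OF Lp_scale[OF sL] C])
    also have "\<dots> \<le> k * N (\<lambda>x. \<Sum>S\<in>Pow J. w S x)"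
      using N_scale_le[OF sL, of "complex_of_real k"] by (simp add: k_def norm_divide norm_power)
    also have "\<dots> \<le> k * (\<Sum>S\<in>Pow J. N (w S))"
      using wL by (intro mult_left_mono Lp_sum) (auto simp: k_def)
    also have "\<dots> \<le> k * (\<Sum>S\<in>Pow J. \<epsilon> * N \<xi>)"
      using wL by (intro mult_left_mono sum_mono) (auto simp: k_def)
    also have "\<dots> = 4 * \<epsilon> * N \<xi>" using J(1) by (simp add: k_def card_Pow)
    finally show "N (res (cball x0 (real n)) (D (res (cball x0 (real n)) \<xi>))) \<le> 4 * \<epsilon> * N \<xi>"
      by (simp add: C_def u_def)
  qed
  then show "N (op_diff (cmul g \<circ> b \<circ> cmul g) (blk G b) \<xi>) \<le> 4 * \<epsilon> * N \<xi>" by (simp add: D_def T_def)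
qed


lemma blk_propagation:
  fixes b :: "('x, 'e::complex_banach) fun_op"
  assumes F: "sepfam F" and b: "bounded_op M p b"
    and diam: "\<And>e x y. e \<in> F \<Longrightarrow> e x \<noteq> 0 \<Longrightarrow> e y \<noteq> 0 \<Longrightarrow> dist x y \<le> R"
  shows "propagation_le M p (blk F b) R"
  unfolding propagation_le_def
proof (intro allI impI ballI)
  fix f f' :: "'x \<Rightarrow>\<^sub>C complex" and \<xi> :: "'x \<Rightarrow> 'e"
  assume far: "far_apart R (supp f) (supp f')"
  show "AE x in M. (mult_op f \<circ> blk F b \<circ> mult_op f') \<xi> x = 0"
    using bop_zero[OF b]
  proof eventually_elim
    case (elim x)
    have "blk F b (mult_op f' \<xi>) x = 0" if fx: "f x \<noteq> 0"
    proof (cases "\<exists>e\<in>F. e x \<noteq> 0")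
      case True
      then obtain e where e: "e \<in> F" "e x \<noteq> 0" by blast
      have "cmul e (mult_op f' \<xi>) = (\<lambda>y. 0)"
      proof
        fix y
        have "e y = 0 \<or> f' y = 0"
        proof (rule ccontr)
          assume "\<not> (e y = 0 \<or> f' y = 0)"
          then have y: "e y \<noteq> 0" "y \<in> supp f'" using not_in_supp[of y f'] by auto
          have x: "x \<in> supp f" using fx not_in_supp[of x f] by auto
          show False
            using far diam[OF e y(1)] setdist_le_dist[OF x y(2)] x y(2) unfolding far_apart_def by auto
        qed
        then show "cmul e (mult_op f' \<xi>) y = 0" by (auto simp: cmul_def mult_op_def)
      qed
      then show ?thesis using elim by (simp add: blk_at[OF F e])
    qed (simp add: blk_off)
    then show ?case by (cases "f x = 0") (simp_all add: mult_op_def)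
  qed
qed

section \<open>Cutdown families and partitions adapted to a decomposition\<close>

text \<open>The invariant of the descent. Uniform separation yields both local finiteness, as in
  \<open>sepfam\<close>, and disjoint closed supports, as in \<open>cutdown_family\<close>;
  equicontinuity and positivity bring the cutdown into \<open>B\<close>.\<close>

definition cutdown_sepfam :: "('x \<Rightarrow>\<^sub>C complex) set \<Rightarrow> bool" where
  "cutdown_sepfam F \<longleftrightarrow> (\<forall>e\<in>F. (\<forall>x. apply_bcontfun e x \<in> \<real>\<^sub>\<ge>\<^sub>0) \<and> norm e \<le> 1) \<and>
     (\<forall>x. \<forall>\<epsilon>>0. \<exists>\<delta>>0. \<forall>e\<in>F. \<forall>y. dist x y < \<delta> \<longrightarrow> cmod (apply_bcontfun e x - apply_bcontfun e y) < \<epsilon>) \<and>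
     (\<exists>\<delta>>0. \<forall>e\<in>F. \<forall>e'\<in>F. e \<noteq> e' \<longrightarrow>
        (\<forall>x y. apply_bcontfun e x \<noteq> 0 \<longrightarrow> apply_bcontfun e' y \<noteq> 0 \<longrightarrow> \<delta> \<le> dist x y))"

lemma cutdown_sepfam_equicontinuous:
  "cutdown_sepfam F \<Longrightarrow> 0 < \<epsilon> \<Longrightarrow> \<exists>\<delta>>0. \<forall>e\<in>F. \<forall>y. dist x y < \<delta> \<longrightarrow> cmod (apply_bcontfun e x - apply_bcontfun e y) < \<epsilon>"
  by (simp add: cutdown_sepfam_def)

lemma cutdown_sepfam_sepfam:
  assumes F: "cutdown_sepfam F" shows "sepfam (apply_bcontfun ` F)"
proof -
  have "cmod (apply_bcontfun e x) \<le> 1" if "e \<in> F" for e x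
    using norm_bounded[of e x] F that unfolding cutdown_sepfam_def by (meson order_trans)
  moreover obtain \<delta> where \<delta>: "0 < \<delta>" "\<And>e e' x y. \<lbrakk>e \<in> F; e' \<in> F; e \<noteq> e'; apply_bcontfun e x \<noteq> 0; apply_bcontfun e' y \<noteq> 0\<rbrakk> \<Longrightarrow> \<delta> \<le> dist x y"
    using F unfolding cutdown_sepfam_def by auto
  moreover have "\<delta> \<le> dist x y"
    if "f \<in> apply_bcontfun ` F" "f' \<in> apply_bcontfun ` F" "f \<noteq> f'" "f x \<noteq> 0" "f' y \<noteq> 0" for f f' x y
    using that \<delta>(2)[of _ _ x y] by (elim imageE) blast
  ultimately show ?thesis unfolding sepfam_def using bcontfun_borel by blast
qed

lemma cutdown_sepfam_cutdown_family:
  assumes F: "cutdown_sepfam F" shows "cutdown_family F"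
proof -
  obtain \<delta> where \<delta>: "0 < \<delta>" "\<And>e e' x y. \<lbrakk>e \<in> F; e' \<in> F; e \<noteq> e'; apply_bcontfun e x \<noteq> 0; apply_bcontfun e' y \<noteq> 0\<rbrakk> \<Longrightarrow> \<delta> \<le> dist x y"
    using F unfolding cutdown_sepfam_def by auto
  have "supp e \<inter> supp e' = {}" if e: "e \<in> F" "e' \<in> F" "e \<noteq> e'" for e e'
  proof (rule ccontr)
    assume "supp e \<inter> supp e' \<noteq> {}"
    then obtain x where x: "x \<in> supp e" "x \<in> supp e'" by blast
    have d2: "0 < \<delta> / 2" using \<delta> by simp
    obtain y where y: "apply_bcontfun e y \<noteq> 0" "dist y x < \<delta> / 2" using supp_subset[OF x(1) d2] by blast
    obtain z where z: "apply_bcontfun e' z \<noteq> 0" "dist z x < \<delta> / 2" using supp_subset[OF x(2) d2] by blast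
    show False using \<delta>(2)[OF e y(1) z(1)] y(2) z(2) dist_triangle2[of y z x] by linarith
  qed
  then have "pairwise (\<lambda>e e'. supp e \<inter> supp e' = {}) F" by (simp add: pairwise_def)
  then show ?thesis using F unfolding cutdown_family_def cutdown_sepfam_def by (elim conjE) (intro conjI)
qed

lemma cutdown_sepfam_blk_in:
  fixes B :: "('x, 'e::complex_banach) fun_op set"
  assumes "cutdown_sepfam F" "closed_under_block_cutdowns M p B" "a \<in> B" "bounded_op M p a"
  shows "blk (apply_bcontfun ` F) a \<in> B"
  using assms(2,3) cutdown_sepfam_cutdown_family[OF assms(1)] blk_is_block_cutdown[OF cutdown_sepfam_sepfam[OF assms(1)] assms(4)]
  unfolding closed_under_block_cutdowns_def by blast

text \<open>The modulus of continuity of the square root of a \<open>1 / s\<close>-Lipschitz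
  function. Square roots enter because a cutdown multiplies on both sides, so the squares of the
  weights have to sum to 1.\<close>

definition sqrt_modulus :: "real \<Rightarrow> ('x \<Rightarrow> real) \<Rightarrow> bool" where
  "sqrt_modulus s w \<longleftrightarrow> (\<forall>x. 0 \<le> w x \<and> w x \<le> 1) \<and> (\<forall>x y. (w x - w y)\<^sup>2 \<le> dist x y / s)"

lemma sqrt_modulus_sqrt:
  assumes "0 < s" "\<And>x. 0 \<le> h x" "\<And>x. h x \<le> 1" "\<And>x y. \<bar>h x - h y\<bar> \<le> dist x y / s"
  shows "sqrt_modulus s (\<lambda>x. sqrt (h x))"
  unfolding sqrt_modulus_def
proof (intro conjI allI)
  fix x y
  show "0 \<le> sqrt (h x)" "sqrt (h x) \<le> 1" using assms by auto
  have sq: "(sqrt a - sqrt b)\<^sup>2 \<le> a - b" if "0 \<le> b" "b \<le> a" for a b :: real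
  proof -
    have "b = sqrt b * sqrt b" "a = sqrt a * sqrt a" using that by auto
    moreover have "sqrt b * sqrt b \<le> sqrt a * sqrt b" using that by (intro mult_right_mono) auto
    ultimately show ?thesis by (simp add: power2_eq_square algebra_simps)
  qed
  have "(sqrt (h x) - sqrt (h y))\<^sup>2 \<le> \<bar>h x - h y\<bar>"
    using sq[of "h x" "h y"] sq[of "h y" "h x"] assms(2) by (cases "h x \<le> h y") (auto simp: power2_commute)
  then show "(sqrt (h x) - sqrt (h y))\<^sup>2 \<le> dist x y / s" using assms(4)[of x y] by linarith
qed

lemma sqrt_modulus_lt:
  assumes "sqrt_modulus s w" "0 < s" "0 < d" "dist x y < s * d\<^sup>2"
  shows "\<bar>w x - w y\<bar> < d"
proof -
  have "(w x - w y)\<^sup>2 \<le> dist x y / s" using assms(1) by (simp add: sqrt_modulus_def)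
  also have "\<dots> < d\<^sup>2" using assms(2,4) by (simp add: pos_divide_less_eq mult.commute)
  finally have "\<bar>w x - w y\<bar>\<^sup>2 < d\<^sup>2" by simp
  from power2_less_imp_less[OF this] show ?thesis using assms(3) by simp
qed

text \<open>The constant 6 leaves distance \<open>2 * s\<close> after widening both sets by
  \<open>2 * s\<close>. The weights are the square roots of \<open>h\<close> and
  \<open>1 - h\<close> for a bump \<open>h\<close> around the first half. Since \<open>h\<close> is
  1 within \<open>s\<close> of that half and \<open>t \<le> s\<close>, a point near \<open>Z\<close>
  with \<open>h x \<noteq> 1\<close> must be close to the second half.\<close>

lemma decomposition_partition:
  fixes Z :: "'x set"
  assumes s: "0 < s" and t: "t \<le> s" and dec: "decomposes_over (6 * s) Z \<Y>"
  obtains \<A> :: "bool \<Rightarrow> 'x set set" and w where "\<And>i. \<A> i \<subseteq> \<Y>"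
    "\<And>i A A' x y. \<lbrakk>A \<in> \<A> i; A' \<in> \<A> i; A \<noteq> A'; x \<in> nbh (2 * s) A; y \<in> nbh (2 * s) A'\<rbrakk> \<Longrightarrow> 2 * s \<le> dist x y"
    "\<And>i. sqrt_modulus s (w i)" "\<And>x. (w True x)\<^sup>2 + (w False x)\<^sup>2 = 1"
    "\<And>i x. x \<in> nbh t Z \<Longrightarrow> w i x \<noteq> 0 \<Longrightarrow> \<exists>A\<in>\<A> i. x \<in> nbh (2 * s) A"
proof -
  obtain \<A>0 \<A>1 where A: "\<A>0 \<subseteq> \<Y>" "\<A>1 \<subseteq> \<Y>" "pairwise (far_apart (6 * s)) \<A>0"
    "pairwise (far_apart (6 * s)) \<A>1" "Z = \<Union>\<A>0 \<union> \<Union>\<A>1"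
    using dec unfolding decomposes_over_def by blast
  define \<A> where "\<A> i = (if i then \<A>0 else \<A>1)" for i
  obtain h :: "'x \<Rightarrow> real" where h: "\<And>x. 0 \<le> h x" "\<And>x. h x \<le> 1"
    "\<And>x y. \<bar>h x - h y\<bar> \<le> dist x y / s" "\<And>x. x \<in> nbh s (\<Union>\<A>0) \<Longrightarrow> h x = 1"
    "\<And>x. h x \<noteq> 0 \<Longrightarrow> x \<in> nbh (2 * s) (\<Union>\<A>0)"
    by (rule bump_exists[OF s, of "\<Union>\<A>0"]) blast
  define w where "w i x = (if i then sqrt (h x) else sqrt (1 - h x))" for i x
  show ?thesis
  proof (rule that[of \<A> w])
    fix i
    show "\<A> i \<subseteq> \<Y>" using A by (simp add: \<A>_def)
    have "sqrt_modulus s (\<lambda>x. sqrt (h x))" by (rule sqrt_modulus_sqrt[OF s]) (use h in auto)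
    moreover have "sqrt_modulus s (\<lambda>x. sqrt (1 - h x))" by (rule sqrt_modulus_sqrt[OF s]) (use h in \<open>auto simp: abs_minus_commute\<close>)
    ultimately show "sqrt_modulus s (w i)" unfolding w_def by (cases i) auto
    show "(w True x)\<^sup>2 + (w False x)\<^sup>2 = 1" for x using h(1,2)[of x] by (simp add: w_def)
    show "2 * s \<le> dist x y"
      if AA: "A \<in> \<A> i" "A' \<in> \<A> i" "A \<noteq> A'" "x \<in> nbh (2 * s) A" "y \<in> nbh (2 * s) A'" for A A' x y
    proof -
      have "far_apart (6 * s) A A'" using A(3,4) AA unfolding pairwise_def \<A>_def by (auto split: if_splits)
      moreover obtain a a' where a: "a \<in> A" "dist a x < 2 * s" "a' \<in> A'" "dist a' y < 2 * s"
        using AA(4,5) by (auto simp: nbh_iff)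
      ultimately have "6 * s < dist a a'"
        unfolding far_apart_def using setdist_le_dist[OF a(1,3)] by auto
      then show ?thesis
        using a dist_triangle[of a a' x] dist_triangle[of x a' y] dist_commute[of y a'] by linarith
    qed
    show "\<exists>A\<in>\<A> i. x \<in> nbh (2 * s) A" if x: "x \<in> nbh t Z" "w i x \<noteq> 0" for x
    proof (cases i)
      case True
      then have "h x \<noteq> 0" using x(2) by (auto simp: w_def)
      then show ?thesis using h(5)[of x] True by (auto simp: nbh_iff \<A>_def)
    next
      case False
      then have "h x \<noteq> 1" using x(2) by (auto simp: w_def)
      then have "x \<notin> nbh s (\<Union>\<A>0)" using h(4) by blast
      moreover obtain z where z: "z \<in> Z" "dist z x < t" using x(1) by (auto simp: nbh_iff)
      moreover from z(2) t have "dist z x < s" by simp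
      ultimately obtain A where "A \<in> \<A>1" "z \<in> A" using A(5) unfolding nbh_iff by blast
      moreover have "dist z x < 2 * s" using z(2) t s by simp
      ultimately show ?thesis using False by (auto simp: nbh_iff \<A>_def)
    qed
  qed
qed

definition piece :: "real \<Rightarrow> ('x \<Rightarrow>\<^sub>C complex) \<Rightarrow> ('x \<Rightarrow> real) \<Rightarrow> 'x set \<Rightarrow> 'x \<Rightarrow> complex" where
  "piece s e w A x = (if x \<in> nbh (2 * s) A then e x * complex_of_real (w x) else 0)"

text \<open>Cutting the product to a neighbourhood of \<open>A\<close> creates no jump: if
  \<open>x\<close> lies inside, \<open>y\<close> outside and both are closer than
  \<open>2 * s\<close>, then the product vanishes at \<open>y\<close>, as otherwise \<open>y\<close>
  would lie near another \<open>A'\<close>, whose neighbourhood is at least \<open>2 * s\<close>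
  away from \<open>x\<close>.\<close>

lemma piece_close:
  assumes s: "0 < s" and e1: "\<And>x. cmod (apply_bcontfun e x) \<le> 1" and w: "sqrt_modulus s w"
    and sep: "\<And>A' x y. \<lbrakk>A' \<in> \<A>; A \<noteq> A'; x \<in> nbh (2 * s) A; y \<in> nbh (2 * s) A'\<rbrakk> \<Longrightarrow> 2 * s \<le> dist x y"
    and cov: "\<And>x. apply_bcontfun e x \<noteq> 0 \<Longrightarrow> w x \<noteq> 0 \<Longrightarrow> \<exists>A'\<in>\<A>. x \<in> nbh (2 * s) A'"
    and d: "0 < d" "dist x y < 2 * s" "dist x y < s * (d / 2)\<^sup>2" "cmod (apply_bcontfun e x - apply_bcontfun e y) < d / 2"
  shows "cmod (piece s e w A x - piece s e w A y) < d"
proof -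
  let ?g = "\<lambda>x. apply_bcontfun e x * complex_of_real (w x)"
  have g_diff: "cmod (?g x - ?g y) < d"
  proof -
    have w01: "\<bar>w x\<bar> \<le> 1" using w unfolding sqrt_modulus_def by auto
    have "?g x - ?g y = (e x - e y) * complex_of_real (w x) + e y * complex_of_real (w x - w y)"
      by (simp add: algebra_simps)
    then have "cmod (?g x - ?g y) \<le> cmod (e x - e y) * \<bar>w x\<bar> + cmod (e y) * \<bar>w x - w y\<bar>"
      by (metis norm_mult norm_of_real norm_triangle_ineq)
    also have "\<dots> \<le> cmod (e x - e y) * 1 + 1 * \<bar>w x - w y\<bar>"
      using w01 e1 by (intro add_mono mult_mono) auto
    also have "\<dots> < d / 2 + d / 2"
      using d sqrt_modulus_lt[OF w s, of "d / 2" x y] by simp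
    finally show ?thesis by simp
  qed
  have g0: "?g y' = 0" if "x' \<in> nbh (2 * s) A" "y' \<notin> nbh (2 * s) A" "dist x' y' < 2 * s" for x' y'
    using cov[of y'] sep[of _ x' y'] that by fastforce
  consider "x \<in> nbh (2 * s) A" "y \<in> nbh (2 * s) A" | "x \<in> nbh (2 * s) A" "y \<notin> nbh (2 * s) A"
    | "x \<notin> nbh (2 * s) A" "y \<in> nbh (2 * s) A" | "x \<notin> nbh (2 * s) A" "y \<notin> nbh (2 * s) A" by blast
  then show ?thesis
  proof cases
    case 2 then show ?thesis using g_diff g0[of x y] d by (simp add: piece_def)
  next
    case 3 then show ?thesis using g_diff g0[of y x] d by (simp add: piece_def dist_commute norm_minus_commute)
  qed (use g_diff d in \<open>simp_all add: piece_def\<close>)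
qed

text \<open>\<open>w True\<close>, \<open>w False\<close> is a partition of unity in the sense of squares, so on the support of
  \<open>e\<close> the defect \<open>e b e - (e w True) b (e w True) - (e w False) b (e w False)\<close> is a sum of
  commutators with the flat functions \<open>w i\<close>.\<close>

lemma block_step:
  fixes b :: "('x, 'e::complex_banach) fun_op"
  assumes b: "bounded_op M p b" and F: "cutdown_sepfam F" and s: "0 < s" and t: "t \<le> s" and c: "0 \<le> c"
    and Z: "\<And>e. e \<in> F \<Longrightarrow> \<exists>Z\<in>\<X>. \<forall>x. apply_bcontfun e x \<noteq> 0 \<longrightarrow> x \<in> nbh t Z"
    and dec: "family_decomposes_over (6 * s) \<X> \<Y>"
    and q: "ql_bound b c (2 * s)"
    and com: "\<And>w \<xi>. sqrt_modulus s w \<Longrightarrow> w \<in> borel_measurable borel \<Longrightarrow> \<xi> \<in> L \<Longrightarrow> N (comm b (\<lambda>x. complex_of_real (w x)) \<xi>) \<le> c * N \<xi>"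
  obtains F' :: "bool \<Rightarrow> ('x \<Rightarrow>\<^sub>C complex) set" where "\<And>i. cutdown_sepfam (F' i)"
    "\<And>i e. e \<in> F' i \<Longrightarrow> \<exists>Z\<in>\<Y>. \<forall>x. apply_bcontfun e x \<noteq> 0 \<longrightarrow> x \<in> nbh (2 * s) Z"
    "\<And>\<xi>. \<xi> \<in> L \<Longrightarrow> N (\<lambda>x. blk (apply_bcontfun ` F) b \<xi> x - (blk (apply_bcontfun ` F' True) b \<xi> x
        + blk (apply_bcontfun ` F' False) b \<xi> x)) \<le> 10 * c * N \<xi>"
proof -
  let ?P = "\<lambda>e \<A> w. (\<forall>i. \<A> i \<subseteq> \<Y>) \<and>
    (\<forall>i A A' x y. A \<in> \<A> i \<longrightarrow> A' \<in> \<A> i \<longrightarrow> A \<noteq> A' \<longrightarrow> x \<in> nbh (2 * s) A \<longrightarrow> y \<in> nbh (2 * s) A' \<longrightarrow> 2 * s \<le> dist x y) \<and>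
    (\<forall>i. sqrt_modulus s (w i)) \<and> (\<forall>x. (w True x)\<^sup>2 + (w False x)\<^sup>2 = 1) \<and>
    (\<forall>i x. apply_bcontfun e x \<noteq> 0 \<longrightarrow> w i x \<noteq> 0 \<longrightarrow> (\<exists>A\<in>\<A> i. x \<in> nbh (2 * s) A))"
  have "\<forall>e\<in>F. \<exists>Q. ?P e (fst Q) (snd Q)"
  proof
    fix e assume "e \<in> F"
    then obtain Z where Z': "Z \<in> \<X>" "\<And>x. apply_bcontfun e x \<noteq> 0 \<Longrightarrow> x \<in> nbh t Z" using Z by blast
    then have "decomposes_over (6 * s) Z \<Y>" using dec unfolding family_decomposes_over_def by blast
    then obtain \<A> :: "bool \<Rightarrow> 'x set set" and w where "\<And>i. \<A> i \<subseteq> \<Y>"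
      "\<And>i A A' x y. \<lbrakk>A \<in> \<A> i; A' \<in> \<A> i; A \<noteq> A'; x \<in> nbh (2 * s) A; y \<in> nbh (2 * s) A'\<rbrakk> \<Longrightarrow> 2 * s \<le> dist x y"
      "\<And>i. sqrt_modulus s (w i)" "\<And>x. (w True x)\<^sup>2 + (w False x)\<^sup>2 = 1"
      "\<And>i x. x \<in> nbh t Z \<Longrightarrow> w i x \<noteq> 0 \<Longrightarrow> \<exists>A\<in>\<A> i. x \<in> nbh (2 * s) A"
      by (rule decomposition_partition[OF s t]) (rule that; assumption)
    note D = this
    have "?P e \<A> w"
    proof (intro conjI allI impI)
      fix i
      show "\<A> i \<subseteq> \<Y>" by (rule D(1))
      show "2 * s \<le> dist x y" if "A \<in> \<A> i" "A' \<in> \<A> i" "A \<noteq> A'" "x \<in> nbh (2 * s) A" "y \<in> nbh (2 * s) A'" for A A' x y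
        by (rule D(2)[OF that])
      show "sqrt_modulus s (w i)" by (rule D(3))
      show "\<exists>A\<in>\<A> i. x \<in> nbh (2 * s) A" if "apply_bcontfun e x \<noteq> 0" "w i x \<noteq> 0" for x
        by (rule D(5)[OF Z'(2)[OF that(1)] that(2)])
    qed (rule D(4))
    then show "\<exists>Q. ?P e (fst Q) (snd Q)" by (intro exI[of _ "(\<A>, w)"]) simp
  qed
  from bchoice[OF this] obtain Q where "\<forall>e\<in>F. ?P e (fst (Q e)) (snd (Q e))" by (rule exE)
  note Q = bspec[OF this]
  define \<A> w where "\<A> e = fst (Q e)" and "w e = snd (Q e)" for e
  note QA = conjunct2[OF Q] note QB = conjunct2[OF QA] note QC = conjunct2[OF QB] note QD = conjunct2[OF QC]
  have Y: "A \<in> \<Y>" if "e \<in> F" "A \<in> \<A> e i" for e i A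
    using conjunct1[OF Q[OF that(1)]] that(2) unfolding \<A>_def by blast
  have sep: "2 * s \<le> dist x y"
    if "e \<in> F" "A \<in> \<A> e i" "A' \<in> \<A> e i" "A \<noteq> A'" "x \<in> nbh (2 * s) A" "y \<in> nbh (2 * s) A'" for e i A A' x y
    using conjunct1[OF QA[OF that(1)]] that(2-) unfolding \<A>_def by blast
  have w: "sqrt_modulus s (w e i)" if "e \<in> F" for e i
    using conjunct1[OF QB[OF that]] unfolding w_def by blast
  have w1: "(w e True x)\<^sup>2 + (w e False x)\<^sup>2 = 1" if "e \<in> F" for e x
    using conjunct1[OF QC[OF that]] unfolding w_def by blast
  have cov: "\<exists>A\<in>\<A> e i. x \<in> nbh (2 * s) A" if "e \<in> F" "apply_bcontfun e x \<noteq> 0" "w e i x \<noteq> 0" for e i x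
    using QD[OF that(1)] that(2-) unfolding \<A>_def w_def by blast
  have e1: "cmod (apply_bcontfun e x) \<le> 1" if "e \<in> F" for e x
    using sepfamD(2)[OF cutdown_sepfam_sepfam[OF F]] that by blast
  \<comment> \<open>The modulus depends on \<open>e\<close> only through the equicontinuity of
    \<open>F\<close>, and on the weights only through \<open>s\<close>; so one
    \<open>\<delta>\<close> serves all pieces, and the new families are again
    equicontinuous.\<close>
  have equi: "\<exists>\<delta>>0. \<forall>e\<in>F. \<forall>i. \<forall>A\<in>\<A> e i. \<forall>y. dist x y < \<delta> \<longrightarrow> cmod (piece s e (w e i) A x - piece s e (w e i) A y) < d"
    if d: "0 < d" for x d
  proof -
    have "0 < d / 2" using d by simp
    from cutdown_sepfam_equicontinuous[OF F this, of x] obtain \<delta>1 where \<delta>1: "0 < \<delta>1"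
      "\<And>e y. e \<in> F \<Longrightarrow> dist x y < \<delta>1 \<Longrightarrow> cmod (apply_bcontfun e x - apply_bcontfun e y) < d / 2" by auto
    define \<delta> where "\<delta> = min \<delta>1 (min (2 * s) (s * (d / 2)\<^sup>2))"
    have "0 < \<delta>" using \<delta>1 s d by (simp add: \<delta>_def)
    moreover have "cmod (piece s e (w e i) A x - piece s e (w e i) A y) < d"
      if "e \<in> F" "A \<in> \<A> e i" "dist x y < \<delta>" for e i A y
      by (rule piece_close[OF s e1[OF that(1)] w[OF that(1)], of "\<A> e i"])
         (use that sep[OF that(1) that(2)] cov[OF that(1)] d \<delta>1(2)[OF that(1)] in \<open>auto simp: \<delta>_def\<close>)
    ultimately show ?thesis by blast
  qed
  have pb: "cmod (piece s e (w e i) A x) \<le> 1" if "e \<in> F" for e i A x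
    using mult_mono[OF e1[OF that, of x], of "w e i x" 1] w[OF that, of i]
    by (auto simp: piece_def norm_mult sqrt_modulus_def)
  have "piece s e (w e i) A \<in> bcontfun" if "e \<in> F" "A \<in> \<A> e i" for e i A
  proof -
    have "continuous_on UNIV (piece s e (w e i) A)"
      unfolding continuous_on_iff
    proof (intro ballI allI impI)
      fix x and d :: real assume d: "0 < d"
      from equi[OF d, of x] obtain \<delta> where \<delta>: "0 < \<delta>" "\<forall>e\<in>F. \<forall>i. \<forall>A\<in>\<A> e i. \<forall>y. dist x y < \<delta> \<longrightarrow>
          cmod (piece s e (w e i) A x - piece s e (w e i) A y) < d" by (elim exE conjE)
      have "cmod (piece s e (w e i) A x - piece s e (w e i) A y) < d" if "dist x y < \<delta>" for y
        using \<delta>(2)[rule_format, OF \<open>e \<in> F\<close> \<open>A \<in> \<A> e i\<close> that] .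
      with \<delta>(1) show "\<exists>\<delta>>0. \<forall>y\<in>UNIV. dist y x < \<delta> \<longrightarrow> dist (piece s e (w e i) A y) (piece s e (w e i) A x) < d"
        by (intro exI[of _ \<delta>]) (simp add: dist_norm[of "piece _ _ _ _ _"] norm_minus_commute dist_commute)
    qed
    then show ?thesis using pb[OF that(1)] by (auto simp: bcontfun_def bounded_iff)
  qed
  then have ap: "apply_bcontfun (Bcontfun (piece s e (w e i) A)) = piece s e (w e i) A" if "e \<in> F" "A \<in> \<A> e i" for e i A
    using that by (simp add: Bcontfun_inverse)
  define F' where "F' i = {Bcontfun (piece s e (w e i) A) | e A. e \<in> F \<and> A \<in> \<A> e i}" for i
  have F'E: "\<exists>e A. e \<in> F \<and> A \<in> \<A> e i \<and> f = Bcontfun (piece s e (w e i) A) \<and> apply_bcontfun f = piece s e (w e i) A"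
    if "f \<in> F' i" for f i
  proof -
    obtain e A where "e \<in> F" "A \<in> \<A> e i" "f = Bcontfun (piece s e (w e i) A)" using \<open>f \<in> F' i\<close> unfolding F'_def by blast
    then show ?thesis using ap[of e A i] by blast
  qed
  have F'I: "piece s e (w e i) A \<in> apply_bcontfun ` F' i" if "e \<in> F" "A \<in> \<A> e i" for e A i
    using ap[OF that] that unfolding F'_def by (intro image_eqI[of _ _ "Bcontfun (piece s e (w e i) A)"]) auto
  obtain \<delta>F where \<delta>F: "0 < \<delta>F" "\<And>e e' x y. \<lbrakk>e \<in> F; e' \<in> F; e \<noteq> e'; apply_bcontfun e x \<noteq> 0; apply_bcontfun e' y \<noteq> 0\<rbrakk> \<Longrightarrow> \<delta>F \<le> dist x y"
    using F unfolding cutdown_sepfam_def by auto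
  have good: "cutdown_sepfam (F' i)" for i
    unfolding cutdown_sepfam_def
  proof (intro conjI ballI allI impI)
    fix f x assume "f \<in> F' i"
    then obtain e A where e: "e \<in> F" and f: "apply_bcontfun f = piece s e (w e i) A" using F'E by blast
    have "apply_bcontfun e x \<in> \<real>\<^sub>\<ge>\<^sub>0" using F e unfolding cutdown_sepfam_def by blast
    moreover have "complex_of_real (w e i x) \<in> \<real>\<^sub>\<ge>\<^sub>0" using w[OF e, of i] by (simp add: sqrt_modulus_def)
    ultimately show "apply_bcontfun f x \<in> \<real>\<^sub>\<ge>\<^sub>0"
      unfolding f piece_def by (auto intro: nonneg_Reals_mult_I)
    show "norm f \<le> 1" using pb[OF e] by (intro norm_bound) (simp add: f)
  next
    fix x and d :: real assume d: "0 < d"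
    from equi[OF d, of x] obtain \<delta> where \<delta>: "0 < \<delta>" "\<forall>e\<in>F. \<forall>i. \<forall>A\<in>\<A> e i. \<forall>y. dist x y < \<delta> \<longrightarrow>
        cmod (piece s e (w e i) A x - piece s e (w e i) A y) < d" by (elim exE conjE)
    show "\<exists>\<delta>>0. \<forall>f\<in>F' i. \<forall>y. dist x y < \<delta> \<longrightarrow> cmod (apply_bcontfun f x - apply_bcontfun f y) < d"
    proof (intro exI[of _ \<delta>] conjI ballI allI impI \<delta>(1))
      fix f y assume "f \<in> F' i" "dist x y < \<delta>"
      moreover from this obtain e A where "e \<in> F" "A \<in> \<A> e i" "apply_bcontfun f = piece s e (w e i) A" using F'E by blast
      ultimately show "cmod (apply_bcontfun f x - apply_bcontfun f y) < d" using \<delta>(2) by simp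
    qed
  next
    show "\<exists>\<delta>>0. \<forall>f\<in>F' i. \<forall>f'\<in>F' i. f \<noteq> f' \<longrightarrow>
        (\<forall>x y. apply_bcontfun f x \<noteq> 0 \<longrightarrow> apply_bcontfun f' y \<noteq> 0 \<longrightarrow> \<delta> \<le> dist x y)"
    proof (intro exI[of _ "min \<delta>F (2 * s)"] conjI ballI allI impI)
      show "0 < min \<delta>F (2 * s)" using \<delta>F s by simp
      fix f f' x y assume ff: "f \<in> F' i" "f' \<in> F' i" "f \<noteq> f'" and nz: "apply_bcontfun f x \<noteq> 0" "apply_bcontfun f' y \<noteq> 0"
      obtain e A where e: "e \<in> F" "A \<in> \<A> e i" "f = Bcontfun (piece s e (w e i) A)" "apply_bcontfun f = piece s e (w e i) A"
        using F'E[OF ff(1)] by blast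
      obtain e' A' where e': "e' \<in> F" "A' \<in> \<A> e' i" "f' = Bcontfun (piece s e' (w e' i) A')" "apply_bcontfun f' = piece s e' (w e' i) A'"
        using F'E[OF ff(2)] by blast
      have nz': "apply_bcontfun e x \<noteq> 0" "x \<in> nbh (2 * s) A" "apply_bcontfun e' y \<noteq> 0" "y \<in> nbh (2 * s) A'"
        using nz unfolding e(4) e'(4) by (auto simp: piece_def split: if_splits)
      show "min \<delta>F (2 * s) \<le> dist x y"
      proof (cases "e = e'")
        case True
        then have "A \<noteq> A'" using ff(3) e(3) e'(3) by auto
        then have "2 * s \<le> dist x y" using sep[OF e(1) e(2), of A' x y] e'(2) nz' True by simp
        then show ?thesis by simp
      next
        case False
        then have "\<delta>F \<le> dist x y" using \<delta>F(2)[OF e(1) e'(1)] nz' by blast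
        then show ?thesis by simp
      qed
    qed
  qed
  show ?thesis
  proof (rule that[of F'])
    show "cutdown_sepfam (F' i)" for i by (rule good)
    show "\<exists>Z\<in>\<Y>. \<forall>x. apply_bcontfun f x \<noteq> 0 \<longrightarrow> x \<in> nbh (2 * s) Z" if f: "f \<in> F' i" for i f
    proof -
      obtain e A where e: "e \<in> F" "A \<in> \<A> e i" "apply_bcontfun f = piece s e (w e i) A" using F'E[OF f] by blast
      then show ?thesis using Y[OF e(1,2)] by (intro bexI[of _ A]) (auto simp: piece_def split: if_splits)
    qed
    fix \<xi> :: "'x \<Rightarrow> 'e" assume \<xi>: "\<xi> \<in> L"
    define T where "T x = blk (apply_bcontfun ` F) b \<xi> x - (blk (apply_bcontfun ` F' True) b \<xi> x
        + blk (apply_bcontfun ` F' False) b \<xi> x)" for x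
    note SF = cutdown_sepfam_sepfam[OF F] and SF' = cutdown_sepfam_sepfam[OF good]
    have TL: "T \<in> L" unfolding T_def by (intro Lp_diff Lp_add blk_bound(1)[OF _ b \<xi>] SF SF')
    define V where "V e = {x. e x \<noteq> 0}" for e :: "'x \<Rightarrow> complex"
    have Vb: "V e \<in> sets borel" if "e \<in> apply_bcontfun ` F" for e
      unfolding V_def by (rule sepfamD(3)[OF SF that])
    have dj: "disjoint_family_on V (apply_bcontfun ` F)"
      unfolding disjoint_family_on_def V_def using sepfam_unique[OF SF] by blast
    have T0: "T x = 0" if "x \<notin> (\<Union>e\<in>apply_bcontfun ` F. V e)" for x
    proof -
      have e0: "apply_bcontfun e x = 0" if "e \<in> F" for e using \<open>x \<notin> _\<close> that by (auto simp: V_def)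
      have "f x = 0" if "f \<in> apply_bcontfun ` F' i" for f i
        using that F'E e0 by (fastforce simp: piece_def)
      moreover have "blk (apply_bcontfun ` F) b \<xi> x = 0" by (rule blk_off) (use e0 in auto)
      ultimately show ?thesis by (simp add: T_def blk_off)
    qed
    \<comment> \<open>The defect is estimated on each carrier \<open>V e'\<close> against
      \<open>\<xi>\<close> on the same carrier, so that the sum over all members of \<open>F\<close>
      leaves the constant unchanged.\<close>
    have main: "res (V e') T \<in> L \<and> N (res (V e') T) \<le> 10 * c * N (res (V e') \<xi>)" if e': "e' \<in> apply_bcontfun ` F" for e'
    proof
      show "res (V e') T \<in> L" by (intro Lp_res TL Vb e')
      obtain e where e: "e \<in> F" "e' = apply_bcontfun e" using e' by blast
      define u where "u = res (V e') \<xi>"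
      have u: "u \<in> L" unfolding u_def by (intro Lp_res \<xi> Vb e')
      define g where "g i x = apply_bcontfun e x * complex_of_real (w e i x)" for i x
      define W where "W i x = complex_of_real (w e i x)" for i x
      have wb: "w e i \<in> borel_measurable borel" for i
      proof (rule borel_measurable_continuous_onI)
        show "continuous_on UNIV (w e i)"
          unfolding continuous_on_iff
        proof (intro ballI allI impI)
          fix x and d :: real assume d: "0 < d"
          then show "\<exists>\<delta>>0. \<forall>y\<in>UNIV. dist y x < \<delta> \<longrightarrow> dist (w e i y) (w e i x) < d"
            using sqrt_modulus_lt[OF w[OF e(1)] s d] s
            by (intro exI[of _ "s * d\<^sup>2"]) (auto simp: dist_real_def)
        qed
      qed
      have w01: "0 \<le> w e i x" "w e i x \<le> 1" for i x using w[OF e(1), of i] by (auto simp: sqrt_modulus_def)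
      have Wb: "W i \<in> borel_measurable borel" "\<And>x. cmod (W i x) \<le> 1" for i
        using wb w01 unfolding W_def by auto
      have gb: "g i \<in> borel_measurable borel" "\<And>x. cmod (g i x) \<le> 1" for i
      proof -
        note [measurable] = bcontfun_borel[of e] wb[of i]
        show "g i \<in> borel_measurable borel" unfolding g_def by measurable
        show "cmod (g i x) \<le> 1" for x
          using mult_mono[OF e1[OF e(1), of x], of "w e i x" 1] w01[of i x] by (auto simp: g_def norm_mult)
      qed
      define G where "G i = (\<lambda>A x. if x \<in> nbh (2 * s) A then g i x else 0) ` \<A> e i" for i
      have G_eq: "G i = piece s e (w e i) ` \<A> e i" for i
        unfolding G_def g_def piece_def by (intro image_cong) auto
      define D where "D i = op_diff (cmul (g i) \<circ> b \<circ> cmul (g i)) (blk (G i) b) u" for i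
      have s2: "0 < 2 * s" using s by simp
      have gcov: "\<exists>A\<in>\<A> e i. x \<in> nbh (2 * s) A" if "g i x \<noteq> 0" for i x
        using cov[OF e(1), of x i] that by (auto simp: g_def)
      have off: "sepfam (G i)" "N (D i) \<le> 4 * c * N u" for i
        unfolding D_def
        by (rule offdiagonal_bound[OF b q c s2 gb[of i] nbh_borel sep[OF e(1)] gcov G_def u]; assumption)+
      have DL: "D i \<in> L" for i
        unfolding D_def by (intro bop_Lp[OF bop_op_diff[OF bop_comp[OF bop_comp[OF bop_cmul[OF gb] b] bop_cmul[OF gb]] bop_blk[OF off(1) b]]] u)
      have eu: "cmul e u \<in> L" "N (cmul e u) \<le> 1 * N u" by (rule Lp_cmul[OF u bcontfun_borel e1[OF e(1)]])+
      note cW = bop_comm[OF b Wb]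
      define H where "H i = cmul (g i) (comm b (W i) (cmul e u))" for i
      have HL: "H i \<in> L" for i unfolding H_def by (intro Lp_cmul(1)[OF _ gb] bop_Lp[OF cW] eu)
      have HN: "N (H i) \<le> c * N u" for i
      proof -
        have "N (H i) \<le> 1 * N (comm b (W i) (cmul e u))"
          unfolding H_def by (intro Lp_cmul(2)[OF _ gb] bop_Lp[OF cW] eu)
        also have "\<dots> \<le> c * N (cmul e u)"
          using com[OF w[OF e(1), of i] wb eu(1)] by (simp add: W_def[abs_def])
        also have "\<dots> \<le> c * N u" using eu(2) c by (intro mult_left_mono) auto
        finally show ?thesis .
      qed
      have blk_eq: "blk (apply_bcontfun ` F' i) b \<xi> x = blk (G i) b u x" if x: "x \<in> V e'" for i x
      proof (cases "\<exists>A\<in>\<A> e i. piece s e (w e i) A x \<noteq> 0")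
        case True
        then obtain A where A: "A \<in> \<A> e i" "piece s e (w e i) A x \<noteq> 0" by blast
        have "cmul (piece s e (w e i) A) u = cmul (piece s e (w e i) A) \<xi>"
          by (auto simp: cmul_def u_def res_def V_def e(2) piece_def fun_eq_iff)
        moreover have "blk (apply_bcontfun ` F' i) b \<xi> x = piece s e (w e i) A x *\<^sub>C b (cmul (piece s e (w e i) A) \<xi>) x"
          by (rule blk_at[OF SF' F'I[OF e(1) A(1)] A(2)])
        moreover have "blk (G i) b u x = piece s e (w e i) A x *\<^sub>C b (cmul (piece s e (w e i) A) u) x"
          by (rule blk_at[OF off(1)[of i]]) (use A G_eq in auto)
        ultimately show ?thesis by simp
      next
        case False
        have "f x = 0" if f: "f \<in> apply_bcontfun ` F' i" for f
        proof (rule ccontr)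
          assume fx: "f x \<noteq> 0"
          obtain e2 A where e2: "e2 \<in> F" "A \<in> \<A> e2 i" "f = piece s e2 (w e2 i) A" using f F'E by blast
          then have "apply_bcontfun e2 x \<noteq> 0" using fx by (auto simp: piece_def split: if_splits)
          then have "apply_bcontfun e2 = apply_bcontfun e"
            using sepfam_unique[OF SF imageI[OF e2(1)] imageI[OF e(1)], of x] x by (simp add: V_def e(2))
          then have "e2 = e" by (simp add: apply_bcontfun_inject)
          then show False using False e2 fx by auto
        qed
        then have "blk (apply_bcontfun ` F' i) b \<xi> x = 0" by (rule blk_off)
        moreover have "blk (G i) b u x = 0" by (rule blk_off) (use False G_eq in auto)
        ultimately show ?thesis by simp
      qed
      have T_eq: "T x = (D True x + D False x) - (H True x + H False x)" if x: "x \<in> V e'" for x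
      proof -
        let ?y = "b (cmul e u) x"
        have cg: "cmul (g i) u = cmul (W i) (cmul e u)" for i
          by (simp add: cmul_def g_def W_def scaleC_scaleC mult.commute)
        have gW: "g i x = e x * W i x" for i by (simp add: g_def W_def)
        have "cmul e \<xi> = cmul e u" by (auto simp: cmul_def u_def res_def V_def e(2) fun_eq_iff)
        then have 1: "blk (apply_bcontfun ` F) b \<xi> x = e x *\<^sub>C ?y"
          using blk_at[OF SF imageI[OF e(1)], of x b \<xi>] x by (simp add: V_def e(2))
        have 2: "D i x - H i x = g i x *\<^sub>C (W i x *\<^sub>C ?y) - blk (G i) b u x" for i
          by (simp add: D_def H_def op_diff_def comm_apply cg cmul_def[of "g i" "b _"] cmul_def[of "g i" "comm _ _ _"]
              scaleC_diff_right)
        have "W True x * W True x + W False x * W False x = complex_of_real ((w e True x)\<^sup>2 + (w e False x)\<^sup>2)"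
          by (simp add: W_def power2_eq_square)
        then have W1: "W True x * W True x + W False x * W False x = 1" using w1[OF e(1)] by simp
        have "g True x *\<^sub>C (W True x *\<^sub>C ?y) + g False x *\<^sub>C (W False x *\<^sub>C ?y)
            = (e x * (W True x * W True x + W False x * W False x)) *\<^sub>C ?y"
          by (simp add: gW scaleC_scaleC distrib_left scaleC_add_left mult.assoc)
        then have 3: "g True x *\<^sub>C (W True x *\<^sub>C ?y) + g False x *\<^sub>C (W False x *\<^sub>C ?y) = e x *\<^sub>C ?y"
          by (simp add: W1)
        have "T x = e x *\<^sub>C ?y - (blk (G True) b u x + blk (G False) b u x)"
          unfolding T_def 1 blk_eq[OF x] ..
        also have "\<dots> = (D True x - H True x) + (D False x - H False x)"
          unfolding 2 3[symmetric] by simp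
        finally show ?thesis by simp
      qed
      have "N (res (V e') T) = N (res (V e') (\<lambda>x. (D True x + D False x) - (H True x + H False x)))"
        using T_eq by (intro arg_cong[of _ _ N]) (auto simp: res_def fun_eq_iff)
      also have "\<dots> \<le> N (\<lambda>x. (D True x + D False x) - (H True x + H False x))"
        by (intro Lp_res Vb e' Lp_diff Lp_add DL HL)
      also have "\<dots> \<le> N (\<lambda>x. D True x + D False x) + N (\<lambda>x. H True x + H False x)"
        by (intro N_diff Lp_add DL HL)
      also have "\<dots> \<le> (N (D True) + N (D False)) + (N (H True) + N (H False))"
        by (intro add_mono N_add DL HL)
      \<comment> \<open>Two off-diagonal errors of \<open>4 * c\<close> and two commutators of
        \<open>c\<close>.\<close>
      also have "\<dots> \<le> 10 * c * N u"
        using off(2)[of True] off(2)[of False] HN[of True] HN[of False] by simp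
      finally show "N (res (V e') T) \<le> 10 * c * N (res (V e') \<xi>)" by (simp add: u_def)
    qed
    have "N T \<le> 10 * c * N \<xi>"
      using Lp_norm_block(2)[OF p sepfam_countable[OF SF] _ dj _ dj _ _ T0 \<xi> main] Vb TL c
      by (auto simp: sets_M Lp_iff)
    then show "N (\<lambda>x. blk (apply_bcontfun ` F) b \<xi> x - (blk (apply_bcontfun ` F' True) b \<xi> x
        + blk (apply_bcontfun ` F' False) b \<xi> x)) \<le> 10 * c * N \<xi>" by (simp add: T_def[abs_def])
  qed
qed


section \<open>Descent along the decompositions\<close>

lemma propagation_le_op_add:
  fixes a b :: "('x, 'e::complex_banach) fun_op"
  assumes "propagation_le M p a R" "propagation_le M p b R'"
  shows "propagation_le M p (op_add a b) (max R R')"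
  unfolding propagation_le_def
proof (intro allI impI ballI)
  fix f f' :: "'x \<Rightarrow>\<^sub>C complex" and \<xi> :: "'x \<Rightarrow> 'e"
  assume far: "far_apart (max R R') (supp f) (supp f')" and \<xi>: "\<xi> \<in> L"
  have far': "far_apart R (supp f) (supp f')" "far_apart R' (supp f) (supp f')"
    using far unfolding far_apart_def by auto
  have "AE x in M. (mult_op f \<circ> a \<circ> mult_op f') \<xi> x = 0" "AE x in M. (mult_op f \<circ> b \<circ> mult_op f') \<xi> x = 0"
    using assms far' \<xi> unfolding propagation_le_def by blast+
  then show "AE x in M. (mult_op f \<circ> op_add a b \<circ> mult_op f') \<xi> x = 0"
    by eventually_elim (simp add: mult_op_def op_add_def scaleC_add_right)
qed

text \<open>Both conclusions hold for every scale beyond \<open>\<sigma>\<close>, so scales can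
  afterwards be enlarged to meet further constraints.\<close>

lemma step_scale:
  fixes b :: "('x, 'e::complex_banach) fun_op"
  assumes b: "bounded_op M p b" and q: "\<And>\<epsilon>. 0 < \<epsilon> \<Longrightarrow> \<exists>R. ql_bound b \<epsilon> R" and c: "0 < c"
  obtains \<sigma> where "0 < \<sigma>" "\<And>s. \<sigma> \<le> s \<Longrightarrow> ql_bound b c (2 * s)"
    "\<And>s w \<xi>. \<lbrakk>\<sigma> \<le> s; sqrt_modulus s w; w \<in> borel_measurable borel; \<xi> \<in> L\<rbrakk>
       \<Longrightarrow> N (comm b (\<lambda>x. complex_of_real (w x)) \<xi>) \<le> c * N \<xi>"
proof -
  obtain R1 where R1: "ql_bound b c R1" using q[OF c] by blast
  obtain R \<delta> where R: "0 < R" "0 < \<delta>" and *: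
    "\<And>Y f \<xi>. \<lbrakk>Y \<in> sets borel; f \<in> borel_measurable borel; \<And>x. \<bar>f x\<bar> \<le> 1;
       \<And>x y. x \<in> Y \<Longrightarrow> y \<in> Y \<Longrightarrow> dist x y < R \<Longrightarrow> \<bar>f x - f y\<bar> \<le> \<delta>; \<xi> \<in> L\<rbrakk>
     \<Longrightarrow> N (res Y (comm b (\<lambda>x. complex_of_real (f x)) (res Y \<xi>))) \<le> c * N \<xi>"
    by (rule commutator_real[OF b q c]) blast+
  \<comment> \<open>\<open>R < s * \<delta>\<^sup>2\<close> makes a weight with modulus
    \<open>sqrt_modulus s\<close> vary by less than \<open>\<delta>\<close> at distance below
    \<open>R\<close>.\<close>
  define \<sigma> where "\<sigma> = max R1 (R / \<delta>\<^sup>2) + 1"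
  have pos: "0 < R / \<delta>\<^sup>2" using R by simp
  show ?thesis
  proof (rule that[of \<sigma>])
    show \<sigma>: "0 < \<sigma>" using pos by (simp add: \<sigma>_def)
    show "ql_bound b c (2 * s)" if "\<sigma> \<le> s" for s
      using that \<sigma> by (intro ql_bound_mono[OF R1]) (simp add: \<sigma>_def)
    fix s w and \<xi> :: "'x \<Rightarrow> 'e"
    assume s: "\<sigma> \<le> s" and w: "sqrt_modulus s w" "w \<in> borel_measurable borel" and \<xi>: "\<xi> \<in> L"
    have s': "0 < s" "R < s * \<delta>\<^sup>2"
    proof -
      show "0 < s" using s \<sigma> by linarith
      have "R / \<delta>\<^sup>2 < s" using s by (simp add: \<sigma>_def)
      then show "R < s * \<delta>\<^sup>2" using R by (simp add: pos_divide_less_eq)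
    qed
    have "\<bar>w x - w y\<bar> \<le> \<delta>" if "dist x y < R" for x y
      using sqrt_modulus_lt[OF w(1) s'(1) R(2), of x y] that s'(2) by simp
    then have "N (res UNIV (comm b (\<lambda>x. complex_of_real (w x)) (res UNIV \<xi>))) \<le> c * N \<xi>"
      using w \<xi> by (intro *) (auto simp: sqrt_modulus_def)
    then show "N (comm b (\<lambda>x. complex_of_real (w x)) \<xi>) \<le> c * N \<xi>" by (simp add: res_def)
  qed
qed

text \<open>Descending along the decompositions, \<open>b\<close> is replaced by \<open>2\<^sup>m\<close> block-diagonal
  operators over uniformly bounded sets.  The scale \<open>s k\<close> of the \<open>k\<close>-th step is chosen so large
  that the step costs at most a quarter of the error \<open>E k\<close> allowed so far; then the two resulting
  operators may be off by \<open>E (k + 1) = E k / 4\<close> each.\<close>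

lemma ql_imp_Roe:
  fixes B :: "('x, 'e::complex_banach) fun_op set"
  assumes B: "banach_subalgebra M p B" and cut: "closed_under_block_cutdowns M p B" and bB: "b \<in> B"
    and q: "\<And>\<epsilon>. 0 < \<epsilon> \<Longrightarrow> \<exists>R. ql_bound b \<epsilon> R" and fdc: "straight_fdc (UNIV :: 'x set)"
  shows "b \<in> Roe M p B"
proof -
  note bop = banach_subalgebraD(1)[OF B]
  have b: "bounded_op M p b" using bop bB by blast
  define P where "P = {a \<in> B. \<exists>R\<ge>0. propagation_le M p a R}"
  have "\<exists>a\<in>P. op_norm M p (op_diff b a) < \<epsilon>" if e: "0 < \<epsilon>" for \<epsilon>
  proof -
    define E where "E k = \<epsilon> / 2 / 4 ^ k" for k :: nat
    have E: "0 < E k" "4 * E (Suc k) = E k" for k using e by (auto simp: E_def)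
    \<comment> \<open>The 10 cancels the factor in \<open>block_step\<close>. A step then costs a
      quarter of \<open>E k\<close> and its two branches another quarter each.\<close>
    define c where "c k = E k / 10" for k
    have c: "0 < c k" "10 * c (Suc k) + 2 * E (Suc k) \<le> E k" for k
      using E(1)[of k] E(2)[of k] by (auto simp: c_def)
    define ok where "ok k \<sigma> \<longleftrightarrow> 0 < \<sigma> \<and> (\<forall>s\<ge>\<sigma>. ql_bound b (c k) (2 * s) \<and>
      (\<forall>w \<xi>. sqrt_modulus s w \<longrightarrow> w \<in> borel_measurable borel \<longrightarrow> \<xi> \<in> L \<longrightarrow>
         N (comm b (\<lambda>x. complex_of_real (w x)) \<xi>) \<le> c k * N \<xi>))" for k \<sigma>
    have "\<exists>\<sigma>. ok k \<sigma>" for k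
    proof -
      obtain \<sigma> where "0 < \<sigma>" "\<And>s. \<sigma> \<le> s \<Longrightarrow> ql_bound b (c k) (2 * s)"
        "\<And>s w \<xi>. \<lbrakk>\<sigma> \<le> s; sqrt_modulus s w; w \<in> borel_measurable borel; \<xi> \<in> L\<rbrakk>
           \<Longrightarrow> N (comm b (\<lambda>x. complex_of_real (w x)) \<xi>) \<le> c k * N \<xi>"
        by (rule step_scale[OF b q c(1)[of k]]) blast+
      then show ?thesis unfolding ok_def by (intro exI[of _ \<sigma>]) simp
    qed
    then have "\<forall>k. \<exists>\<sigma>. ok k \<sigma>" by blast
    from choice[OF this] obtain \<sigma> where \<sigma>: "\<forall>k. ok k (\<sigma> k)" by (rule exE)
    \<comment> \<open>Doubling makes the scales strictly increasing and provides
      \<open>2 * s k \<le> s (Suc k)\<close>, so the margin left by one step is admissible as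
      \<open>t\<close> in the next. No decomposition has been chosen yet.\<close>
    define s where "s = rec_nat 1 (\<lambda>k sk. max (2 * sk) (\<sigma> (Suc k)))"
    have s0: "s 0 = 1" and s_Suc: "s (Suc k) = max (2 * s k) (\<sigma> (Suc k))" for k by (simp_all add: s_def)
    have s_pos: "0 < s k" for k by (induction k) (auto simp: s0 s_Suc max_def)
    have sR: "0 \<le> 6 * s 1 \<and> (\<forall>i\<ge>1. 6 * s i < 6 * s (Suc i))"
    proof (intro conjI allI impI)
      show "0 \<le> 6 * s 1" using s_pos[of 1] by linarith
      show "6 * s i < 6 * s (Suc i)" for i using s_pos[of i] by (simp add: s_Suc)
    qed
    from fdc[unfolded straight_fdc_def, THEN spec[of _ "\<lambda>i. 6 * s i"], THEN mp, OF sR]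
    obtain m and \<X> :: "nat \<Rightarrow> 'x set set" where "\<X> 0 = {UNIV} \<and> (\<forall>i\<le>m. \<X> i \<subseteq> Pow UNIV) \<and>
      (\<forall>i\<in>{1..m}. family_decomposes_over (6 * s i) (\<X> (i - 1)) (\<X> i)) \<and> uniformly_bounded (\<X> m)"
      by (elim exE)
    then have X: "\<X> 0 = {UNIV}"
      "\<And>i. i \<in> {1..m} \<Longrightarrow> family_decomposes_over (6 * s i) (\<X> (i - 1)) (\<X> i)" "uniformly_bounded (\<X> m)"
      by auto
    \<comment> \<open>Supports may exceed the members of \<open>\<X> k\<close> by
      \<open>2 * s k\<close>, the margin produced by \<open>block_step\<close> at scale
      \<open>s k\<close>. The induction runs from \<open>m\<close> down to 0, since finite
      propagation is available at the uniformly bounded end.\<close>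
    define Q where "Q k \<longleftrightarrow> (\<forall>F. cutdown_sepfam F \<longrightarrow>
        (\<forall>e\<in>F. \<exists>Z\<in>\<X> k. \<forall>x. apply_bcontfun e x \<noteq> 0 \<longrightarrow> x \<in> nbh (2 * s k) Z) \<longrightarrow>
        (\<exists>a\<in>P. \<forall>\<xi>\<in>L. N (\<lambda>x. blk (apply_bcontfun ` F) b \<xi> x - a \<xi> x) \<le> E k * N \<xi>))" for k
    have "Q 0"
    proof (rule inc_induct[OF le0, of Q m])
      show "Q m"
        unfolding Q_def
      proof (intro allI impI)
        fix F assume F: "cutdown_sepfam F"
          and Z: "\<forall>e\<in>F. \<exists>Z\<in>\<X> m. \<forall>x. apply_bcontfun e x \<noteq> 0 \<longrightarrow> x \<in> nbh (2 * s m) Z"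
        obtain D where D: "\<And>Y x y. Y \<in> \<X> m \<Longrightarrow> x \<in> Y \<Longrightarrow> y \<in> Y \<Longrightarrow> dist x y \<le> D"
          using X(3) unfolding uniformly_bounded_def by blast
        \<comment> \<open>Both endpoints are within \<open>2 * s m\<close> of points of a single
          member, whose diameter is at most \<open>D\<close>; the maximum secures
          \<open>0 \<le> R\<close>.\<close>
        define R where "R = max 0 (D + 4 * s m)"
        have "propagation_le M p (blk (apply_bcontfun ` F) b) R"
        proof (rule blk_propagation[OF cutdown_sepfam_sepfam[OF F] b])
          fix e' x y assume e': "e' \<in> apply_bcontfun ` F" "e' x \<noteq> 0" "e' y \<noteq> 0"
          then obtain Y where Y: "Y \<in> \<X> m" "x \<in> nbh (2 * s m) Y" "y \<in> nbh (2 * s m) Y" using Z by blast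
          then obtain x' y' where "x' \<in> Y" "dist x' x < 2 * s m" "y' \<in> Y" "dist y' y < 2 * s m" by (auto simp: nbh_iff)
          moreover from this have "dist x' y' \<le> D" using D[OF Y(1)] by blast
          moreover have "dist x y \<le> dist x' x + dist x' y' + dist y' y"
            using dist_triangle[of x y x'] dist_triangle[of x' y y'] by (simp add: dist_commute)
          ultimately show "dist x y \<le> R" by (simp add: R_def)
        qed
        then have "blk (apply_bcontfun ` F) b \<in> P"
          using cutdown_sepfam_blk_in[OF F cut bB b] unfolding P_def by (auto simp: R_def intro!: exI[of _ R])
        then show "\<exists>a\<in>P. \<forall>\<xi>\<in>L. N (\<lambda>x. blk (apply_bcontfun ` F) b \<xi> x - a \<xi> x) \<le> E m * N \<xi>"
          using E(1)[of m] by (intro bexI[of _ "blk (apply_bcontfun ` F) b"]) auto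
      qed
    next
      fix k assume k: "k < m" and IH: "Q (Suc k)"
      have ok: "\<sigma> (Suc k) \<le> s (Suc k)" "2 * s k \<le> s (Suc k)" by (auto simp: s_Suc)
      have qS: "ql_bound b (c (Suc k)) (2 * s (Suc k))" and
        comS: "\<And>w \<xi>. sqrt_modulus (s (Suc k)) w \<Longrightarrow> w \<in> borel_measurable borel \<Longrightarrow> \<xi> \<in> L \<Longrightarrow>
           N (comm b (\<lambda>x. complex_of_real (w x)) \<xi>) \<le> c (Suc k) * N \<xi>"
        using spec[OF \<sigma>, of "Suc k"] ok(1) unfolding ok_def by auto
      have dec: "family_decomposes_over (6 * s (Suc k)) (\<X> k) (\<X> (Suc k))" using X(2)[of "Suc k"] k by simp
      show "Q k"
        unfolding Q_def
      proof (intro allI impI)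
        fix F assume F: "cutdown_sepfam F"
          and Z: "\<forall>e\<in>F. \<exists>Z\<in>\<X> k. \<forall>x. apply_bcontfun e x \<noteq> 0 \<longrightarrow> x \<in> nbh (2 * s k) Z"
        obtain F' :: "bool \<Rightarrow> ('x \<Rightarrow>\<^sub>C complex) set" where F': "\<And>i. cutdown_sepfam (F' i)"
          "\<And>i e. e \<in> F' i \<Longrightarrow> \<exists>Z\<in>\<X> (Suc k). \<forall>x. apply_bcontfun e x \<noteq> 0 \<longrightarrow> x \<in> nbh (2 * s (Suc k)) Z"
          "\<And>\<xi>. \<xi> \<in> L \<Longrightarrow> N (\<lambda>x. blk (apply_bcontfun ` F) b \<xi> x - (blk (apply_bcontfun ` F' True) b \<xi> x
              + blk (apply_bcontfun ` F' False) b \<xi> x)) \<le> 10 * c (Suc k) * N \<xi>"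
          by (rule block_step[OF b F s_pos ok(2) less_imp_le[OF c(1)] bspec[OF Z] dec qS comS]) (assumption | rule that)+
        have "\<exists>a\<in>P. \<forall>\<xi>\<in>L. N (\<lambda>x. blk (apply_bcontfun ` F' i) b \<xi> x - a \<xi> x) \<le> E (Suc k) * N \<xi>" for i
          using IH F'(1)[of i] F'(2)[of _ i] unfolding Q_def by simp
        then have "\<forall>i. \<exists>a. a \<in> P \<and> (\<forall>\<xi>\<in>L. N (\<lambda>x. blk (apply_bcontfun ` F' i) b \<xi> x - a \<xi> x) \<le> E (Suc k) * N \<xi>)"
          by blast
        from choice[OF this] obtain a where a: "\<And>i. a i \<in> P"
          "\<And>i \<xi>. \<xi> \<in> L \<Longrightarrow> N (\<lambda>x. blk (apply_bcontfun ` F' i) b \<xi> x - a i \<xi> x) \<le> E (Suc k) * N \<xi>"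
          by blast
        have ab: "bounded_op M p (a i)" for i using a(1)[of i] bop by (auto simp: P_def)
        define a' where "a' = op_add (a True) (a False)"
        have "a' \<in> P"
        proof -
          obtain R where R: "0 \<le> R" "propagation_le M p (a True) R" using a(1)[of True] by (auto simp: P_def)
          obtain R' where R': "0 \<le> R'" "propagation_le M p (a False) R'" using a(1)[of False] by (auto simp: P_def)
          have "a' \<in> B" unfolding a'_def using a(1) by (intro banach_subalgebraD(2)[OF B]) (auto simp: P_def)
          moreover have "propagation_le M p a' (max R R')" unfolding a'_def by (rule propagation_le_op_add[OF R(2) R'(2)])
          ultimately show ?thesis using R(1) unfolding P_def by (auto intro!: exI[of _ "max R R'"])
        qed
        moreover have "N (\<lambda>x. blk (apply_bcontfun ` F) b \<xi> x - a' \<xi> x) \<le> E k * N \<xi>" if \<xi>: "\<xi> \<in> L" for \<xi>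
        proof -
          define S where "S i x = blk (apply_bcontfun ` F' i) b \<xi> x" for i x
          define T where "T x = blk (apply_bcontfun ` F) b \<xi> x" for x
          have SL: "S i \<in> L" for i
            unfolding S_def by (rule blk_bound(1)[OF cutdown_sepfam_sepfam[OF F'(1)] b \<xi>])
          have TL: "T \<in> L" unfolding T_def by (rule blk_bound(1)[OF cutdown_sepfam_sepfam[OF F] b \<xi>])
          have DL: "(\<lambda>x. S i x - a i \<xi> x) \<in> L" for i by (intro Lp_diff SL bop_Lp[OF ab] \<xi>)
          have T1L: "(\<lambda>x. T x - (S True x + S False x)) \<in> L" by (intro Lp_diff TL Lp_add SL)
          have "N (\<lambda>x. T x - a' \<xi> x) = N (\<lambda>x. (T x - (S True x + S False x))
              + ((S True x - a True \<xi> x) + (S False x - a False \<xi> x)))"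
            by (intro arg_cong[of _ _ N]) (simp add: a'_def op_add_def fun_eq_iff)
          also have "\<dots> \<le> N (\<lambda>x. T x - (S True x + S False x))
              + N (\<lambda>x. (S True x - a True \<xi> x) + (S False x - a False \<xi> x))"
            by (intro N_add T1L Lp_add DL)
          also have "\<dots> \<le> N (\<lambda>x. T x - (S True x + S False x))
              + (N (\<lambda>x. S True x - a True \<xi> x) + N (\<lambda>x. S False x - a False \<xi> x))"
            by (intro add_mono order_refl N_add DL)
          also have "\<dots> \<le> 10 * c (Suc k) * N \<xi> + (E (Suc k) * N \<xi> + E (Suc k) * N \<xi>)"
            unfolding S_def T_def by (intro add_mono F'(3) a(2) \<xi>)
          also have "\<dots> = (10 * c (Suc k) + 2 * E (Suc k)) * N \<xi>" by (simp add: algebra_simps)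
          also have "\<dots> \<le> E k * N \<xi>" by (intro mult_right_mono c(2)) simp
          finally show ?thesis by (simp add: T_def)
        qed
        ultimately show "\<exists>a\<in>P. \<forall>\<xi>\<in>L. N (\<lambda>x. blk (apply_bcontfun ` F) b \<xi> x - a \<xi> x) \<le> E k * N \<xi>" by blast
      qed
    qed
    \<comment> \<open>The cutdown by the single function 1 is \<open>b\<close> itself, so
      \<open>Q 0\<close> applied to it gives the approximation of \<open>b\<close>.\<close>
    define F where "F = {const_bcontfun 1 :: 'x \<Rightarrow>\<^sub>C complex}"
    have ap1: "apply_bcontfun (const_bcontfun 1 :: 'x \<Rightarrow>\<^sub>C complex) = (\<lambda>x. 1)" by (simp add: fun_eq_iff)
    have F: "cutdown_sepfam F"
      unfolding cutdown_sepfam_def F_def by (auto simp: ap1 intro!: norm_bound exI[of _ 1])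
    have "x \<in> nbh (2 * s 0) UNIV" for x :: 'x by (rule nbh_self) (simp_all add: s0)
    then obtain a where a: "a \<in> P" "\<And>\<xi>. \<xi> \<in> L \<Longrightarrow> N (\<lambda>x. blk (apply_bcontfun ` F) b \<xi> x - a \<xi> x) \<le> E 0 * N \<xi>"
      using \<open>Q 0\<close> F X(1) unfolding Q_def by auto
    have "blk (apply_bcontfun ` F) b \<xi> x = b \<xi> x" for \<xi> x
      using blk_at[OF cutdown_sepfam_sepfam[OF F], of "\<lambda>x. 1" x b \<xi>] by (simp add: F_def ap1 scaleC_one cmul_def)
    then have "op_norm M p (op_diff b a) \<le> E 0"
      using a(2) E(1)[of 0] by (intro op_norm_le) (auto simp: op_diff_def)
    also have "\<dots> < \<epsilon>" using e by (simp add: E_def)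
    finally show ?thesis using a(1) by blast
  qed
  then show ?thesis using b unfolding Roe_def op_closure_def P_def by blast
qed

end

section \<open>Assembly of the equivalences\<close>

theorem theorem3p3:
  fixes M :: "'x::metric_space measure"
    and p :: real
    and B :: "('x, 'e::complex_banach) fun_op set"
    and b :: "('x, 'e) fun_op"
  assumes "proper_space (UNIV :: 'x set)"
    and "radon_measure M"
    and "full_support M"
    and "1 \<le> p"
    and "banach_subalgebra M p B"
    and "sandwich UNIV B = B"
    and "closed_under_block_cutdowns M p B"
    and "b \<in> B"
  shows "((\<forall>f\<in>VL. commutes_at_infinity M p b f) \<longleftrightarrow> quasi_local M p b) \<and>
         (quasi_local M p b \<longleftrightarrow> (\<forall>g\<in>higson. commutator b g \<in> K_ideal M p B)) \<and>
         (straight_fdc (UNIV :: 'x set) \<longrightarrow>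
            ((\<forall>g\<in>higson. commutator b g \<in> K_ideal M p B) \<longleftrightarrow> b \<in> Roe M p B))"
proof -
  \<comment> \<open>Any point of the type serves as the centre of the balls.\<close>
  interpret proper_Lp M p undefined
    using assms(1,2,4) by unfold_locales (auto simp: radon_measure_def)
  note bop = banach_subalgebraD(1)[OF assms(5)]
  have b: "bounded_op M p b" using bop assms(8) by blast
  have q: "\<exists>R. ql_bound b \<epsilon> R" if "quasi_local M p b" "0 < \<epsilon>" for \<epsilon>
    using quasi_local_imp_ql_bound[OF b that] by blast
  have 1: "quasi_local M p b" if "\<forall>f\<in>VL. commutes_at_infinity M p b f"
    using commutes_imp_quasi_local[OF b] that by blast
  have 2: "\<forall>f\<in>VL. commutes_at_infinity M p b f" if "quasi_local M p b"
    using ql_imp_commutes[OF b q[OF that]] by blast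
  have 3: "\<forall>g\<in>higson. commutator b g \<in> K_ideal M p B" if "quasi_local M p b"
    using ql_imp_higson[OF assms(5,6,8) q[OF that]] by blast
  have 4: "quasi_local M p b" if "\<forall>g\<in>higson. commutator b g \<in> K_ideal M p B"
    using higson_imp_quasi_local[OF bop b] that by blast
  have 5: "b \<in> Roe M p B" if "straight_fdc (UNIV :: 'x set)" "quasi_local M p b"
    using ql_imp_Roe[OF assms(5,7,8) q[OF that(2)] that(1)] .
  have 6: "quasi_local M p b" if "b \<in> Roe M p B"
    using Roe_imp_quasi_local[OF bop that] .
  show ?thesis using 1 2 3 4 5 6 by blast
qed


end
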